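(* The local averaged Laplacian comparison on Kähler manifolds (statement (Av) in the context) is a local version, in the average sense, of the classical Laplacian comparison theorem (statement (Cl) in the context). However, on Kähler manifolds with Ricci curvature lower bound, the pointwise Laplacian comparison (statement (Pt) in the context) does not hold, even locally.
   Context: $r$ denotes the distance function from a point $p$ of a manifold $M$ and $\Delta r$ its Laplacian. For a Kähler manifold $M$ of complex dimension $n$ and a real number $K$, $N_K$ denotes the complex space form of complex dimension $n$ (the Kähler manifold of constant holomorphic sectional curvature), rescaled so that $Ric=K$; $\Delta_{N_K}r(t)$ is the Laplacian of the distance function from a base point of $N_K$, at points at distance $t$ from it. (Cl) Classical Laplacian comparison: if $M$ is a complete Riemannian manifold of real dimension $d$ with $Ric\ge (d-1)K$ and $M_K$ is the simply connected real space form of sectional curvature $K$, with distance function $r_{M_K}$ from a base point, then $\Delta r(x)\le\Delta r_{M_K}(y)$ for any $x\in M$, $y\in M_K$ with $r(x)=r_{M_K}(y)$. (Av) Local averaged comparison: if $M$ is a Kähler manifold with real analytic metric and $Ric\ge K$, and $p\in M$, then there is $r_0=r_0(p,M)>0$ such that for any $r<r_0$, $\frac{\int_{\partial B_p(r)}\Delta r}{A(\partial B_p(r))}\le\Delta_{N_K}r(r)$, where $A(\partial B_p(r))$ is the area of the geodesic sphere; moreover equality holds iff $M$ is locally isometric to $N_K$. (Pt) Pointwise comparison with Kähler models: if $M$ is a Kähler manifold with $Ric\ge K$ and $p\in M$, then $\Delta r(x)\le\Delta_{N_K}r(r(x))$ at points $x\in M$. "Even locally" means that this fails even when only points $x$ near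 $p$ are considered. *)

theory Defs
  imports "HOL-Analysis.Analysis"
begin

section \<open>Riemannian geometry in a coordinate domain\<close>

text \<open>
  A metric on an open subset of a Euclidean space \<open>'e\<close> is a map \<open>g\<close>, where \<open>g x u v\<close> is the
  inner product of the tangent vectors \<open>u\<close>, \<open>v\<close> at \<open>x\<close>.  Nothing is claimed outside
  the open set under consideration; there the definitions below have junk values.
\<close>

type_synonym 'e metric_field = "'e \<Rightarrow> 'e \<Rightarrow> 'e \<Rightarrow> real"

definition dderiv :: "('e::euclidean_space \<Rightarrow> 'f::real_normed_vector) \<Rightarrow> 'e \<Rightarrow> 'e \<Rightarrow> 'f" where
  "dderiv f x u = frechet_derivative f (at x) u"

definition endo_trace :: "('e::euclidean_space \<Rightarrow> 'e) \<Rightarrow> real" where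
  "endo_trace L = (\<Sum>b\<in>Basis. L b \<bullet> b)"

text \<open>\<open>Ck_on k f S\<close> is meant for open \<open>S\<close>: \<open>f\<close> is \<open>k\<close> times continuously differentiable on \<open>S\<close>.\<close>

primrec Ck_on :: "nat \<Rightarrow> ('e::euclidean_space \<Rightarrow> real) \<Rightarrow> 'e set \<Rightarrow> bool" where
  "Ck_on 0 f S \<longleftrightarrow> continuous_on S f"
| "Ck_on (Suc k) f S \<longleftrightarrow> f differentiable_on S \<and> (\<forall>u. Ck_on k (\<lambda>x. dderiv f x u) S)"

definition smooth_on :: "('e::euclidean_space \<Rightarrow> real) \<Rightarrow> 'e set \<Rightarrow> bool" where
  "smooth_on f S \<longleftrightarrow> (\<forall>k. Ck_on k f S)"

text \<open>
  The Christoffel map of the Levi-Civita connection, given by the Koszul formula for vector fields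
  with constant coefficients.
\<close>

definition christoffel :: "'e::euclidean_space metric_field \<Rightarrow> 'e \<Rightarrow> 'e \<Rightarrow> 'e \<Rightarrow> 'e" where
  "christoffel g x u v = (THE w. \<forall>y. g x w y =
     (dderiv (\<lambda>z. g z v y) x u + dderiv (\<lambda>z. g z u y) x v - dderiv (\<lambda>z. g z u v) x y) / 2)"

text \<open>\<open>covd g X x u\<close> is the covariant derivative of the vector field \<open>X\<close> at \<open>x\<close> in direction \<open>u\<close>.\<close>

definition covd :: "'e::euclidean_space metric_field \<Rightarrow> ('e \<Rightarrow> 'e) \<Rightarrow> 'e \<Rightarrow> 'e \<Rightarrow> 'e" where
  "covd g X x u = dderiv X x u + christoffel g x u (X x)"

text \<open>
  Vector fields with constant coefficients commute, so for them the curvature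
  \<open>R(U,V)W = \<nabla>\<^sub>U\<nabla>\<^sub>V W - \<nabla>\<^sub>V\<nabla>\<^sub>U W - \<nabla>\<^bsub>[U,V]\<^esub>W\<close>
  has no bracket term.
\<close>

definition curvature :: "'e::euclidean_space metric_field \<Rightarrow> 'e \<Rightarrow> 'e \<Rightarrow> 'e \<Rightarrow> 'e \<Rightarrow> 'e" where
  "curvature g x u v w =
     covd g (\<lambda>z. covd g (\<lambda>_. w) z v) x u - covd g (\<lambda>z. covd g (\<lambda>_. w) z u) x v"

definition ricci :: "'e::euclidean_space metric_field \<Rightarrow> 'e \<Rightarrow> 'e \<Rightarrow> 'e \<Rightarrow> real" where
  "ricci g x v w = endo_trace (\<lambda>u. curvature g x u v w)"

definition grad :: "'e::euclidean_space metric_field \<Rightarrow> ('e \<Rightarrow> real) \<Rightarrow> 'e \<Rightarrow> 'e" where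
  "grad g f x = (THE w. \<forall>y. g x w y = dderiv f x y)"

definition diverg :: "'e::euclidean_space metric_field \<Rightarrow> ('e \<Rightarrow> 'e) \<Rightarrow> 'e \<Rightarrow> real" where
  "diverg g X x = endo_trace (covd g X x)"

definition laplace_beltrami :: "'e::euclidean_space metric_field \<Rightarrow> ('e \<Rightarrow> real) \<Rightarrow> 'e \<Rightarrow> real" where
  "laplace_beltrami g f x = diverg g (grad g f) x"


section \<open>Complex manifolds with a Riemannian metric\<close>

text \<open>
  A chart is a domain together with a coordinate map.  \<open>metric_in M c z u v\<close> is the inner product,
  at the point with coordinates \<open>z\<close> in the chart \<open>c\<close>, of the tangent vectors whose coordinate
  representations in \<open>c\<close> are \<open>u\<close> and \<open>v\<close>.  The complex dimension is the cardinality of \<open>'n\<close>.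
  A manifold in the sense below has the cardinality of the continuum, so every type of that
  cardinality can serve as the type \<open>'a\<close> of points for all such manifolds up to isomorphism.
\<close>

type_synonym ('a, 'n) chart = "'a set \<times> ('a \<Rightarrow> complex ^ 'n)"

record ('a, 'n::finite) cmanifold =
  mtop :: "'a topology"
  atlas :: "('a, 'n::finite) chart set"
  metric_in :: "('a, 'n::finite) chart \<Rightarrow> (complex ^ 'n) metric_field"

abbreviation cdom :: "('a, 'n::finite) chart \<Rightarrow> 'a set" where "cdom c \<equiv> fst c"
abbreviation coord :: "('a, 'n::finite) chart \<Rightarrow> 'a \<Rightarrow> complex ^ 'n" where "coord c \<equiv> snd c"
abbreviation cran :: "('a, 'n::finite) chart \<Rightarrow> (complex ^ 'n) set" where "cran c \<equiv> coord c ` cdom c"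
abbreviation cinv :: "('a, 'n::finite) chart \<Rightarrow> complex ^ 'n \<Rightarrow> 'a" where
  "cinv c \<equiv> inv_into (cdom c) (coord c)"
abbreviation points :: "('a, 'n::finite) cmanifold \<Rightarrow> 'a set" where "points M \<equiv> topspace (mtop M)"

definition cplx_J :: "complex ^ 'n::finite \<Rightarrow> complex ^ 'n" where
  "cplx_J v = \<i> *s v"

definition is_chart :: "'a topology \<Rightarrow> ('a, 'n::finite) chart \<Rightarrow> bool" where
  "is_chart X c \<longleftrightarrow> openin X (cdom c) \<and> open (cran c) \<and>
     homeomorphic_map (subtopology X (cdom c)) (top_of_set (cran c)) (coord c)"

text \<open>
  Coordinate changes are differentiable with complex linear derivative, hence biholomorphic, and
  are isometries for the metrics of the two charts.
\<close>

definition compatible_charts ::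
    "('a, 'n::finite) cmanifold \<Rightarrow> ('a, 'n) chart \<Rightarrow> ('a, 'n) chart \<Rightarrow> bool" where
  "compatible_charts M c d \<longleftrightarrow>
     (\<forall>z \<in> coord c ` (cdom c \<inter> cdom d). \<exists>T.
        ((coord d \<circ> cinv c) has_derivative T) (at z) \<and>
        (\<forall>v. T (cplx_J v) = cplx_J (T v)) \<and>
        (\<forall>u v. metric_in M c z u v = metric_in M d ((coord d \<circ> cinv c) z) (T u) (T v)))"

definition hermitian_metric_on :: "(complex ^ 'n::finite) metric_field \<Rightarrow> (complex ^ 'n) set \<Rightarrow> bool" where
  "hermitian_metric_on g S \<longleftrightarrow>
     (\<forall>u v. smooth_on (\<lambda>z. g z u v) S) \<and>
     (\<forall>z\<in>S. bilinear (g z) \<and> (\<forall>u v. g z u v = g z v u) \<and> (\<forall>u. u \<noteq> 0 \<longrightarrow> g z u u > 0) \<and>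
        (\<forall>u v. g z (cplx_J u) (cplx_J v) = g z u v))"

text \<open>The fundamental form \<open>\<omega>(u,v) = g(Ju,v)\<close> is closed.\<close>

definition fundamental_form_closed_on ::
    "(complex ^ 'n::finite) metric_field \<Rightarrow> (complex ^ 'n) set \<Rightarrow> bool" where
  "fundamental_form_closed_on g S \<longleftrightarrow>
     (let \<omega> = (\<lambda>z u v. g z (cplx_J u) v) in
      \<forall>z\<in>S. \<forall>u v w. dderiv (\<lambda>y. \<omega> y v w) z u + dderiv (\<lambda>y. \<omega> y w u) z v + dderiv (\<lambda>y. \<omega> y u v) z w = 0)"

definition kaehler_manifold :: "('a, 'n::finite) cmanifold \<Rightarrow> bool" where
  "kaehler_manifold M \<longleftrightarrow>
     Hausdorff_space (mtop M) \<and> second_countable (mtop M) \<and> connected_space (mtop M) \<and>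
     points M \<noteq> {} \<and> (\<Union>c\<in>atlas M. cdom c) = points M \<and>
     (\<forall>c\<in>atlas M. is_chart (mtop M) c \<and> hermitian_metric_on (metric_in M c) (cran c) \<and>
        fundamental_form_closed_on (metric_in M c) (cran c)) \<and>
     (\<forall>c\<in>atlas M. \<forall>d\<in>atlas M. compatible_charts M c d)"

definition ricci_ge :: "('a, 'n::finite) cmanifold \<Rightarrow> real \<Rightarrow> bool" where
  "ricci_ge M K \<longleftrightarrow> (\<forall>c\<in>atlas M. \<forall>z\<in>cran c. \<forall>v.
     ricci (metric_in M c) z v v \<ge> K * metric_in M c z v v)"

definition ricci_eq :: "('a, 'n::finite) cmanifold \<Rightarrow> real \<Rightarrow> bool" where
  "ricci_eq M K \<longleftrightarrow> (\<forall>c\<in>atlas M. \<forall>z\<in>cran c. \<forall>v w.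
     ricci (metric_in M c) z v w = K * metric_in M c z v w)"

definition constant_holomorphic_sectional_curvature :: "('a, 'n::finite) cmanifold \<Rightarrow> bool" where
  "constant_holomorphic_sectional_curvature M \<longleftrightarrow>
     (\<exists>H. \<forall>c\<in>atlas M. \<forall>z\<in>cran c. \<forall>v. let g = metric_in M c in
        g z (curvature g z v (cplx_J v) (cplx_J v)) v = H * (g z v v)\<^sup>2)"


section \<open>The distance function and its Laplacian\<close>

text \<open>
  The choice of the chart does not affect \<open>laplacian\<close> and \<open>speed\<close>, since the charts of a
  manifold are compatible.
\<close>

definition chart_at :: "('a, 'n::finite) cmanifold \<Rightarrow> 'a \<Rightarrow> ('a, 'n) chart" where
  "chart_at M x = (SOME c. c \<in> atlas M \<and> x \<in> cdom c)"

definition laplacian :: "('a, 'n::finite) cmanifold \<Rightarrow> ('a \<Rightarrow> real) \<Rightarrow> 'a \<Rightarrow> real" where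
  "laplacian M f x = (let c = chart_at M x in
     laplace_beltrami (metric_in M c) (f \<circ> cinv c) (coord c x))"

definition speed :: "('a, 'n::finite) cmanifold \<Rightarrow> (real \<Rightarrow> 'a) \<Rightarrow> real \<Rightarrow> real" where
  "speed M \<gamma> t = (let c = chart_at M (\<gamma> t); v = vector_derivative (coord c \<circ> \<gamma>) (at t) in
     sqrt (metric_in M c (coord c (\<gamma> t)) v v))"

definition smooth_near :: "('a, 'n::finite) cmanifold \<Rightarrow> ('a \<Rightarrow> real) \<Rightarrow> 'a \<Rightarrow> bool" where
  "smooth_near M f x \<longleftrightarrow> (\<exists>c\<in>atlas M. x \<in> cdom c \<and>
     (\<exists>V. open V \<and> V \<subseteq> cran c \<and> coord c x \<in> V \<and> smooth_on (f \<circ> cinv c) V))"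

definition piecewise_C1_curve ::
    "('a, 'n::finite) cmanifold \<Rightarrow> 'a \<Rightarrow> 'a \<Rightarrow> (real \<Rightarrow> 'a) \<Rightarrow> bool" where
  "piecewise_C1_curve M p x \<gamma> \<longleftrightarrow>
     continuous_map (top_of_set {0..1}) (mtop M) \<gamma> \<and> \<gamma> 0 = p \<and> \<gamma> 1 = x \<and>
     (\<exists>S. finite S \<and> (\<forall>c\<in>atlas M.
        (coord c \<circ> \<gamma>) C1_differentiable_on {t \<in> {0<..<1} - S. \<gamma> t \<in> cdom c}))"

text \<open>The derivative may be unbounded near a break point; such a curve may have infinite length.\<close>

definition curve_length :: "('a, 'n::finite) cmanifold \<Rightarrow> (real \<Rightarrow> 'a) \<Rightarrow> ennreal" where
  "curve_length M \<gamma> = (\<integral>\<^sup>+t\<in>{0..1}. ennreal (speed M \<gamma> t) \<partial>lborel)"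

definition rdist :: "('a, 'n::finite) cmanifold \<Rightarrow> 'a \<Rightarrow> 'a \<Rightarrow> real" where
  "rdist M p x = enn2real (INF \<gamma>\<in>Collect (piecewise_C1_curve M p x). curve_length M \<gamma>)"


section \<open>Complex space forms and the pointwise comparison\<close>

definition simply_connected_space :: "'a topology \<Rightarrow> bool" where
  "simply_connected_space X \<longleftrightarrow> path_connected_space X \<and>
     (\<forall>f. continuous_map (top_of_set (sphere (0::complex) 1)) X f \<longrightarrow>
        (\<exists>a\<in>topspace X. homotopic_with (\<lambda>_. True) (top_of_set (sphere (0::complex) 1)) X f (\<lambda>_. a)))"

text \<open>\<open>N\<close> is the complex space form of its dimension, scaled to have Ricci curvature \<open>K\<close>.\<close>

definition complex_space_form :: "('a, 'n::finite) cmanifold \<Rightarrow> real \<Rightarrow> bool" where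
  "complex_space_form N K \<longleftrightarrow>
     kaehler_manifold N \<and> Metric_space.mcomplete (points N) (rdist N) \<and>
     simply_connected_space (mtop N) \<and> constant_holomorphic_sectional_curvature N \<and> ricci_eq N K"

text \<open>
  The comparison of \<open>\<Delta>r\<close> on \<open>M\<close> with \<open>\<Delta>r\<close> on \<open>N\<close>, at points at the same distance less than \<open>\<epsilon>\<close>
  from \<open>p\<close> and \<open>q\<close>.  As usual the Laplacian is only considered where the distance function is
  smooth, which excludes \<open>p\<close>, \<open>q\<close> and cut points.
\<close>

definition pointwise_laplacian_comparison_within ::
    "real \<Rightarrow> ('a, 'n::finite) cmanifold \<Rightarrow> 'a \<Rightarrow> ('b, 'n) cmanifold \<Rightarrow> 'b \<Rightarrow> bool" where
  "pointwise_laplacian_comparison_within \<epsilon> M p N q \<longleftrightarrow>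
     (\<forall>x\<in>points M. \<forall>y\<in>points N.
        rdist M p x = rdist N q y \<and> rdist M p x < \<epsilon> \<and>
        smooth_near M (rdist M p) x \<and> smooth_near N (rdist N q) y \<longrightarrow>
        laplacian M (rdist M p) x \<le> laplacian N (rdist N q) y)"

end

(* The counterexample is the product of two round 2-spheres (a dense open subset of it, with the
   single chart C^2) compared with CP^2, both Kaehler-Einstein with Ric = 6.  Along the diagonal
   geodesic of the product the radial curvature operator has the eigenvalues 3, 3, 0, and along a
   geodesic of CP^2 it has 4, 1, 1.  The Laplacian of r is the sum of sqrt(e) cot(sqrt(e) r) over the
   eigenvalues e (1/r for e = 0), so its expansion at r = 0 involves the power sums of
   the eigenvalues: the first two agree (6 and 18), but the third ones are 54 < 66, and the Laplacian on
   the product is the larger one at order r^5.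

   All distances are explicit.  Half the arccosine of a height function (the overlap of lines, on
   CP^2) is 1-Lipschitz and attains its increment along geodesics; it is singular at the base point
   and the cut locus, so the height is first multiplied by a factor k < 1, and then k tends to 1.
   CP^2 consists of the rank one orthogonal projections of C^3.  Its charts are restricted to the
   points where the homogeneous coordinate of the chart is large, so that near the base point there
   is only one chart.  A loop of lines lifts to a loop in the simply connected 5-sphere. *)

theory Submission
  imports Defs "HOL-Real_Asymp.Real_Asymp"
begin


section \<open>Smooth functions\<close>

text \<open>Near 0, sqrt(e) cot(sqrt(e) r) = 1/r - e r/3 - e^2 r^3/45 - 2 e^3 r^5/945 - ..., so
  larger power sums lower the Laplacian. A geodesic of the product at angle \<phi> to the first
  factor has the eigenvalues 6 cos^2 \<phi>, 6 sin^2 \<phi>, 0. Their squares add up to at least 18,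
  with equality exactly on the diagonals; in every other direction the product has the smaller
  Laplacian close to the base point. So the diagonals are the only directions in which the failure
  persists as r tends to 0. The space form has to be complete and simply connected, so all of CP^2
  is built. The other manifold may be incomplete: leaving out the points at infinity of the spheres
  does not affect the minimal geodesics from 0 to the remaining points. The geometric notions are
  definite descriptions, choices of charts and infima over curves. Each is first evaluated in closed
  form: Christoffel maps and gradients are guessed and certified, and a distance is squeezed between
  a Lipschitz function and an explicit curve.\<close>

lemma dderiv_eq:
  assumes "(f has_derivative f') (at x)"
  shows "dderiv f x u = f' u"
  using frechet_derivative_at[OF assms] by (simp add: dderiv_def)

text \<open>No differentiability is assumed: both functions have the same derivatives at
  \<open>x\<close>, so \<open>frechet_derivative\<close> chooses the same map for both even if there
  is no derivative at all.\<close>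

lemma dderiv_cong_open:
  assumes "open S" "x \<in> S" "\<And>y. y \<in> S \<Longrightarrow> f y = g y"
  shows "dderiv f x u = dderiv g x u"
proof -
  have "(f has_derivative D) (at x) \<longleftrightarrow> (g has_derivative D) (at x)" for D
    using has_derivative_transform_within_open[OF _ assms(1,2)] assms(3) by metis
  then show ?thesis
    by (simp add: dderiv_def frechet_derivative_def)
qed

lemma Ck_on_cong:
  fixes f g :: "'e::euclidean_space \<Rightarrow> real"
  assumes "Ck_on k f S" "open S" "\<And>x. x \<in> S \<Longrightarrow> f x = g x"
  shows "Ck_on k g S"
  using assms
proof (induction k arbitrary: f g)
  case 0
  then show ?case by (simp cong: continuous_on_cong)
next
  case (Suc k)
  have "g differentiable_on S"
    using Suc.prems by (auto simp: differentiable_on_def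
        intro: differentiable_transform_within[where d=1])
  moreover have "Ck_on k (\<lambda>x. dderiv g x u) S" for u
    by (rule Suc.IH[where f = "\<lambda>x. dderiv f x u"])
      (use Suc.prems in \<open>auto intro: dderiv_cong_open\<close>)
  ultimately show ?case by simp
qed

text \<open>Lets a derivative known by a formula replace the choice made in \<open>dderiv\<close>;
  most inductions on the order of differentiability pass through it.\<close>

lemma Ck_on_SucI:
  fixes f :: "'e::euclidean_space \<Rightarrow> real"
  assumes S: "open S" and D: "\<And>x. x \<in> S \<Longrightarrow> (f has_derivative f' x) (at x)"
    and Ck: "\<And>u. Ck_on k (\<lambda>x. f' x u) S"
  shows "Ck_on (Suc k) f S"
proof -
  have "Ck_on k (\<lambda>x. dderiv f x u) S" for u
    by (rule Ck_on_cong[OF Ck[of u] S]) (simp add: dderiv_eq[OF D])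
  moreover have "f differentiable_on S"
    using D by (auto simp: differentiable_on_def differentiable_def intro: has_derivative_at_withinI)
  ultimately show ?thesis by simp
qed

lemma Ck_on_Suc_has_derivative:
  assumes "Ck_on (Suc k) f S" "open S" "x \<in> S"
  shows "(f has_derivative dderiv f x) (at x)"
proof -
  have "f differentiable (at x)"
    using assms by (simp add: differentiable_on_eq_differentiable_at)
  then show ?thesis
    unfolding dderiv_def using frechet_derivative_works by (metis eta_contract_eq)
qed

lemma Ck_on_SucD: "Ck_on (Suc k) f S \<Longrightarrow> Ck_on k f S"
  by (induction k arbitrary: f) (simp_all add: differentiable_imp_continuous_on)

section \<open>Closure of the C^k classes under sums, products and composition\<close>

lemma Ck_on_const:
  fixes S :: "'e::euclidean_space set"
  shows "Ck_on k (\<lambda>_. c) S"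
proof (induction k arbitrary: c)
  case (Suc k)
  have "dderiv (\<lambda>_::'e. c) = (\<lambda>_ _. 0)"
    by (intro ext dderiv_eq has_derivative_const)
  then show ?case using Suc by simp
qed simp

lemma Ck_on_bounded_linear:
  fixes f :: "'e::euclidean_space \<Rightarrow> real"
  assumes "bounded_linear f" "open S"
  shows "Ck_on k f S"
proof (cases k)
  case 0
  then show ?thesis using assms by (simp add: linear_continuous_on)
next
  case (Suc m)
  show ?thesis unfolding Suc
    by (rule Ck_on_SucI[OF \<open>open S\<close> bounded_linear_imp_has_derivative[OF assms(1)] Ck_on_const])
qed

lemma Ck_on_add:
  fixes f g :: "'e::euclidean_space \<Rightarrow> real"
  assumes "Ck_on k f S" "Ck_on k g S" "open S"
  shows "Ck_on k (\<lambda>x. f x + g x) S"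
  using assms
proof (induction k arbitrary: f g)
  case (Suc k)
  show ?case
    by (rule Ck_on_SucI[OF \<open>open S\<close> has_derivative_add[OF Ck_on_Suc_has_derivative Ck_on_Suc_has_derivative]])
      (use Suc in auto)
qed (simp add: continuous_on_add)

lemma Ck_on_mult:
  fixes f g :: "'e::euclidean_space \<Rightarrow> real"
  assumes "Ck_on k f S" "Ck_on k g S" "open S"
  shows "Ck_on k (\<lambda>x. f x * g x) S"
  using assms
proof (induction k arbitrary: f g)
  case (Suc k)
  note f = Ck_on_SucD[OF Suc.prems(1)] and g = Ck_on_SucD[OF Suc.prems(2)]
  show ?case
    by (rule Ck_on_SucI[OF \<open>open S\<close> has_derivative_mult[OF Ck_on_Suc_has_derivative Ck_on_Suc_has_derivative]])
      (use Suc f g in \<open>auto intro!: Ck_on_add\<close>)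
qed (simp add: continuous_on_mult)

text \<open>Induction with \<open>h\<close> arbitrary. By the chain rule the derivative is the
  product of \<open>\<lambda>x. dderiv h (f x) 1\<close>, which the induction hypothesis covers, and
  a directional derivative of \<open>f\<close>.\<close>

lemma Ck_on_compose:
  fixes f :: "'e::euclidean_space \<Rightarrow> real"
  assumes "Ck_on k h I" "open I" "Ck_on k f S" "open S" "f ` S \<subseteq> I"
  shows "Ck_on k (\<lambda>x. h (f x)) S"
  using assms
proof (induction k arbitrary: h)
  case 0
  then show ?case
    using continuous_on_compose2[of I h S f] by simp
next
  case (Suc k)
  have D: "((\<lambda>x. h (f x)) has_derivative (\<lambda>u. dderiv h (f x) 1 * dderiv f x u)) (at x)" if "x \<in> S" for x
  proof -
    have h: "(h has_derivative dderiv h (f x)) (at (f x))"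
      using Ck_on_Suc_has_derivative[OF Suc.prems(1,2)] Suc.prems(5) that by blast
    have "dderiv h (f x) c = dderiv h (f x) 1 * c" for c
      using linear_cmul[OF has_derivative_linear[OF h], of c 1] by simp
    then have "(h has_derivative (\<lambda>c. dderiv h (f x) 1 * c)) (at (f x))"
      using h by (metis (no_types, lifting) ext)
    from has_derivative_compose[OF Ck_on_Suc_has_derivative[OF Suc.prems(3,4) that] this]
    show ?thesis .
  qed
  show ?case
    by (rule Ck_on_SucI[OF \<open>open S\<close> D])
      (use Suc.prems Suc.IH[of "\<lambda>y. dderiv h y 1"] Ck_on_SucD[OF Suc.prems(3)] in \<open>simp_all add: Ck_on_mult\<close>)
qed

lemma Ck_on_real_derivI:
  fixes h :: "real \<Rightarrow> real"
  assumes "open I" "\<And>x. x \<in> I \<Longrightarrow> (h has_field_derivative h' x) (at x)" "Ck_on k h' I"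
  shows "Ck_on (Suc k) h I"
  by (rule Ck_on_SucI[OF \<open>open I\<close> assms(2)[unfolded has_field_derivative_def]])
    (use assms in \<open>auto intro!: Ck_on_mult Ck_on_const\<close>)

lemma smooth_on_const: "smooth_on (\<lambda>_. c) S"
  by (simp add: smooth_on_def Ck_on_const)

lemma smooth_on_bounded_linear: "bounded_linear f \<Longrightarrow> open S \<Longrightarrow> smooth_on f S"
  by (simp add: smooth_on_def Ck_on_bounded_linear)

lemma smooth_on_add:
  "smooth_on f S \<Longrightarrow> smooth_on g S \<Longrightarrow> open S \<Longrightarrow> smooth_on (\<lambda>x. f x + g x) S"
  by (simp add: smooth_on_def Ck_on_add)

lemma smooth_on_mult:
  "smooth_on f S \<Longrightarrow> smooth_on g S \<Longrightarrow> open S \<Longrightarrow> smooth_on (\<lambda>x. f x * g x) S"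
  by (simp add: smooth_on_def Ck_on_mult)

lemma smooth_on_diff:
  assumes "smooth_on f S" "smooth_on g S" "open S"
  shows "smooth_on (\<lambda>x. f x - g x) S"
  using smooth_on_add[OF assms(1) smooth_on_mult[OF smooth_on_const assms(2,3)] assms(3), of "-1"]
  by simp

lemma smooth_on_power:
  "smooth_on f S \<Longrightarrow> open S \<Longrightarrow> smooth_on (\<lambda>x. f x ^ n) S"
  by (induction n) (simp_all add: smooth_on_const smooth_on_mult)

lemma smooth_on_compose:
  "smooth_on h I \<Longrightarrow> open I \<Longrightarrow> smooth_on f S \<Longrightarrow> open S \<Longrightarrow> f ` S \<subseteq> I \<Longrightarrow> smooth_on (\<lambda>x. h (f x)) S"
  unfolding smooth_on_def by (intro allI Ck_on_compose[of _ h I f S]) simp_all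

lemma smooth_on_cong:
  "smooth_on f S \<Longrightarrow> open S \<Longrightarrow> (\<And>x. x \<in> S \<Longrightarrow> f x = g x) \<Longrightarrow> smooth_on g S"
  unfolding smooth_on_def by (intro allI Ck_on_cong[of _ f S g]) simp_all

text \<open>The derivative is a polynomial in \<open>inverse\<close> itself, so C^k bootstraps to
  C^(k+1). For \<open>sqrt\<close> below, the derivative is \<open>inverse (2 * sqrt x)\<close> and
  the same argument works.\<close>

lemma smooth_on_inverse_real: "smooth_on (inverse :: real \<Rightarrow> real) (- {0})"
  unfolding smooth_on_def
proof
  fix k show "Ck_on k (inverse :: real \<Rightarrow> real) (- {0})"
  proof (induction k)
    case (Suc k)
    have "Ck_on k (\<lambda>x::real. - 1 * (inverse x * inverse x)) (- {0})"
      by (intro Ck_on_mult Suc Ck_on_const) auto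
    then show ?case
      by (rule Ck_on_real_derivI[rotated 2]) (auto intro!: derivative_eq_intros)
  qed (simp add: continuous_on_inverse continuous_on_id)
qed

lemma smooth_on_inverse:
  "smooth_on f S \<Longrightarrow> open S \<Longrightarrow> (\<And>x. x \<in> S \<Longrightarrow> f x \<noteq> 0) \<Longrightarrow> smooth_on (\<lambda>x. inverse (f x)) S"
  by (rule smooth_on_compose[OF smooth_on_inverse_real]) auto

lemma smooth_on_divide:
  "smooth_on f S \<Longrightarrow> smooth_on g S \<Longrightarrow> open S \<Longrightarrow> (\<And>x. x \<in> S \<Longrightarrow> g x \<noteq> 0) \<Longrightarrow> smooth_on (\<lambda>x. f x / g x) S"
  unfolding divide_inverse by (rule smooth_on_mult[OF _ smooth_on_inverse])

lemma smooth_on_sqrt_real: "smooth_on sqrt {0<..}"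
  unfolding smooth_on_def
proof
  fix k show "Ck_on k sqrt {0<..}"
  proof (induction k)
    case (Suc k)
    have "Ck_on k inverse (- {0::real})"
      using smooth_on_inverse_real by (simp add: smooth_on_def)
    then have "Ck_on k (\<lambda>x. inverse (2 * sqrt x)) {0<..}"
      by (rule Ck_on_compose) (use Suc Ck_on_const in \<open>auto intro!: Ck_on_mult\<close>)
    moreover have "(sqrt has_field_derivative inverse (2 * sqrt x)) (at x)" if "x \<in> {0<..}" for x
      using DERIV_real_sqrt[of x] that by (simp add: field_simps)
    ultimately show ?case
      by (intro Ck_on_real_derivI) simp_all
  qed (simp add: continuous_on_real_sqrt continuous_on_id)
qed

lemma smooth_on_sqrt:
  "smooth_on f S \<Longrightarrow> open S \<Longrightarrow> (\<And>x. x \<in> S \<Longrightarrow> f x > 0) \<Longrightarrow> smooth_on (\<lambda>x. sqrt (f x)) S"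
  by (rule smooth_on_compose[OF smooth_on_sqrt_real]) auto

lemma smooth_on_arctan_real: "smooth_on arctan UNIV"
  unfolding smooth_on_def
proof
  fix k show "Ck_on k arctan UNIV"
  proof (cases k)
    case (Suc m)
    have "smooth_on (\<lambda>x::real. inverse (1 + x * x)) UNIV"
      by (rule smooth_on_inverse[OF smooth_on_add[OF smooth_on_const smooth_on_mult]])
        (simp_all add: smooth_on_bounded_linear bounded_linear_ident add_pos_nonneg less_imp_neq[THEN not_sym])
    then have "Ck_on m (\<lambda>x::real. inverse (1 + x * x)) UNIV"
      by (simp add: smooth_on_def)
    then show ?thesis unfolding Suc
      by (intro Ck_on_real_derivI) (simp_all add: DERIV_arctan power2_eq_square[symmetric])
  qed (simp add: continuous_on_arctan continuous_on_id)
qed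

lemma smooth_on_arctan:
  "smooth_on f S \<Longrightarrow> open S \<Longrightarrow> smooth_on (\<lambda>x. arctan (f x)) S"
  by (rule smooth_on_compose[OF smooth_on_arctan_real]) auto


section \<open>Connections given by a Christoffel map\<close>

lemma endo_trace_add: "endo_trace (\<lambda>u. F u + G u) = endo_trace F + endo_trace G"
  by (simp add: endo_trace_def inner_add_left sum.distrib)

lemma endo_trace_diff: "endo_trace (\<lambda>u. F u - G u) = endo_trace F - endo_trace G"
  by (simp add: endo_trace_def inner_diff_left sum_subtractf)

lemma endo_trace_minus: "endo_trace (\<lambda>u. - F u) = - endo_trace F"
  by (simp add: endo_trace_def sum_negf)

lemma endo_trace_scaleR: "endo_trace (\<lambda>u. c *\<^sub>R F u) = c * endo_trace F"
  by (simp add: endo_trace_def sum_distrib_left)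

lemma endo_trace_ident: "endo_trace (\<lambda>u::'e::euclidean_space. u) = DIM('e)"
  by (simp add: endo_trace_def)

lemma endo_trace_rank_one: "endo_trace (\<lambda>u. (a \<bullet> u) *\<^sub>R b) = a \<bullet> b"
  by (simp add: endo_trace_def euclidean_inner[of a b] inner_commute)

lemma endo_trace_complex_vec:
  "endo_trace L = (\<Sum>i\<in>UNIV. Re (L (axis i 1) $ i) + Im (L (axis i \<i>) $ i))"
  for L :: "complex ^ 'n \<Rightarrow> complex ^ 'n"
proof -
  have "(Basis :: (complex ^ 'n) set) = (\<Union>i. {axis i 1, axis i \<i>})"
    by (auto simp: Basis_vec_def Basis_complex_def)
  moreover have "(\<Sum>b\<in>(\<Union>i\<in>UNIV. {axis i 1, axis i \<i>}). L b \<bullet> b) =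
      (\<Sum>i\<in>UNIV. \<Sum>b\<in>{axis i 1, axis i \<i>}. L b \<bullet> b)"
    by (intro sum.UNION_disjoint) (auto simp: axis_eq_axis)
  ultimately show ?thesis
    by (simp add: endo_trace_def axis_eq_axis inner_axis inner_complex_def)
qed

text \<open>Complex valued, so that the metrics below are real parts of rational expressions whose
  identities can be checked by field arithmetic; the real part is the inner product of the type
  class.\<close>

definition herm :: "complex ^ 'n::finite \<Rightarrow> complex ^ 'n \<Rightarrow> complex" where
  "herm u v = (\<Sum>i\<in>UNIV. u $ i * cnj (v $ i))"

lemma herm_simps:
  "herm (u + u') v = herm u v + herm u' v" "herm u (v + v') = herm u v + herm u v'"
  "herm (u - u') v = herm u v - herm u' v" "herm u (v - v') = herm u v - herm u v'"
  "herm (- u) v = - herm u v" "herm u (- v) = - herm u v"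
  "herm (c *s u) v = c * herm u v" "herm u (c *s v) = cnj c * herm u v"
  "herm (r *\<^sub>R u) v = of_real r * herm u v" "herm u (r *\<^sub>R v) = of_real r * herm u v"
  "herm 0 v = 0" "herm u 0 = 0"
  by (simp_all add: herm_def algebra_simps sum.distrib sum_distrib_left sum_subtractf sum_negf
      scaleR_conv_of_real[where 'a = complex])

lemma cnj_herm: "cnj (herm u v) = herm v u"
  by (simp add: herm_def mult.commute)

lemma Re_herm: "Re (herm u v) = u \<bullet> v"
  by (simp add: herm_def inner_vec_def inner_complex_def)

lemma herm_self: "herm u u = of_real ((norm u)\<^sup>2)"
  using Re_herm[of u u] cnj_herm[of u u]
  by (simp add: complex_eq_iff power2_norm_eq_inner)

lemma herm_bounded_bilinear: "bounded_bilinear herm"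
proof
  show "\<exists>K. \<forall>u v. norm (herm u v) \<le> norm u * norm v * K"
  proof (intro exI allI)
    fix u v :: "complex ^ 'n"
    have "norm (herm u v) \<le> (\<Sum>i\<in>UNIV. norm (u $ i) * norm (v $ i))"
      unfolding herm_def by (rule order_trans[OF norm_sum]) (simp add: norm_mult)
    also have "\<dots> \<le> (\<Sum>i\<in>(UNIV::'n set). norm u * norm v)"
      by (intro sum_mono mult_mono Finite_Cartesian_Product.norm_nth_le) auto
    finally show "norm (herm u v) \<le> norm u * norm v * CARD('n)"
      by (simp add: mult.commute)
  qed
qed (simp_all add: herm_simps scaleR_conv_of_real[where 'a = complex])

lemma herm_nonneg: "Re (herm u u) \<ge> 0"
  by (simp add: herm_self)

text \<open>The component of \<open>u\<close> orthogonal to \<open>v\<close>, which is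
  \<open>u - c *s v\<close>, has nonnegative squared norm.\<close>

lemma herm_Cauchy_Schwarz: "(norm (herm u v))\<^sup>2 \<le> (norm u)\<^sup>2 * (norm v)\<^sup>2"
proof (cases "v = 0")
  case False
  define c where "c = herm u v / herm v v"
  have v: "herm v v \<noteq> 0" using False by (simp add: herm_self)
  have "herm (u - c *s v) (u - c *s v) = herm u u - herm u v * cnj (herm u v) / herm v v"
    using v by (simp add: herm_simps c_def cnj_herm herm_self[of v] field_simps)
  also have "\<dots> = of_real ((norm u)\<^sup>2 - (norm (herm u v))\<^sup>2 / (norm v)\<^sup>2)"
    by (simp add: herm_self complex_norm_square[symmetric] del: complex_cnj_mult)
  finally have "(norm u)\<^sup>2 - (norm (herm u v))\<^sup>2 / (norm v)\<^sup>2 \<ge> 0"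
    using herm_nonneg[of "u - c *s v"] by simp
  then show ?thesis using False by (simp add: field_simps)
qed (simp add: herm_simps)

text \<open>Since \<open>endo_trace\<close> is a trace over the reals, a complex linear map
  contributes twice the real part of its complex trace and a conjugate linear map contributes
  nothing. This governs the next four lemmas too.\<close>

lemma endo_trace_herm_left: "endo_trace (\<lambda>u. herm u v *s w) = 2 * Re (herm w v)"
  by (simp add: endo_trace_complex_vec herm_def axis_def if_distrib if_distribR cong: if_cong)
    (simp add: sum_distrib_left algebra_simps)

lemma endo_trace_herm_right: "endo_trace (\<lambda>u. herm v u *s w) = 0"
  by (simp add: endo_trace_complex_vec herm_def axis_def if_distrib if_distribR cong: if_cong)

lemma endo_trace_scale: "endo_trace (\<lambda>u::complex ^ 'n. c *s u) = 2 * CARD('n) * Re c"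
  by (simp add: endo_trace_complex_vec)

lemma endo_trace_diag: "endo_trace (\<lambda>u. \<chi> i. c i * u $ i) = 2 * (\<Sum>i\<in>UNIV. Re (c i))"
  by (simp add: endo_trace_complex_vec sum_distrib_left)

lemma endo_trace_conj_diag: "endo_trace (\<lambda>u. \<chi> i. c i * cnj (u $ i)) = 0"
  by (simp add: endo_trace_complex_vec)

text \<open>A certificate for a guessed Christoffel map: a symmetric connection that preserves the
  metric is the Levi-Civita connection, so the definite description in \<open>christoffel\<close>
  can be replaced by the guess.\<close>

locale metric_connection =
  fixes g :: "'e::euclidean_space metric_field" and \<Gamma> :: "'e \<Rightarrow> 'e \<Rightarrow> 'e \<Rightarrow> 'e" and S :: "'e set"
  assumes open_S: "open S"
    and bilinear_g: "z \<in> S \<Longrightarrow> bilinear (g z)"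
    and g_sym: "z \<in> S \<Longrightarrow> g z u v = g z v u"
    and g_pos: "z \<in> S \<Longrightarrow> u \<noteq> 0 \<Longrightarrow> g z u u > 0"
    and \<Gamma>_sym: "z \<in> S \<Longrightarrow> \<Gamma> z u v = \<Gamma> z v u"
    and metric_compatible: "z \<in> S \<Longrightarrow>
      ((\<lambda>x. g x u v) has_derivative (\<lambda>w. g z (\<Gamma> z w u) v + g z u (\<Gamma> z w v))) (at z)"
begin

lemma eq_if_inner_eq:
  assumes "z \<in> S" "\<And>y. g z v y = g z w y"
  shows "v = w"
proof (rule ccontr)
  assume "v \<noteq> w"
  then have "g z (v - w) (v - w) > 0" using g_pos[OF assms(1)] by simp
  then show False using assms(2) by (simp add: bilinear_lsub[OF bilinear_g[OF assms(1)]])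
qed

lemma the_inner_eq:
  assumes "z \<in> S" "\<And>y. g z w y = \<phi> y"
  shows "(THE w. \<forall>y. g z w y = \<phi> y) = w"
  using assms by (intro the_equality) (auto intro: eq_if_inner_eq)

lemma dderiv_metric:
  "z \<in> S \<Longrightarrow> dderiv (\<lambda>x. g x u v) z w = g z (\<Gamma> z w u) v + g z u (\<Gamma> z w v)"
  by (rule dderiv_eq[OF metric_compatible])

text \<open>Compatibility turns the three derivatives of the Koszul formula into six terms. By
  symmetry of \<open>\<Gamma>\<close> and \<open>g\<close>, four of them cancel in pairs and the
  other two agree.\<close>

lemma christoffel_eq:
  assumes "z \<in> S"
  shows "christoffel g z u v = \<Gamma> z u v"
  unfolding christoffel_def
proof (rule the_inner_eq[OF assms])
  fix y
  show "g z (\<Gamma> z u v) y = (dderiv (\<lambda>x. g x v y) z u + dderiv (\<lambda>x. g x u y) z v -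
      dderiv (\<lambda>x. g x u v) z y) / 2"
    unfolding dderiv_metric[OF assms]
      \<Gamma>_sym[OF assms, of v u] \<Gamma>_sym[OF assms, of y] g_sym[OF assms, of v "\<Gamma> z u y"]
    by simp
qed

lemma covd_eq: "z \<in> S \<Longrightarrow> covd g X z u = dderiv X z u + \<Gamma> z u (X z)"
  by (simp add: covd_def christoffel_eq)

lemma covd_const: "z \<in> S \<Longrightarrow> covd g (\<lambda>_. w) z v = \<Gamma> z v w"
  by (simp add: covd_eq dderiv_eq[OF has_derivative_const])

lemma curvature_eq:
  assumes "z \<in> S" "\<And>v w. ((\<lambda>x. \<Gamma> x v w) has_derivative (\<lambda>u. d\<Gamma> u v w)) (at z)"
  shows "curvature g z u v w =
    d\<Gamma> u v w - d\<Gamma> v u w + \<Gamma> z u (\<Gamma> z v w) - \<Gamma> z v (\<Gamma> z u w)"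
proof -
  have "dderiv (\<lambda>x. covd g (\<lambda>_. w) x v) z u = d\<Gamma> u v w" for u v
    using dderiv_cong_open[OF open_S assms(1), of "\<lambda>x. covd g (\<lambda>_. w) x v" "\<lambda>x. \<Gamma> x v w"]
      dderiv_eq[OF assms(2)] by (simp add: covd_const)
  then show ?thesis
    unfolding curvature_def covd_eq[OF assms(1), of "\<lambda>x. covd g (\<lambda>_. w) x _"] covd_const[OF assms(1)]
    by simp
qed

lemma grad_eq:
  assumes "z \<in> S" "(f has_derivative (\<lambda>y. g z w y)) (at z)"
  shows "grad g f z = w"
  unfolding grad_def
  by (rule the_inner_eq[OF assms(1)]) (simp add: dderiv_eq[OF assms(2)])

text \<open>The gradient is differentiated once more, so the candidate \<open>X\<close> has to be
  right on a neighbourhood \<open>V\<close> and not only at \<open>z\<close>.\<close>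

lemma laplace_beltrami_eq:
  assumes "open V" "V \<subseteq> S" "z \<in> V"
    and "\<And>x. x \<in> V \<Longrightarrow> (f has_derivative (\<lambda>y. g x (X x) y)) (at x)"
    and "(X has_derivative X') (at z)"
  shows "laplace_beltrami g f z = endo_trace X' + endo_trace (\<lambda>u. \<Gamma> z u (X z))"
proof -
  have grad: "grad g f x = X x" if "x \<in> V" for x
    using grad_eq assms(2,4) that by blast
  have "dderiv (grad g f) z u = X' u" for u
    using dderiv_cong_open[OF assms(1,3) grad] dderiv_eq[OF assms(5)] by simp
  moreover have "z \<in> S" using assms by blast
  ultimately have "covd g (grad g f) z = (\<lambda>u. X' u + \<Gamma> z u (X z))"
    by (intro ext) (simp add: covd_eq grad[OF assms(3)])
  then show ?thesis
    by (simp add: laplace_beltrami_def diverg_def endo_trace_add)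
qed

end

lemma cplx_J_J: "cplx_J (cplx_J v) = - v"
  by (simp add: cplx_J_def vec_eq_iff)

text \<open>The cyclic sum is the exterior derivative of the fundamental form. For a symmetric
  connection it is the alternation of the covariant derivative, which vanishes when the metric and
  the complex structure are parallel.\<close>

lemma fundamental_form_closed_onI:
  assumes "metric_connection g \<Gamma> S"
    and J: "\<And>z u v. z \<in> S \<Longrightarrow> g z (cplx_J u) (cplx_J v) = g z u v"
    and \<Gamma>J: "\<And>z u v. z \<in> S \<Longrightarrow> \<Gamma> z u (cplx_J v) = cplx_J (\<Gamma> z u v)"
  shows "fundamental_form_closed_on g S"
proof -
  interpret metric_connection g \<Gamma> S by fact
  have anti: "g z (cplx_J u) v = - g z (cplx_J v) u" if "z \<in> S" for z u v
    using J[OF that, of u "cplx_J v"] g_sym[OF that, of "cplx_J v" u]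
    by (simp add: cplx_J_J bilinear_rneg[OF bilinear_g[OF that]])
  show ?thesis
    unfolding fundamental_form_closed_on_def Let_def
  proof (intro ballI allI)
    fix z u v w assume z: "z \<in> S"
    show "dderiv (\<lambda>y. g y (cplx_J v) w) z u + dderiv (\<lambda>y. g y (cplx_J w) u) z v +
      dderiv (\<lambda>y. g y (cplx_J u) v) z w = 0"
      using anti[OF z, of "\<Gamma> z u v" w] anti[OF z, of "\<Gamma> z v w" u] anti[OF z, of "\<Gamma> z w u" v]
      by (simp add: dderiv_metric[OF z] \<Gamma>J[OF z] \<Gamma>_sym[OF z, of v u] \<Gamma>_sym[OF z, of w v]
          \<Gamma>_sym[OF z, of u w])
  qed
qed


section \<open>The Fubini-Study metric in an affine chart\<close>

text \<open>The squared length of the homogeneous coordinates (1, z).\<close>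

definition aff :: "complex ^ 'n::finite \<Rightarrow> complex" where
  "aff z = 1 + herm z z"

text \<open>The complex Hessian of the Kaehler potential log (1 + |z|^2).\<close>

definition fs_herm :: "complex ^ 'n::finite \<Rightarrow> complex ^ 'n \<Rightarrow> complex ^ 'n \<Rightarrow> complex" where
  "fs_herm z u v = herm u v / aff z - herm u z * herm z v / (aff z)\<^sup>2"

definition fs_metric :: "(complex ^ 'n::finite) metric_field" where
  "fs_metric z u v = Re (fs_herm z u v)"

text \<open>In holomorphic coordinates the Christoffel map of a Kaehler metric is g^-1 \<partial>g,
  complex bilinear in \<open>u\<close> and \<open>v\<close>; this is its value for
  \<open>fs_herm\<close>.\<close>

definition fs_conn :: "complex ^ 'n::finite \<Rightarrow> complex ^ 'n \<Rightarrow> complex ^ 'n \<Rightarrow> complex ^ 'n" where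
  "fs_conn z u v = - ((herm u z / aff z) *s v + (herm v z / aff z) *s u)"

lemma aff_eq: "aff z = of_real (1 + (norm z)\<^sup>2)"
  by (simp add: aff_def herm_self)

lemma one_plus_norm_sq_pos: "1 + (norm z)\<^sup>2 > 0"
  by (simp add: add_pos_nonneg)

lemma aff_nonzero [simp]: "aff z \<noteq> 0"
  unfolding aff_eq using one_plus_norm_sq_pos[of z] by (metis of_real_eq_0_iff less_irrefl)

lemma cnj_aff [simp]: "cnj (aff z) = aff z"
  by (simp add: aff_eq)

lemma cnj_fs_herm: "cnj (fs_herm z u v) = fs_herm z v u"
  by (simp add: fs_herm_def cnj_herm mult.commute)

lemma fs_herm_simps:
  "fs_herm z (u + u') v = fs_herm z u v + fs_herm z u' v"
  "fs_herm z u (v + v') = fs_herm z u v + fs_herm z u v'"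
  "fs_herm z (- u) v = - fs_herm z u v" "fs_herm z u (- v) = - fs_herm z u v"
  "fs_herm z (c *s u) v = c * fs_herm z u v" "fs_herm z u (c *s v) = cnj c * fs_herm z u v"
  "fs_herm z (r *\<^sub>R u) v = of_real r * fs_herm z u v" "fs_herm z u (r *\<^sub>R v) = of_real r * fs_herm z u v"
  by (simp_all add: fs_herm_def herm_simps field_simps)

lemma bilinear_fs_metric: "bilinear (fs_metric z)"
  unfolding bilinear_def fs_metric_def
  by (auto intro!: linearI simp: fs_herm_simps)

text \<open>Positivity is Cauchy-Schwarz for \<open>u\<close> and \<open>z\<close>, made strict by
  |z|^2 < 1 + |z|^2.\<close>

lemma fs_metric_pos:
  assumes "u \<noteq> 0"
  shows "fs_metric z u u > 0"
proof -
  have "fs_herm z u u = of_real ((norm u)\<^sup>2 / (1 + (norm z)\<^sup>2) - (norm (herm u z))\<^sup>2 / (1 + (norm z)\<^sup>2)\<^sup>2)"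
    unfolding fs_herm_def cnj_herm[of u z, symmetric] complex_norm_square[symmetric] of_real_power[symmetric]
      mult.commute[of "cnj _"] by (simp add: herm_self aff_eq complex_norm_square)
  then have eq: "fs_metric z u u = (norm u)\<^sup>2 / (1 + (norm z)\<^sup>2) - (norm (herm u z))\<^sup>2 / (1 + (norm z)\<^sup>2)\<^sup>2"
    by (simp add: fs_metric_def)
  have "(norm (herm u z))\<^sup>2 < (norm u)\<^sup>2 * (1 + (norm z)\<^sup>2)"
    using order_le_less_trans[OF herm_Cauchy_Schwarz[of u z], of "(norm u)\<^sup>2 * (1 + (norm z)\<^sup>2)"] assms
    by (simp add: algebra_simps)
  then show ?thesis
    unfolding eq using one_plus_norm_sq_pos[of z]
    by (simp add: pos_divide_less_eq pos_less_divide_eq power2_eq_square[of "1 + (norm z)\<^sup>2"])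
qed

lemma herm_has_derivative_left: "((\<lambda>x. herm x v) has_derivative (\<lambda>w. herm w v)) (at z)"
  by (rule bounded_linear_imp_has_derivative[OF bounded_bilinear.bounded_linear_left[OF herm_bounded_bilinear]])

lemma herm_has_derivative_right: "((\<lambda>x. herm u x) has_derivative (\<lambda>w. herm u w)) (at z)"
  by (rule bounded_linear_imp_has_derivative[OF bounded_bilinear.bounded_linear_right[OF herm_bounded_bilinear]])

lemma aff_has_derivative: "(aff has_derivative (\<lambda>w. herm w z + herm z w)) (at z)"
proof -
  have "((\<lambda>x. 1 + herm x x) has_derivative (\<lambda>w. 0 + (herm z w + herm w z))) (at z)"
    by (intro has_derivative_add has_derivative_const bounded_bilinear.FDERIV[OF herm_bounded_bilinear]
        has_derivative_ident)
  then show ?thesis by (simp add: aff_def[abs_def] add.commute)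
qed

lemma fs_herm_has_derivative:
  "((\<lambda>x. fs_herm x u v) has_derivative
    (\<lambda>w. fs_herm z (fs_conn z w u) v + fs_herm z u (fs_conn z w v))) (at z)"
proof -
  note D1 = has_derivative_divide'[OF has_derivative_const[of "herm u v"] aff_has_derivative aff_nonzero]
  note D2 = has_derivative_divide'[OF has_derivative_mult[OF herm_has_derivative_right[of u]
        herm_has_derivative_left[of v]] has_derivative_power[OF aff_has_derivative, where n = 2]]
  have [simp]: "aff z ^ 2 \<noteq> 0" by simp
  show ?thesis
    unfolding fs_herm_def[of _ u v]
    apply (rule has_derivative_eq_rhs[OF has_derivative_diff[OF D1 D2]])
     apply simp
    apply (rule ext)
    apply (simp add: fs_herm_def fs_conn_def herm_simps cnj_herm)
    apply (simp add: power2_eq_square divide_simps)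
    apply (simp add: algebra_simps power4_eq_xxxx)
    done
qed

interpretation fs: metric_connection fs_metric fs_conn UNIV
proof
  show "bilinear (fs_metric z)" for z :: "complex ^ 'n"
    by (rule bilinear_fs_metric)
  show "((\<lambda>x. fs_metric x u v) has_derivative
      (\<lambda>w. fs_metric z (fs_conn z w u) v + fs_metric z u (fs_conn z w v))) (at z)"
    for z u v :: "complex ^ 'n"
    using has_derivative_Re[OF fs_herm_has_derivative[of u v z]]
    by (simp add: fs_metric_def[abs_def])
  show "fs_metric z u v = fs_metric z v u" for z u v :: "complex ^ 'n"
    unfolding fs_metric_def by (metis cnj_fs_herm complex_cnj(1) complex.sel(1) cnj.sel(1))
qed (simp_all add: fs_metric_pos fs_conn_def add.commute)


text \<open>Written with \<open>fs_herm\<close> so that the curvature emerges in terms of the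
  metric; the remaining products \<open>herm v z * herm u z\<close> cancel there against the
  quadratic terms of the connection.\<close>

lemma fs_conn_has_derivative:
  fixes v w z :: "complex ^ 'n"
  shows "((\<lambda>x. fs_conn x v w) has_derivative
    (\<lambda>u. - ((fs_herm z v u - herm v z * herm u z / (aff z)\<^sup>2) *s w
        + (fs_herm z w u - herm w z * herm u z / (aff z)\<^sup>2) *s v))) (at z)"
proof -
  have D: "((\<lambda>x. (herm v x / aff x) *s w) has_derivative
      (\<lambda>u. (fs_herm z v u - herm v z * herm u z / (aff z)\<^sup>2) *s w)) (at z)" for v w :: "complex ^ 'n"
  proof -
    have lin: "bounded_linear (\<lambda>c. c *s w)"
      unfolding linear_conv_bounded_linear[symmetric]
      by (auto intro!: linearI simp: vec_eq_iff algebra_simps scaleR_conv_of_real[where 'a = complex])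
    have "((\<lambda>x. herm v x / aff x) has_derivative
        (\<lambda>u. fs_herm z v u - herm v z * herm u z / (aff z)\<^sup>2)) (at z)"
      by (rule has_derivative_eq_rhs[OF has_derivative_divide'[OF herm_has_derivative_right aff_has_derivative aff_nonzero]])
        (simp add: fun_eq_iff fs_herm_def field_simps power2_eq_square)
    from bounded_linear.has_derivative[OF lin this] show ?thesis .
  qed
  show ?thesis
    unfolding fs_conn_def by (intro has_derivative_minus has_derivative_add D)
qed

lemma curvature_fs_metric:
  "curvature fs_metric z u v w =
    (fs_herm z u v - fs_herm z v u) *s w - fs_herm z w u *s v + fs_herm z w v *s u"
  unfolding fs.curvature_eq[OF UNIV_I fs_conn_has_derivative]
  apply (simp add: vec_eq_iff)
  apply (simp add: fs_conn_def herm_simps)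
  apply (simp add: algebra_simps power2_eq_square)
  done

text \<open>Of the curvature terms only the two that are complex linear in \<open>u\<close> have a
  trace: one gives 2, the other 2n times the metric. In dimension 2 this is the constant 6.\<close>

lemma ricci_fs_metric:
  "ricci fs_metric z v w = 2 * (real CARD('n) + 1) * fs_metric z v w"
  for z :: "complex ^ 'n"
proof -
  have left: "endo_trace (\<lambda>u. fs_herm z u v *s w) = 2 * fs_metric z w v"
    and right: "endo_trace (\<lambda>u. fs_herm z v u *s w) = 0" for v w :: "complex ^ 'n"
  proof -
    \<comment> \<open>The vector \<open>b\<close> turns the form at \<open>z\<close> into
      \<open>herm\<close> against a fixed vector, to which the trace rules apply.\<close>
    define b where "b = (1 / aff z) *s v - (herm v z / (aff z)\<^sup>2) *s z"
    have b: "fs_herm z u v = herm u b" "fs_herm z v u = herm b u" for u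
      by (simp_all add: fs_herm_def b_def herm_simps cnj_herm)
    show "endo_trace (\<lambda>u. fs_herm z u v *s w) = 2 * fs_metric z w v"
      "endo_trace (\<lambda>u. fs_herm z v u *s w) = 0"
      by (simp_all add: b endo_trace_herm_left endo_trace_herm_right fs_metric_def)
  qed
  show ?thesis
    by (simp add: ricci_def curvature_fs_metric vector_sub_rdistrib endo_trace_add endo_trace_diff
        left right endo_trace_scale fs.g_sym[of z w v] algebra_simps fs_metric_def[of z w v, symmetric])
qed

lemma holomorphic_sectional_curvature_fs_metric:
  "fs_metric z (curvature fs_metric z v (cplx_J v) (cplx_J v)) v = 4 * (fs_metric z v v)\<^sup>2"
proof -
  have "fs_herm z v v = of_real (fs_metric z v v)"
    using cnj_fs_herm[of z v v] by (simp add: complex_eq_iff fs_metric_def)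
  moreover have "curvature fs_metric z v (cplx_J v) (cplx_J v) = (4 * fs_herm z v v) *s v"
    by (simp add: curvature_fs_metric cplx_J_def fs_herm_simps vec_eq_iff algebra_simps)
  ultimately show ?thesis
    by (simp add: fs_metric_def[of z "_ *s _"] fs_herm_simps power2_eq_square)
qed

lemma smooth_on_herm_right:
  assumes "open S"
  shows "smooth_on (\<lambda>x. Re (herm u x)) S" "smooth_on (\<lambda>x. Im (herm u x)) S"
  by (intro smooth_on_bounded_linear[OF _ assms]
      bounded_linear_compose[OF bounded_linear_Re] bounded_linear_compose[OF bounded_linear_Im]
      bounded_bilinear.bounded_linear_right[OF herm_bounded_bilinear])+

lemma smooth_on_norm_power2:
  fixes S :: "'e::euclidean_space set"
  assumes "open S"
  shows "smooth_on (\<lambda>x. (norm x)\<^sup>2) S"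
proof -
  have "smooth_on (\<lambda>x. \<Sum>b\<in>B. (x \<bullet> b)\<^sup>2) S" if "finite B" for B
    using that
    by induction (simp_all add: smooth_on_const smooth_on_add smooth_on_power
        smooth_on_bounded_linear bounded_linear_inner_left assms)
  then show ?thesis
    by (simp add: norm_eq_sqrt_inner euclidean_inner[of x x for x] power2_eq_square finite_Basis sum_nonneg)
qed

lemma hermitian_fs_metric:
  fixes S :: "(complex ^ 'n) set"
  assumes "open S"
  shows "hermitian_metric_on fs_metric S"
  unfolding hermitian_metric_on_def
proof (intro conjI allI ballI impI)
  fix u v :: "complex ^ 'n"
  have "fs_metric x u v = Re (herm u v) / (1 + (norm x)\<^sup>2)
      - (Re (herm u x) * Re (herm v x) + Im (herm u x) * Im (herm v x)) / (1 + (norm x)\<^sup>2)\<^sup>2" for x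
    unfolding fs_metric_def fs_herm_def aff_eq cnj_herm[of v x, symmetric]
    by (simp flip: of_real_power)
  moreover have "smooth_on (\<lambda>x. Re (herm u v) / (1 + (norm x)\<^sup>2)
      - (Re (herm u x) * Re (herm v x) + Im (herm u x) * Im (herm v x)) / (1 + (norm x)\<^sup>2)\<^sup>2) S"
    using one_plus_norm_sq_pos[THEN less_imp_neq, THEN not_sym]
    by (intro smooth_on_diff smooth_on_divide smooth_on_add smooth_on_mult smooth_on_const smooth_on_power
        smooth_on_norm_power2 smooth_on_herm_right assms) auto
  ultimately show "smooth_on (\<lambda>z. fs_metric z u v) S" by simp
next
  fix z u v
  show "fs_metric z (cplx_J u) (cplx_J v) = fs_metric z u v"
    by (simp add: fs_metric_def cplx_J_def fs_herm_simps)
qed (auto simp: bilinear_fs_metric fs_metric_pos fs.g_sym)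

lemma metric_connection_subset: "metric_connection g \<Gamma> S \<Longrightarrow> open T \<Longrightarrow> T \<subseteq> S \<Longrightarrow> metric_connection g \<Gamma> T"
  unfolding metric_connection_def by blast

lemma fundamental_form_closed_fs_metric:
  assumes "open S"
  shows "fundamental_form_closed_on fs_metric S"
proof (rule fundamental_form_closed_onI)
  show "metric_connection fs_metric fs_conn S"
    using metric_connection_subset[OF fs.metric_connection_axioms assms] by simp
  show "fs_metric z (cplx_J u) (cplx_J v) = fs_metric z u v" for z u v
    by (simp add: fs_metric_def cplx_J_def fs_herm_simps)
  show "fs_conn z u (cplx_J v) = cplx_J (fs_conn z u v)" for z u v
    by (simp add: fs_conn_def cplx_J_def vec_eq_iff herm_simps algebra_simps)
qed


section \<open>Products of round spheres\<close>

definition saff :: "complex \<Rightarrow> complex" where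
  "saff \<zeta> = 1 + \<zeta> * cnj \<zeta>"

definition sph_herm :: "complex ^ 'n::finite \<Rightarrow> complex ^ 'n \<Rightarrow> complex ^ 'n \<Rightarrow> complex" where
  "sph_herm z u v = (\<Sum>i\<in>UNIV. u $ i * cnj (v $ i) / (saff (z $ i))\<^sup>2)"

text \<open>In stereographic coordinates |d\<zeta>|^2 / (1 + |\<zeta>|^2)^2 is the round sphere of
  curvature 4. The factor 2/3 raises the curvature to 6, the Ricci constant of the Fubini-Study
  metric in dimension 2.\<close>

definition sph_metric :: "(complex ^ 'n::finite) metric_field" where
  "sph_metric z u v = 2 / 3 * Re (sph_herm z u v)"

definition sph_conn :: "complex ^ 'n::finite \<Rightarrow> complex ^ 'n \<Rightarrow> complex ^ 'n \<Rightarrow> complex ^ 'n" where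
  "sph_conn z u v = (\<chi> i. - 2 * cnj (z $ i) * u $ i * v $ i / saff (z $ i))"

lemma saff_eq: "saff \<zeta> = of_real (1 + (norm \<zeta>)\<^sup>2)"
  unfolding saff_def complex_norm_square[symmetric] by simp

lemma saff_nonzero [simp]: "saff \<zeta> \<noteq> 0"
  unfolding saff_eq using one_plus_norm_sq_pos[of \<zeta>] by (metis of_real_eq_0_iff less_irrefl)

lemma cnj_saff [simp]: "cnj (saff \<zeta>) = saff \<zeta>"
  by (simp add: saff_eq)

lemma sph_metric_eq: "sph_metric z u v = 2 / 3 * (\<Sum>i\<in>UNIV. (u $ i \<bullet> v $ i) / (1 + (norm (z $ i))\<^sup>2)\<^sup>2)"
  unfolding sph_metric_def sph_herm_def saff_eq
  by (simp add: inner_complex_def flip: of_real_power)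

lemma bilinear_sph_metric: "bilinear (sph_metric z)"
  unfolding bilinear_def sph_metric_eq
  by (auto intro!: linearI simp: inner_add_left inner_add_right add_divide_distrib sum.distrib algebra_simps
      sum_distrib_left)

lemma sph_metric_pos:
  assumes "u \<noteq> 0"
  shows "sph_metric z u u > 0"
proof -
  obtain i where "u $ i \<noteq> 0" using assms by (auto simp: vec_eq_iff)
  then have "(\<Sum>i\<in>UNIV. (u $ i \<bullet> u $ i) / (1 + (norm (z $ i))\<^sup>2)\<^sup>2) > 0"
    using one_plus_norm_sq_pos by (intro sum_pos2[of _ i]) (auto intro!: divide_pos_pos zero_less_power)
  then show ?thesis by (simp add: sph_metric_eq)
qed

lemma vec_lambda_has_derivative:
  fixes f :: "'e::real_normed_vector \<Rightarrow> 'n::finite \<Rightarrow> complex"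
  assumes "\<And>i. ((\<lambda>x. f x i) has_derivative (\<lambda>u. f' u i)) (at z)"
  shows "((\<lambda>x. \<chi> i. f x i) has_derivative (\<lambda>u. \<chi> i. f' u i)) (at z)"
proof -
  have lin: "bounded_linear (axis i :: complex \<Rightarrow> complex ^ 'n)" for i
    unfolding linear_conv_bounded_linear[symmetric] by (auto intro!: linearI simp: vec_eq_iff axis_def)
  have eq: "(\<chi> i. c i) = (\<Sum>i\<in>UNIV. axis i (c i))" for c :: "'n \<Rightarrow> complex"
    by (simp add: vec_eq_iff axis_def sum.delta)
  show ?thesis
    unfolding eq by (intro has_derivative_sum bounded_linear.has_derivative[OF lin] assms)
qed

lemma nth_has_derivative: "((\<lambda>x. x $ i) has_derivative (\<lambda>w. w $ i)) (at z)"
  by (rule bounded_linear_imp_has_derivative[OF bounded_linear_vec_nth])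

lemma cnj_nth_has_derivative: "((\<lambda>x. cnj (x $ i)) has_derivative (\<lambda>w. cnj (w $ i))) (at z)"
  by (rule has_derivative_cnj[OF nth_has_derivative])

lemma saff_has_derivative:
  "((\<lambda>x. saff (x $ i)) has_derivative (\<lambda>w. w $ i * cnj (z $ i) + z $ i * cnj (w $ i))) (at z)"
proof -
  have "((\<lambda>x. 1 + x $ i * cnj (x $ i)) has_derivative
      (\<lambda>w. 0 + (z $ i * cnj (w $ i) + w $ i * cnj (z $ i)))) (at z)"
    by (intro has_derivative_add has_derivative_const has_derivative_mult nth_has_derivative cnj_nth_has_derivative)
  then show ?thesis by (simp add: saff_def add.commute)
qed

lemma sph_herm_has_derivative:
  "((\<lambda>x. sph_herm x u v) has_derivative
    (\<lambda>w. sph_herm z (sph_conn z w u) v + sph_herm z u (sph_conn z w v))) (at z)"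
proof -
  have [simp]: "saff \<zeta> ^ 2 \<noteq> 0" for \<zeta> by simp
  note D = has_derivative_divide'[OF has_derivative_const
      has_derivative_power[OF saff_has_derivative, where n = 2]]
  have "((\<lambda>x. u $ i * cnj (v $ i) / (saff (x $ i))\<^sup>2) has_derivative
      (\<lambda>w. sph_conn z w u $ i * cnj (v $ i) / (saff (z $ i))\<^sup>2 +
        u $ i * cnj (sph_conn z w v $ i) / (saff (z $ i))\<^sup>2)) (at z)" for i
    apply (rule has_derivative_eq_rhs[OF D[of z i]])
     apply simp
    apply (rule ext)
    apply (simp add: sph_conn_def power2_eq_square divide_simps)
    apply (simp add: algebra_simps)
    done
  from has_derivative_sum[where I = UNIV, OF this] show ?thesis
    by (simp add: sph_herm_def sum.distrib)
qed

interpretation sph: metric_connection sph_metric sph_conn UNIV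
proof
  show "bilinear (sph_metric z)" for z :: "complex ^ 'n"
    by (rule bilinear_sph_metric)
  show "((\<lambda>x. sph_metric x u v) has_derivative
      (\<lambda>w. sph_metric z (sph_conn z w u) v + sph_metric z u (sph_conn z w v))) (at z)"
    for z u v :: "complex ^ 'n"
    using has_derivative_mult_right[OF has_derivative_Re[OF sph_herm_has_derivative[of u v z]], of "2 / 3"]
    by (simp add: sph_metric_def[abs_def] distrib_left)
  show "sph_metric z u v = sph_metric z v u" for z u v :: "complex ^ 'n"
    by (simp add: sph_metric_eq inner_commute)
qed (simp_all add: sph_metric_pos sph_conn_def mult.commute mult.left_commute)

lemma sph_conn_has_derivative:
  "((\<lambda>x. sph_conn x v w) has_derivative
    (\<lambda>u. \<chi> i. - 2 * v $ i * w $ i * (cnj (u $ i) / saff (z $ i)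
      - cnj (z $ i) * (u $ i * cnj (z $ i) + z $ i * cnj (u $ i)) / (saff (z $ i))\<^sup>2))) (at z)"
  unfolding sph_conn_def
proof (rule vec_lambda_has_derivative)
  fix i
  have "((\<lambda>x. (- 2 * v $ i * w $ i) * (cnj (x $ i) / saff (x $ i))) has_derivative
    (\<lambda>u. (- 2 * v $ i * w $ i) * ((cnj (u $ i) * saff (z $ i)
      - cnj (z $ i) * (u $ i * cnj (z $ i) + z $ i * cnj (u $ i))) / (saff (z $ i) * saff (z $ i))))) (at z)"
    by (intro has_derivative_mult_right has_derivative_divide'[OF cnj_nth_has_derivative saff_has_derivative saff_nonzero])
  then show "((\<lambda>x. - 2 * cnj (x $ i) * v $ i * w $ i / saff (x $ i)) has_derivative
    (\<lambda>u. - 2 * v $ i * w $ i * (cnj (u $ i) / saff (z $ i)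
      - cnj (z $ i) * (u $ i * cnj (z $ i) + z $ i * cnj (u $ i)) / (saff (z $ i))\<^sup>2))) (at z)"
    by (simp add: diff_divide_distrib power2_eq_square mult_ac)
qed

lemma curvature_sph_metric:
  "curvature sph_metric z u v w =
    (\<chi> i. (2 * cnj (v $ i) * w $ i / (saff (z $ i))\<^sup>2) * u $ i) -
    (\<chi> i. (2 * v $ i * w $ i / (saff (z $ i))\<^sup>2) * cnj (u $ i))"
  unfolding sph.curvature_eq[OF UNIV_I sph_conn_has_derivative]
  apply (simp add: vec_eq_iff sph_conn_def)
  apply (simp add: power2_eq_square divide_simps)
  apply (simp add: saff_def algebra_simps)
  done

text \<open>The conjugate linear half of the curvature has no trace. What remains is four times the
  real part of \<open>sph_herm\<close>, whatever the scale of the metric, and the factor 2/3 makes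
  it 6 times the metric.\<close>

lemma ricci_sph_metric: "ricci sph_metric z v w = 6 * sph_metric z v w"
proof -
  have "ricci sph_metric z v w = 2 * Re (\<Sum>i\<in>UNIV. 2 * cnj (v $ i) * w $ i / (saff (z $ i))\<^sup>2)"
    unfolding ricci_def curvature_sph_metric endo_trace_diff endo_trace_diag endo_trace_conj_diag by simp
  also have "(\<Sum>i\<in>UNIV. 2 * cnj (v $ i) * w $ i / (saff (z $ i))\<^sup>2) = 2 * sph_herm z w v"
    by (simp add: sph_herm_def sum_distrib_left mult_ac)
  also have "2 * Re (2 * sph_herm z w v) = 4 * Re (sph_herm z w v)" by simp
  finally show ?thesis by (simp add: sph_metric_def[of z w v] sph.g_sym[of z v w])
qed

lemma hermitian_sph_metric: "open S \<Longrightarrow> hermitian_metric_on sph_metric S"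
  unfolding hermitian_metric_on_def
proof (intro conjI allI ballI impI)
  fix u v :: "complex ^ 'n" and S :: "(complex ^ 'n) set"
  assume S: "open S"
  have "smooth_on (\<lambda>x. Re (x $ i)) S" "smooth_on (\<lambda>x. Im (x $ i)) S" for i
    by (intro smooth_on_bounded_linear[OF _ S] bounded_linear_compose[OF bounded_linear_Re bounded_linear_vec_nth]
      bounded_linear_compose[OF bounded_linear_Im bounded_linear_vec_nth])+
  then have nrm: "smooth_on (\<lambda>x. (norm (x $ i))\<^sup>2) S" for i
    unfolding cmod_power2 by (intro smooth_on_add smooth_on_power S)
  have "smooth_on (\<lambda>z. \<Sum>i\<in>I. (u $ i \<bullet> v $ i) / (1 + (norm (z $ i))\<^sup>2)\<^sup>2) S" if "finite I" for I
    using that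
  proof induction
    case (insert i I)
    have "smooth_on (\<lambda>z. (u $ i \<bullet> v $ i) / (1 + (norm (z $ i))\<^sup>2)\<^sup>2) S"
      using one_plus_norm_sq_pos[THEN less_imp_neq, THEN not_sym]
      by (intro smooth_on_divide smooth_on_add smooth_on_const smooth_on_power nrm S) auto
    then show ?case using insert by (simp add: smooth_on_add S)
  qed (simp add: smooth_on_const)
  then show "smooth_on (\<lambda>z. sph_metric z u v) S"
    unfolding sph_metric_eq by (intro smooth_on_mult smooth_on_const S) simp
next
  fix z u v :: "complex ^ 'n"
  have "sph_herm z (cplx_J u) (cplx_J v) = sph_herm z u v"
    unfolding sph_herm_def cplx_J_def by (intro sum.cong) (auto simp: mult_ac)
  then show "sph_metric z (cplx_J u) (cplx_J v) = sph_metric z u v"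
    by (simp add: sph_metric_def)
qed (auto simp: bilinear_sph_metric sph_metric_pos sph.g_sym)

lemma fundamental_form_closed_sph_metric:
  assumes "open S"
  shows "fundamental_form_closed_on sph_metric S"
proof (rule fundamental_form_closed_onI)
  show "metric_connection sph_metric sph_conn S"
    using metric_connection_subset[OF sph.metric_connection_axioms assms] by simp
  show "sph_metric z (cplx_J u) (cplx_J v) = sph_metric z u v" for z u v
    using hermitian_sph_metric[OF open_UNIV] unfolding hermitian_metric_on_def by blast
  show "sph_conn z u (cplx_J v) = cplx_J (sph_conn z u v)" for z u v
    by (simp add: sph_conn_def cplx_J_def vec_eq_iff)
qed

section \<open>The product of two spheres as a Kaehler manifold\<close>

lemma second_countable_euclidean: "second_countable (euclidean :: 'a::second_countable_topology topology)"
proof -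
  obtain B :: "'a set set" where B: "countable B" "topological_basis B"
    using ex_countable_basis by blast
  then have "\<exists>V\<in>B. x \<in> V \<and> V \<subseteq> U" if "open U" "x \<in> U" for U x
    using topological_basisE[OF B(2) that] by metis
  with B show ?thesis
    unfolding second_countable_def by (intro exI[of _ B]) (simp add: topological_basis_open)
qed

definition sphere_product :: "(complex ^ 2, 2) cmanifold" where
  "sphere_product = \<lparr>mtop = euclidean, atlas = {(UNIV, id)}, metric_in = (\<lambda>_. sph_metric)\<rparr>"

lemma kaehler_sphere_product: "kaehler_manifold sphere_product"
  unfolding kaehler_manifold_def
proof (intro conjI ballI)
  show "second_countable (mtop sphere_product)"
    by (simp add: sphere_product_def second_countable_euclidean)
  show "connected_space (mtop sphere_product)"
    using connected_UNIV by (simp add: sphere_product_def flip: connectedin_topspace)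
  fix c d assume "c \<in> atlas sphere_product"
  then have c: "c = (UNIV, id)" by (simp add: sphere_product_def)
  show "is_chart (mtop sphere_product) c"
    by (simp add: c sphere_product_def is_chart_def homeomorphic_map_id)
  show "hermitian_metric_on (metric_in sphere_product c) (cran c)"
    by (simp add: c sphere_product_def hermitian_sph_metric)
  show "fundamental_form_closed_on (metric_in sphere_product c) (cran c)"
    by (simp add: c sphere_product_def fundamental_form_closed_sph_metric)
  assume "d \<in> atlas sphere_product"
  then have d: "d = (UNIV, id)" by (simp add: sphere_product_def)
  have "inv_into UNIV id = (id :: complex ^ 2 \<Rightarrow> _)" by (simp flip: id_def)
  then have "((coord d \<circ> cinv c) has_derivative (\<lambda>v. v)) (at z)" for z
    by (simp add: c d o_def has_derivative_ident)
  then show "compatible_charts sphere_product c d"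
    unfolding compatible_charts_def by (intro ballI exI[of _ "\<lambda>v. v"])
      (simp_all add: c d sphere_product_def)
qed (simp_all add: sphere_product_def)

lemma ricci_ge_sphere_product: "ricci_ge sphere_product 6"
  by (simp add: ricci_ge_def sphere_product_def ricci_sph_metric)


section \<open>Lower bounds for the length of a curve\<close>

text \<open>If the right-hand side is infinite, there is nothing to show. Otherwise the derivative
  is absolutely integrable, and its Lebesgue integral agrees with the gauge integral of the
  fundamental theorem, which tolerates break points and unbounded derivatives.\<close>

lemma increment_le_nn_integral:
  fixes \<phi> \<sigma> :: "real \<Rightarrow> real"
  assumes cont: "continuous_on {0..1} \<phi>" and S: "finite S"
    and deriv: "\<And>t. t \<in> {0<..<1} - S \<Longrightarrow> (\<phi> has_real_derivative D t) (at t)"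
    and bound: "\<And>t. t \<in> {0<..<1} - S \<Longrightarrow> \<bar>D t\<bar> \<le> \<sigma> t"
  shows "ennreal (\<phi> 1 - \<phi> 0) \<le> (\<integral>\<^sup>+t\<in>{0..1}. ennreal (\<sigma> t) \<partial>lborel)"
proof -
  define T where "T = {0<..<1} - S"
  define E where "E t = indicator T t * D t" for t
  \<comment> \<open>Clamping the argument extends \<phi> to a continuous function on the line, whose
    difference quotients are Borel.\<close>
  define \<psi> where "\<psi> t = \<phi> (max 0 (min 1 t))" for t
  have T: "T \<in> sets borel" unfolding T_def using S by (intro sets.Diff borel_open borel_closed finite_imp_closed) auto
  have "continuous_on UNIV \<psi>"
    unfolding \<psi>_def by (rule continuous_on_compose2[OF cont]) (auto intro!: continuous_intros)
  then have [measurable]: "\<psi> \<in> borel_measurable borel" by (rule borel_measurable_continuous_onI)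
  \<comment> \<open>The derivative is a pointwise limit of difference quotients.\<close>
  have E_meas: "E \<in> borel_measurable borel"
  proof (rule borel_measurable_LIMSEQ_real)
    show "(\<lambda>t. indicator T t * ((\<psi> (t + inverse (real (Suc n))) - \<psi> t) / inverse (real (Suc n)))) \<in> borel_measurable borel" for n
      using T by measurable
    fix t
    show "(\<lambda>n. indicator T t * ((\<psi> (t + inverse (real (Suc n))) - \<psi> t) / inverse (real (Suc n)))) \<longlonglongrightarrow> E t"
    proof (cases "t \<in> T")
      case True
      have "(\<psi> has_real_derivative D t) (at t)"
      proof (rule has_field_derivative_transform_within_open)
        show "(\<phi> has_real_derivative D t) (at t)" "open {0<..<1::real}" "t \<in> {0<..<1}"
          using True deriv by (auto simp: T_def)
      qed (simp add: \<psi>_def)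
      then have "((\<lambda>h. (\<psi> (t + h) - \<psi> t) / h) \<longlongrightarrow> D t) (at 0)"
        by (simp add: has_field_derivative_def has_derivative_at DERIV_def flip: has_field_derivative_def)
      moreover have "filterlim (\<lambda>n. inverse (real (Suc n))) (at 0) sequentially"
        using LIMSEQ_inverse_real_of_nat by (simp add: filterlim_at)
      ultimately have "(\<lambda>n. (\<psi> (t + inverse (real (Suc n))) - \<psi> t) / inverse (real (Suc n))) \<longlonglongrightarrow> D t"
        by (rule filterlim_compose)
      then show ?thesis using True by (simp add: E_def)
    qed (simp add: E_def)
  qed
  have int: "(E has_integral (\<phi> 1 - \<phi> 0)) {0..1}"
  proof (rule fundamental_theorem_of_calculus_interior_strong[OF S _ _ cont])
    fix t :: real assume "t \<in> {0<..<1} - S"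
    then show "(\<phi> has_vector_derivative E t) (at t)"
      using deriv[of t] by (simp add: E_def T_def has_real_derivative_iff_has_vector_derivative)
  qed simp
  \<comment> \<open>Only monotonicity is used, so no measurability of \<sigma> enters; in the
    applications it is a speed defined through arbitrarily chosen charts.\<close>
  have le: "(\<integral>\<^sup>+t. ennreal \<bar>E t\<bar> \<partial>lborel) \<le> (\<integral>\<^sup>+t\<in>{0..1}. ennreal (\<sigma> t) \<partial>lborel)"
    using bound by (intro nn_integral_mono) (auto simp: E_def T_def indicator_def ennreal_leI)
  show ?thesis
  proof (cases "(\<integral>\<^sup>+t\<in>{0..1}. ennreal (\<sigma> t) \<partial>lborel) = \<infinity>")
    case False
    then have fin: "(\<integral>\<^sup>+t. ennreal \<bar>E t\<bar> \<partial>lborel) < \<infinity>"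
      by (intro order_le_less_trans[OF le]) (simp add: less_top)
    have integrable: "integrable lborel E"
      using E_meas fin by (intro integrableI_bounded) (simp_all add: norm_conv_dist)
    have "(E has_integral (LINT t|lborel. E t)) UNIV"
      using integrable by (rule has_integral_integral_lborel)
    moreover have "(E has_integral (\<phi> 1 - \<phi> 0)) UNIV"
      by (rule has_integral_on_superset[OF int]) (auto simp: E_def T_def indicator_def)
    ultimately have "\<phi> 1 - \<phi> 0 = (LINT t|lborel. E t)"
      using has_integral_unique by blast
    also have "\<dots> \<le> (LINT t|lborel. \<bar>E t\<bar>)"
      using integrable by (intro integral_mono) auto
    finally have "ennreal (\<phi> 1 - \<phi> 0) \<le> ennreal (LINT t|lborel. \<bar>E t\<bar>)"
      by (rule ennreal_leI)
    also have "\<dots> = (\<integral>\<^sup>+t. ennreal \<bar>E t\<bar> \<partial>lborel)"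
      using integrable by (intro nn_integral_eq_integral[symmetric]) auto
    finally show ?thesis using le by (rule order_trans)
  qed simp
qed

text \<open>For \<open>k < 1\<close> the argument of \<open>arccos\<close> stays away from the
  singular values -1 and 1, and the slope bound survives because k^2 (1 - \<xi>^2) \<le> 1 - (k
  \<xi>)^2.\<close>

lemma arccos_scaled_has_derivative:
  fixes \<xi> :: "real \<Rightarrow> real"
  assumes D: "(\<xi> has_real_derivative d) (at t)" and le1: "\<bar>\<xi> t\<bar> \<le> 1"
    and d: "d\<^sup>2 \<le> 4 * (1 - (\<xi> t)\<^sup>2) * s\<^sup>2" and s: "s \<ge> 0" and k: "0 < k" "k < 1"
  obtains e where "((\<lambda>t. arccos (k * \<xi> t) / 2) has_real_derivative e) (at t)" "\<bar>e\<bar> \<le> s"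
proof
  have "\<bar>k * \<xi> t\<bar> \<le> k * 1"
    unfolding abs_mult using le1 k by (intro mult_mono) auto
  then have kx: "\<bar>k * \<xi> t\<bar> < 1" using k by linarith
  then have sq: "(k * \<xi> t)\<^sup>2 < 1" by (simp add: abs_square_less_1)
  show "((\<lambda>t. arccos (k * \<xi> t) / 2) has_real_derivative
      - (k * d) / (2 * sqrt (1 - (k * \<xi> t)\<^sup>2))) (at t)"
    using kx sq by (auto intro!: derivative_eq_intros D simp: field_simps)
  have "k\<^sup>2 \<le> 1" using k by (simp add: power_le_one)
  have "(k * d)\<^sup>2 \<le> k\<^sup>2 * (4 * (1 - (\<xi> t)\<^sup>2) * s\<^sup>2)"
    using d by (simp add: power_mult_distrib mult_left_mono)
  also have "\<dots> \<le> 4 * (1 - (k * \<xi> t)\<^sup>2) * s\<^sup>2"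
    using \<open>k\<^sup>2 \<le> 1\<close> mult_right_mono[OF \<open>k\<^sup>2 \<le> 1\<close>, of "s\<^sup>2"] by (simp add: power_mult_distrib algebra_simps)
  also have "\<dots> = (2 * sqrt (1 - (k * \<xi> t)\<^sup>2) * s)\<^sup>2"
    using sq by (simp add: power_mult_distrib)
  finally have "\<bar>k * d\<bar> \<le> 2 * sqrt (1 - (k * \<xi> t)\<^sup>2) * s"
    using sq s by (intro power2_le_imp_le[of "\<bar>k * d\<bar>"]) auto
  then show "\<bar>- (k * d) / (2 * sqrt (1 - (k * \<xi> t)\<^sup>2))\<bar> \<le> s"
    using sq by (simp add: abs_divide pos_divide_le_eq mult_ac)
qed

text \<open>The weighted sum serves the product of spheres, with one height function per factor; the
  projective plane uses a single one.\<close>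

lemma arccos_increment_le_nn_integral:
  fixes \<xi> :: "'i \<Rightarrow> real \<Rightarrow> real" and \<sigma> :: "real \<Rightarrow> real"
  assumes I: "finite I" and c: "\<And>i. i \<in> I \<Longrightarrow> c i \<ge> 0"
    and cont: "\<And>i. i \<in> I \<Longrightarrow> continuous_on {0..1} (\<xi> i)"
    and le1: "\<And>i t. i \<in> I \<Longrightarrow> t \<in> {0..1} \<Longrightarrow> \<bar>\<xi> i t\<bar> \<le> 1"
    and S: "finite S"
    and deriv: "\<And>i t. i \<in> I \<Longrightarrow> t \<in> {0<..<1} - S \<Longrightarrow> (\<xi> i has_real_derivative d i t) (at t)"
    and d: "\<And>i t. i \<in> I \<Longrightarrow> t \<in> {0<..<1} - S \<Longrightarrow> (d i t)\<^sup>2 \<le> 4 * (1 - (\<xi> i t)\<^sup>2) * (s i t)\<^sup>2"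
    and s: "\<And>i t. i \<in> I \<Longrightarrow> t \<in> {0<..<1} - S \<Longrightarrow> s i t \<ge> 0"
    and \<sigma>: "\<And>t. t \<in> {0<..<1} - S \<Longrightarrow> (\<Sum>i\<in>I. c i * s i t) \<le> \<sigma> t"
  shows "ennreal (\<Sum>i\<in>I. c i * ((arccos (\<xi> i 1) - arccos (\<xi> i 0)) / 2)) \<le> (\<integral>\<^sup>+t\<in>{0..1}. ennreal (\<sigma> t) \<partial>lborel)"
proof (rule LIMSEQ_le_const2)
  \<comment> \<open>With two successors \<open>k 0\<close> is 1/2; with one it would be 0.\<close>
  define k where "k n = 1 - inverse (real (Suc (Suc n)))" for n
  have k: "0 < k n" "k n < 1" for n by (simp_all add: k_def field_simps)
  have klim: "k \<longlonglongrightarrow> 1"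
    using tendsto_diff[OF tendsto_const LIMSEQ_Suc[OF LIMSEQ_inverse_real_of_nat], of "1::real"]
    by (simp add: k_def[abs_def])
  have lim: "(\<lambda>n. arccos (k n * x)) \<longlonglongrightarrow> arccos x" if "\<bar>x\<bar> \<le> 1" for x
  proof (rule continuous_on_tendsto_compose[OF continuous_on_arccos'])
    show "(\<lambda>n. k n * x) \<longlonglongrightarrow> x" using tendsto_mult_right[OF klim, of x] by simp
    have "\<bar>k n * x\<bar> \<le> 1" for n
      using k[of n] that mult_mono[of "k n" 1 "\<bar>x\<bar>" 1] by (simp add: abs_mult)
    then show "\<forall>\<^sub>F n in sequentially. k n * x \<in> {-1..1}" by (simp add: abs_le_iff minus_le_iff)
  qed (use that in auto)
  show "(\<lambda>n. ennreal (\<Sum>i\<in>I. c i * ((arccos (k n * \<xi> i 1) - arccos (k n * \<xi> i 0)) / 2)))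
      \<longlonglongrightarrow> ennreal (\<Sum>i\<in>I. c i * ((arccos (\<xi> i 1) - arccos (\<xi> i 0)) / 2))"
    by (intro tendsto_ennrealI tendsto_sum tendsto_mult tendsto_divide tendsto_diff lim tendsto_const le1) auto
  show "\<exists>N. \<forall>n\<ge>N. ennreal (\<Sum>i\<in>I. c i * ((arccos (k n * \<xi> i 1) - arccos (k n * \<xi> i 0)) / 2))
      \<le> (\<integral>\<^sup>+t\<in>{0..1}. ennreal (\<sigma> t) \<partial>lborel)"
  proof (intro exI allI impI)
    fix n
    have "\<forall>i t. i \<in> I \<and> t \<in> {0<..<1} - S \<longrightarrow>
        (\<exists>e. ((\<lambda>t. arccos (k n * \<xi> i t) / 2) has_real_derivative e) (at t) \<and> \<bar>e\<bar> \<le> s i t)"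
    proof (intro allI impI)
      fix i t assume it: "i \<in> I \<and> t \<in> {0<..<1} - S"
      then have "\<bar>\<xi> i t\<bar> \<le> 1" by (intro le1) auto
      with it show "\<exists>e. ((\<lambda>t. arccos (k n * \<xi> i t) / 2) has_real_derivative e) (at t) \<and> \<bar>e\<bar> \<le> s i t"
        using arccos_scaled_has_derivative[OF deriv _ d s k] by metis
    qed
    then obtain e where e: "\<And>i t. i \<in> I \<Longrightarrow> t \<in> {0<..<1} - S \<Longrightarrow>
          ((\<lambda>t. arccos (k n * \<xi> i t) / 2) has_real_derivative e i t) (at t)"
        "\<And>i t. i \<in> I \<Longrightarrow> t \<in> {0<..<1} - S \<Longrightarrow> \<bar>e i t\<bar> \<le> s i t"
      by metis
    have "ennreal ((\<Sum>i\<in>I. c i * (arccos (k n * \<xi> i 1) / 2)) - (\<Sum>i\<in>I. c i * (arccos (k n * \<xi> i 0) / 2)))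
        \<le> (\<integral>\<^sup>+t\<in>{0..1}. ennreal (\<sigma> t) \<partial>lborel)"
    proof (rule increment_le_nn_integral[OF _ S, where D = "\<lambda>t. \<Sum>i\<in>I. c i * e i t"])
      have "continuous_on {0..1} (\<lambda>t. arccos (k n * \<xi> i t))" if "i \<in> I" for i
      proof (rule continuous_on_compose2[OF continuous_on_arccos'])
        show "continuous_on {0..1} (\<lambda>t. k n * \<xi> i t)"
          by (intro continuous_on_mult continuous_on_const cont that)
        have "\<bar>k n * \<xi> i t\<bar> \<le> 1" if "t \<in> {0..1}" for t
          using k[of n] le1[OF \<open>i \<in> I\<close> that] mult_mono[of "k n" 1 "\<bar>\<xi> i t\<bar>" 1] by (simp add: abs_mult)
        then show "(\<lambda>t. k n * \<xi> i t) ` {0..1} \<subseteq> {-1..1}" by (auto simp: abs_le_iff minus_le_iff)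
      qed
      then show "continuous_on {0..1} (\<lambda>t. \<Sum>i\<in>I. c i * (arccos (k n * \<xi> i t) / 2))"
        by (intro continuous_on_sum continuous_on_mult continuous_on_divide continuous_on_const) auto
      fix t assume t: "t \<in> {0<..<1} - S"
      show "((\<lambda>t. \<Sum>i\<in>I. c i * (arccos (k n * \<xi> i t) / 2)) has_real_derivative (\<Sum>i\<in>I. c i * e i t)) (at t)"
        by (intro DERIV_sum DERIV_cmult e t)
      have "\<bar>\<Sum>i\<in>I. c i * e i t\<bar> \<le> (\<Sum>i\<in>I. c i * s i t)"
        using c e(2)[OF _ t] by (intro order_trans[OF sum_abs] sum_mono) (simp add: abs_mult mult_left_mono)
      also have "\<dots> \<le> \<sigma> t" by (rule \<sigma>[OF t])
      finally show "\<bar>\<Sum>i\<in>I. c i * e i t\<bar> \<le> \<sigma> t" .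
    qed
    then show "ennreal (\<Sum>i\<in>I. c i * ((arccos (k n * \<xi> i 1) - arccos (k n * \<xi> i 0)) / 2))
        \<le> (\<integral>\<^sup>+t\<in>{0..1}. ennreal (\<sigma> t) \<partial>lborel)"
      by (simp add: sum_subtractf[symmetric] diff_divide_distrib right_diff_distrib)
  qed
qed

lemma rdist_eqI:
  assumes "0 \<le> d" "\<And>\<gamma>. piecewise_C1_curve M p x \<gamma> \<Longrightarrow> ennreal d \<le> curve_length M \<gamma>"
    and "piecewise_C1_curve M p x \<gamma>" "curve_length M \<gamma> = ennreal d"
  shows "rdist M p x = d"
proof -
  have "(INF \<gamma>\<in>Collect (piecewise_C1_curve M p x). curve_length M \<gamma>) = ennreal d"
    using assms(2-4) by (intro antisym INF_greatest INF_lower2[of \<gamma>]) auto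
  then show ?thesis using assms(1) by (simp add: rdist_def)
qed

lemma curve_length_const:
  assumes "\<And>t. t \<in> {0<..<1} \<Longrightarrow> speed M \<gamma> t = c"
  shows "curve_length M \<gamma> = ennreal c"
proof -
  have "curve_length M \<gamma> = (\<integral>\<^sup>+t\<in>{0<..<1::real}. ennreal c \<partial>lborel)"
    unfolding curve_length_def
  proof (rule nn_integral_cong_AE)
    have "AE t in lborel. t \<noteq> 0 \<and> t \<noteq> (1::real)"
      using AE_lborel_singleton[of 0] AE_lborel_singleton[of 1] by auto
    then show "AE t in lborel. ennreal (speed M \<gamma> t) * indicator {0..1} t = ennreal c * indicator {0<..<1} t"
      by eventually_elim (auto simp: indicator_def assms)
  qed
  also have "\<dots> = ennreal c" by (simp add: nn_integral_cmult)
  finally show ?thesis .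
qed


section \<open>Distance and Laplacian on the product of two spheres\<close>

text \<open>The argument of \<open>arccos\<close> is the height on the unit sphere of the point at
  stereographic radius \<open>n\<close>, so its polar angle is twice
  \<open>arctan n\<close>.\<close>

lemma arccos_arctan_norm:
  assumes "0 \<le> n"
  shows "arccos ((1 - n\<^sup>2) / (1 + n\<^sup>2)) = 2 * arctan n"
proof -
  have "cos (2 * arctan n) = (1 - n\<^sup>2) / (1 + n\<^sup>2)"
    using one_plus_norm_sq_pos[of n]
    unfolding cos_double_cos by (simp add: cos_arctan power_divide field_simps)
  then show ?thesis
    using arccos_cos[of "2 * arctan n"] arctan_bounded[of n] assms by simp
qed

lemma chart_at_sphere_product: "chart_at sphere_product x = (UNIV, id)"
  unfolding chart_at_def by (rule some_equality) (auto simp: sphere_product_def)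

lemma inv_into_UNIV_id [simp]: "inv_into UNIV id = id"
  by (simp add: id_def)

lemma speed_sphere_product:
  assumes "(\<gamma> has_vector_derivative v) (at t)"
  shows "speed sphere_product \<gamma> t = sqrt (sph_metric (\<gamma> t) v v)"
  using vector_derivative_at[OF assms]
  by (simp add: speed_def chart_at_sphere_product Let_def) (simp add: sphere_product_def)

text \<open>Pythagoras for products: for the line element |d\<zeta>| / (1 + |\<zeta>|^2) the
  distance from 0 in each factor is the arctangent of the modulus. The scale
  \<open>sqrt (2 / 3)\<close> is added later.\<close>

definition sphere_product_radius :: "complex ^ 2 \<Rightarrow> real" where
  "sphere_product_radius z = L2_set (\<lambda>i. arctan (norm (z $ i))) UNIV"

lemma sphere_product_radius_nonneg: "sphere_product_radius z \<ge> 0"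
  by (simp add: sphere_product_radius_def L2_set_nonneg)

lemma speed_sphere_product_eq_L2_set:
  assumes "(\<gamma> has_vector_derivative v) (at t)"
  shows "speed sphere_product \<gamma> t =
    sqrt (2 / 3) * L2_set (\<lambda>i. norm (v $ i) / (1 + (norm (\<gamma> t $ i))\<^sup>2)) UNIV"
  unfolding speed_sphere_product[OF assms] sph_metric_eq L2_set_def real_sqrt_mult
  by (simp add: power_divide dot_square_norm)

lemma piecewise_C1_curve_sphere_product_iff:
  "piecewise_C1_curve sphere_product p x \<gamma> \<longleftrightarrow> continuous_on {0..1} \<gamma> \<and> \<gamma> 0 = p \<and> \<gamma> 1 = x \<and>
    (\<exists>S. finite S \<and> \<gamma> C1_differentiable_on ({0<..<1} - S))"
proof -
  have "{t. 0 < t \<and> t < 1 \<and> t \<notin> S} = {0<..<1} - S" for S :: "real set" by auto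
  then show ?thesis by (simp add: piecewise_C1_curve_def sphere_product_def)
qed

text \<open>The l2 norm of the factor distances is linearised at the end point: each factor distance
  gets the weight \<open>a i / \<rho>\<close>. Cauchy-Schwarz bounds the slope of the weighted sum
  by the speed in the product, and at \<open>z\<close> its value is the sum of
  \<open>(a i)\<^sup>2 / \<rho>\<close>, which is \<rho>.\<close>

lemma sphere_product_length_ge:
  assumes "piecewise_C1_curve sphere_product 0 z \<gamma>"
  shows "ennreal (sqrt (2 / 3) * sphere_product_radius z) \<le> curve_length sphere_product \<gamma>"
proof -
  obtain S D where cont: "continuous_on {0..1} \<gamma>" and \<gamma>: "\<gamma> 0 = 0" "\<gamma> 1 = z" and S: "finite S"
    and D: "\<And>t. t \<in> {0<..<1} - S \<Longrightarrow> (\<gamma> has_vector_derivative D t) (at t)"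
    using assms unfolding piecewise_C1_curve_sphere_product_iff C1_differentiable_on_def by metis
  define a where "a i = arctan (norm (z $ i))" for i
  define \<rho> where "\<rho> = sphere_product_radius z"
  define n where "n i t = (norm (\<gamma> t $ i))\<^sup>2" for i t
  have \<rho>: "\<rho> = L2_set a UNIV" "\<rho> \<ge> 0"
    by (simp_all add: \<rho>_def sphere_product_radius_def a_def[abs_def] L2_set_nonneg)
  have a0: "a i \<ge> 0" for i by (simp add: a_def)
  have npos: "1 + n i t > 0" "n i t \<ge> 0" for i t by (simp_all add: n_def add_pos_nonneg)
  have "ennreal (\<Sum>i\<in>UNIV. sqrt (2 / 3) * (a i / \<rho>) *
      ((arccos ((1 - n i 1) / (1 + n i 1)) - arccos ((1 - n i 0) / (1 + n i 0))) / 2))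
    \<le> (\<integral>\<^sup>+t\<in>{0..1}. ennreal (speed sphere_product \<gamma> t) \<partial>lborel)"
  proof (rule arccos_increment_le_nn_integral[where S = S and
        d = "\<lambda>i t. - 4 * (\<gamma> t $ i \<bullet> D t $ i) / (1 + n i t)\<^sup>2" and
        s = "\<lambda>i t. norm (D t $ i) / (1 + n i t)"])
    show "sqrt (2 / 3) * (a i / \<rho>) \<ge> 0" for i using a0 \<rho> by simp
    show "continuous_on {0..1} (\<lambda>t. (1 - n i t) / (1 + n i t))" for i
      using npos(1)[THEN less_imp_neq, THEN not_sym] unfolding n_def
      by (intro continuous_intros cont) auto
    show "\<bar>(1 - n i t) / (1 + n i t)\<bar> \<le> 1" for i t
      using npos[of i t] by (simp add: abs_le_iff field_simps)
    fix i t assume t: "t \<in> {0<..<1} - S"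
    have Di: "((\<lambda>t. \<gamma> t $ i) has_vector_derivative D t $ i) (at t)"
      by (rule bounded_linear.has_vector_derivative[OF bounded_linear_vec_nth D[OF t]])
    have "(n i has_real_derivative 2 * (\<gamma> t $ i \<bullet> D t $ i)) (at t)"
      using has_derivative_inner[OF Di[unfolded has_vector_derivative_def] Di[unfolded has_vector_derivative_def]]
      unfolding n_def power2_norm_eq_inner has_field_derivative_def
      by (rule has_derivative_eq_rhs) (simp add: fun_eq_iff inner_commute)
    then show "((\<lambda>t. (1 - n i t) / (1 + n i t)) has_real_derivative
        - 4 * (\<gamma> t $ i \<bullet> D t $ i) / (1 + n i t)\<^sup>2) (at t)"
      using npos(1)[of i t]
      by (auto intro!: derivative_eq_intros simp: field_simps power2_eq_square)
    have "(\<gamma> t $ i \<bullet> D t $ i)\<^sup>2 \<le> n i t * (norm (D t $ i))\<^sup>2"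
      using power_mono[OF Cauchy_Schwarz_ineq2, of "\<gamma> t $ i" "D t $ i" 2] by (simp add: n_def power_mult_distrib)
    then have "16 * (\<gamma> t $ i \<bullet> D t $ i)\<^sup>2 / ((1 + n i t)\<^sup>2)\<^sup>2 \<le> 16 * (n i t * (norm (D t $ i))\<^sup>2) / ((1 + n i t)\<^sup>2)\<^sup>2"
      by (intro divide_right_mono) auto
    also have "\<dots> = 4 * (1 - ((1 - n i t) / (1 + n i t))\<^sup>2) * (norm (D t $ i) / (1 + n i t))\<^sup>2"
    proof -
      have "1 - ((1 - n i t) / (1 + n i t))\<^sup>2 = 4 * n i t / (1 + n i t)\<^sup>2"
        using npos(1)[of i t] by (simp add: power_divide eq_divide_eq left_diff_distrib) (simp add: power2_eq_square algebra_simps)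
      then show ?thesis by (simp add: power_divide power2_eq_square)
    qed
    finally show "(- 4 * (\<gamma> t $ i \<bullet> D t $ i) / (1 + n i t)\<^sup>2)\<^sup>2 \<le>
        4 * (1 - ((1 - n i t) / (1 + n i t))\<^sup>2) * (norm (D t $ i) / (1 + n i t))\<^sup>2"
      by (simp add: power_divide power_mult_distrib)
    show "norm (D t $ i) / (1 + n i t) \<ge> 0" using npos[of i t] by simp
  next
    fix t assume t: "t \<in> {0<..<1} - S"
    have "(\<Sum>i\<in>UNIV. a i * (norm (D t $ i) / (1 + n i t))) \<le> \<rho> * L2_set (\<lambda>i. norm (D t $ i) / (1 + n i t)) UNIV"
      using L2_set_mult_ineq[of a "\<lambda>i. norm (D t $ i) / (1 + n i t)" UNIV] a0 npos
      by (simp add: \<rho> abs_divide less_imp_le)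
    \<comment> \<open>If \<rho> is 0, division by zero makes the left-hand side 0.\<close>
    then have "(\<Sum>i\<in>UNIV. a i * (norm (D t $ i) / (1 + n i t))) / \<rho> \<le> L2_set (\<lambda>i. norm (D t $ i) / (1 + n i t)) UNIV"
      using \<rho>(2) by (cases "\<rho> = 0") (simp_all add: L2_set_nonneg divide_le_eq mult.commute)
    then have "sqrt (2 / 3) * ((\<Sum>i\<in>UNIV. a i * (norm (D t $ i) / (1 + n i t))) / \<rho>) \<le> speed sphere_product \<gamma> t"
      unfolding speed_sphere_product_eq_L2_set[OF D[OF t]] n_def[symmetric] by (rule mult_left_mono) simp
    also have "sqrt (2 / 3) * ((\<Sum>i\<in>UNIV. a i * (norm (D t $ i) / (1 + n i t))) / \<rho>) =
        (\<Sum>i\<in>UNIV. sqrt (2 / 3) * (a i / \<rho>) * (norm (D t $ i) / (1 + n i t)))"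
      unfolding sum_divide_distrib sum_distrib_left by (intro sum.cong) (auto simp: mult_ac)
    finally show "(\<Sum>i\<in>UNIV. sqrt (2 / 3) * (a i / \<rho>) * (norm (D t $ i) / (1 + n i t))) \<le> speed sphere_product \<gamma> t" .
  qed (use S in auto)
  also have "(\<Sum>i\<in>UNIV. sqrt (2 / 3) * (a i / \<rho>) *
      ((arccos ((1 - n i 1) / (1 + n i 1)) - arccos ((1 - n i 0) / (1 + n i 0))) / 2)) =
      (\<Sum>i\<in>UNIV. sqrt (2 / 3) / \<rho> * (a i)\<^sup>2)"
    by (simp add: n_def \<gamma> arccos_arctan_norm a_def) (simp add: power2_eq_square mult_ac)
  also have "\<dots> = sqrt (2 / 3) / \<rho> * \<rho>\<^sup>2"
    unfolding sum_distrib_left[symmetric] by (simp add: \<rho>(1) L2_set_def sum_nonneg)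
  also have "\<dots> = sqrt (2 / 3) * \<rho>" by (simp add: power2_eq_square)
  finally show ?thesis by (simp add: curve_length_def \<rho>_def)
qed

lemma vec_lambda_has_vector_derivative:
  fixes f :: "real \<Rightarrow> 'n::finite \<Rightarrow> complex"
  assumes "\<And>i. ((\<lambda>t. f t i) has_vector_derivative d i) (at t)"
  shows "((\<lambda>t. \<chi> i. f t i) has_vector_derivative (\<chi> i. d i)) (at t)"
  unfolding has_vector_derivative_def
  by (rule has_derivative_eq_rhs[OF vec_lambda_has_derivative[OF assms[unfolded has_vector_derivative_def]]])
    (simp add: fun_eq_iff vec_eq_iff)

lemma rdist_sphere_product: "rdist sphere_product 0 z = sqrt (2 / 3) * sphere_product_radius z"
proof (rule rdist_eqI)
  define a where "a i = arctan (norm (z $ i))" for i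
  \<comment> \<open>Each component moves along a ray with the arctangent of its modulus equal to
    \<open>t * a i\<close>, hence with constant speed \<open>a i\<close> in its factor.\<close>
  define \<gamma> where "\<gamma> t = (\<chi> i. of_real (tan (t * a i)) * sgn (z $ i))" for t
  define D where "D t = (\<chi> i. of_real (a i * (1 + (tan (t * a i))\<^sup>2)) * sgn (z $ i))" for t
  have a: "0 \<le> a i" "a i < pi / 2" for i
    using arctan_bounded[of "norm (z $ i)"] by (simp_all add: a_def)
  have cos_pos: "cos (t * a i) > 0" if "t \<in> {0..1}" for t i
  proof (rule cos_gt_zero_pi)
    have "t * a i \<le> a i" using that a[of i] by (simp add: mult_left_le_one_le)
    then show "t * a i < pi / 2" using a[of i] by simp
    have "0 \<le> t * a i" using that a by simp
    then show "- (pi / 2) < t * a i" using pi_gt_zero by linarith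
  qed
  have D: "(\<gamma> has_vector_derivative D t) (at t)" if "t \<in> {0..1}" for t
    unfolding \<gamma>_def D_def
  proof (rule vec_lambda_has_vector_derivative)
    fix i
    have "((\<lambda>t. tan (t * a i)) has_real_derivative a i * (1 + (tan (t * a i))\<^sup>2)) (at t)"
      using cos_pos[OF that, of i] tan_sec[of "t * a i"]
      by (auto intro!: derivative_eq_intros simp: power_inverse)
    then show "((\<lambda>t. of_real (tan (t * a i)) * sgn (z $ i)) has_vector_derivative
        of_real (a i * (1 + (tan (t * a i))\<^sup>2)) * sgn (z $ i)) (at t)"
      by (intro has_vector_derivative_mult_left has_vector_derivative_of_real)
        (simp add: has_real_derivative_iff_has_vector_derivative)
  qed
  show "piecewise_C1_curve sphere_product 0 z \<gamma>"
    unfolding piecewise_C1_curve_sphere_product_iff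
  proof (intro conjI exI[of _ "{}"])
    show "continuous_on {0..1} \<gamma>"
      using has_vector_derivative_continuous[OF D] by (intro continuous_at_imp_continuous_on) blast
    show "\<gamma> 0 = 0" by (simp add: \<gamma>_def vec_eq_iff)
    show "\<gamma> 1 = z"
      by (simp add: \<gamma>_def vec_eq_iff a_def tan_arctan sgn_eq)
    have "continuous_on {0<..<1} D"
      unfolding D_def using cos_pos by (intro continuous_intros) (auto simp: less_imp_neq[THEN not_sym])
    then show "\<gamma> C1_differentiable_on {0<..<1} - {}"
      unfolding C1_differentiable_on_def using D by (intro exI[of _ D]) auto
  qed simp
  show "curve_length sphere_product \<gamma> = ennreal (sqrt (2 / 3) * sphere_product_radius z)"
  proof (rule curve_length_const)
    fix t :: real assume t: "t \<in> {0<..<1}"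
    have "norm (D t $ i) / (1 + (norm (\<gamma> t $ i))\<^sup>2) = a i" for i
    proof (cases "z $ i = 0")
      case True
      then show ?thesis by (simp add: D_def a_def)
    next
      case False
      have "\<bar>1 + (tan (t * a i))\<^sup>2\<bar> = 1 + (tan (t * a i))\<^sup>2" "1 + (tan (t * a i))\<^sup>2 \<noteq> 0"
        using one_plus_norm_sq_pos[of "tan (t * a i)"] by simp_all
      moreover have "norm (D t $ i) = a i * \<bar>1 + (tan (t * a i))\<^sup>2\<bar>"
        using False a[of i] unfolding D_def vec_lambda_beta norm_mult norm_of_real abs_mult by (simp add: norm_sgn)
      moreover have "(norm (\<gamma> t $ i))\<^sup>2 = (tan (t * a i))\<^sup>2"
        using False by (simp add: \<gamma>_def norm_mult norm_sgn)
      ultimately show ?thesis by simp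
    qed
    then show "speed sphere_product \<gamma> t = sqrt (2 / 3) * sphere_product_radius z"
      using t by (simp add: speed_sphere_product_eq_L2_set[OF D] sphere_product_radius_def a_def)
  qed
qed (simp_all add: sphere_product_length_ge sphere_product_radius_nonneg)


section \<open>Gradient and Laplacian of the distance on the product\<close>

lemma radial_has_derivative:
  fixes z :: "'e::real_inner"
  assumes "z \<noteq> 0" "(\<phi> has_real_derivative d) (at (norm z))"
  shows "((\<lambda>x. \<phi> (norm x)) has_derivative (\<lambda>u. d * ((z \<bullet> u) / norm z))) (at z)"
proof -
  have "(norm has_derivative (\<lambda>u. (z \<bullet> u) / norm z)) (at z)"
    by (rule has_derivative_eq_rhs[OF has_derivative_norm[OF assms(1)]])
      (simp add: fun_eq_iff sgn_div_norm inner_commute divide_inverse mult.commute)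
  from has_derivative_compose[OF this assms(2)[unfolded has_field_derivative_def]] show ?thesis .
qed

lemma radial_nth_has_derivative:
  fixes z :: "complex ^ 'n::finite"
  assumes "z $ i \<noteq> 0" "(\<phi> has_real_derivative d) (at (norm (z $ i)))"
  shows "((\<lambda>x. \<phi> (norm (x $ i))) has_derivative (\<lambda>u. d * ((z $ i \<bullet> u $ i) / norm (z $ i)))) (at z)"
  using has_derivative_compose[OF nth_has_derivative radial_has_derivative[OF assms]] .

lemma endo_trace_scaleR_diag: "endo_trace (\<lambda>u::complex ^ 'n. \<chi> i. r i *\<^sub>R u $ i) = 2 * (\<Sum>i\<in>UNIV. r i)"
  by (simp add: endo_trace_complex_vec sum_distrib_left)

lemma endo_trace_rank_one_diag: "endo_trace (\<lambda>u::complex ^ 'n. \<chi> i. (p i \<bullet> u $ i) *\<^sub>R q i) = (\<Sum>i\<in>UNIV. p i \<bullet> q i)"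
  by (simp add: endo_trace_complex_vec inner_complex_def)

lemma vec_lambda_plus: "(\<chi> i. a i + b i) = (\<chi> i. a i) + (\<chi> i. b i)"
  by (simp add: vec_eq_iff)

text \<open>Restricted to points without vanishing components, where the norm of each component is
  differentiable; the diagonal minus the origin lies there.\<close>

lemma sphere_product_radius_has_derivative:
  fixes z :: "complex ^ 2"
  assumes z: "\<And>i. z $ i \<noteq> 0"
  defines "n \<equiv> \<lambda>i. norm (z $ i)"
  shows "(sphere_product_radius has_derivative
    (\<lambda>u. (\<chi> i. (arctan (n i) / ((1 + (n i)\<^sup>2) * n i * sphere_product_radius z)) *\<^sub>R z $ i) \<bullet> u)) (at z)"
    "sphere_product_radius z > 0"
proof -
  have n: "n i > 0" for i using z by (simp add: n_def)
  have pos: "(\<Sum>i\<in>UNIV. (arctan (n i))\<^sup>2) > 0"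
    using n by (intro sum_pos zero_less_power) simp_all
  then show "sphere_product_radius z > 0" by (simp add: sphere_product_radius_def L2_set_def n_def)
  have D: "((\<lambda>x. (arctan (norm (x $ i)))\<^sup>2) has_derivative
      (\<lambda>u. 2 * arctan (n i) / (1 + (n i)\<^sup>2) * ((z $ i \<bullet> u $ i) / n i))) (at z)" for i
    unfolding n_def by (rule radial_nth_has_derivative[OF z])
      (auto intro!: derivative_eq_intros simp: inverse_eq_divide)
  have "((\<lambda>x. sqrt (\<Sum>i\<in>UNIV. (arctan (norm (x $ i)))\<^sup>2)) has_derivative
      (\<lambda>u. (\<Sum>i\<in>UNIV. 2 * arctan (n i) / (1 + (n i)\<^sup>2) * ((z $ i \<bullet> u $ i) / n i)) *
        (inverse (sqrt (\<Sum>i\<in>UNIV. (arctan (n i))\<^sup>2)) / 2))) (at z)"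
  proof -
    have "((\<lambda>x. \<Sum>i\<in>UNIV. (arctan (norm (x $ i)))\<^sup>2) has_derivative
      (\<lambda>u. \<Sum>i\<in>UNIV. 2 * arctan (n i) / (1 + (n i)\<^sup>2) * ((z $ i \<bullet> u $ i) / n i))) (at z)"
      by (rule has_derivative_sum[OF D])
    from has_derivative_compose[OF this DERIV_real_sqrt[unfolded has_field_derivative_def, OF pos[unfolded n_def]]]
    show ?thesis by (simp add: n_def mult.commute)
  qed
  then show "(sphere_product_radius has_derivative
    (\<lambda>u. (\<chi> i. (arctan (n i) / ((1 + (n i)\<^sup>2) * n i * sphere_product_radius z)) *\<^sub>R z $ i) \<bullet> u)) (at z)"
    unfolding sphere_product_radius_def[abs_def] L2_set_def
  proof (rule has_derivative_eq_rhs, intro ext)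
    fix u
    have eq: "2 * A / B * (Z / m) * (inverse q / 2) = A / (B * m * q) * Z" for A B Z m q :: real
      by (simp add: inverse_eq_divide)
    have norm_n: "norm (z $ i) = n i" for i by (simp add: n_def)
    define q where "q = sqrt (\<Sum>i\<in>UNIV. (arctan (n i))\<^sup>2)"
    show "(\<Sum>i\<in>UNIV. 2 * arctan (n i) / (1 + (n i)\<^sup>2) * ((z $ i \<bullet> u $ i) / n i)) *
        (inverse (sqrt (\<Sum>i\<in>UNIV. (arctan (n i))\<^sup>2)) / 2) =
      (\<chi> i. (arctan (n i) / ((1 + (n i)\<^sup>2) * n i * sqrt (\<Sum>i\<in>UNIV. (arctan (norm (z $ i)))\<^sup>2))) *\<^sub>R z $ i) \<bullet> u"
      unfolding norm_n q_def[symmetric] inner_vec_def sum_distrib_right vec_lambda_beta inner_scaleR_left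
      by (rule sum.cong[OF refl eq])
  qed
qed

text \<open>The Riemannian gradient of half the squared distance. Unlike the gradient of the
  distance, it splits over the two factors.\<close>

definition sphere_product_grad :: "complex ^ 2 \<Rightarrow> complex ^ 2" where
  "sphere_product_grad z =
    (\<chi> i. (arctan (norm (z $ i)) * (1 + (norm (z $ i))\<^sup>2) / norm (z $ i)) *\<^sub>R z $ i)"

lemma sphere_product_grad_has_derivative:
  fixes z :: "complex ^ 2"
  assumes z: "\<And>i. z $ i \<noteq> 0"
  defines "n \<equiv> \<lambda>i. norm (z $ i)"
  shows "(sphere_product_grad has_derivative
    (\<lambda>u. \<chi> i. (arctan (n i) * (1 + (n i)\<^sup>2) / n i) *\<^sub>R u $ i +
      (((1 / n i + arctan (n i) * (1 - 1 / (n i)\<^sup>2)) / n i) *\<^sub>R z $ i \<bullet> u $ i) *\<^sub>R z $ i)) (at z)"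
  unfolding sphere_product_grad_def[abs_def]
proof (rule vec_lambda_has_derivative)
  fix i
  have n: "n i > 0" using z by (simp add: n_def)
  have "((\<lambda>s. arctan s * (1 + s\<^sup>2) / s) has_real_derivative
      (1 / n i + arctan (n i) * (1 - 1 / (n i)\<^sup>2))) (at (n i))"
    using n one_plus_norm_sq_pos[of "n i"]
    by (auto intro!: derivative_eq_intros simp: divide_simps) (auto simp: power2_eq_square algebra_simps)
  from has_derivative_scaleR[OF radial_nth_has_derivative[OF z this[unfolded n_def]] nth_has_derivative]
  show "((\<lambda>x. (arctan (norm (x $ i)) * (1 + (norm (x $ i))\<^sup>2) / norm (x $ i)) *\<^sub>R x $ i) has_derivative
    (\<lambda>u. (arctan (n i) * (1 + (n i)\<^sup>2) / n i) *\<^sub>R u $ i +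
      (((1 / n i + arctan (n i) * (1 - 1 / (n i)\<^sup>2)) / n i) *\<^sub>R z $ i \<bullet> u $ i) *\<^sub>R z $ i)) (at z)"
    by (simp add: n_def)
qed

lemma open_nth_nonzero: "open {z :: complex ^ 'n::finite. \<forall>i. z $ i \<noteq> 0}"
proof -
  have "open (\<Inter>i. {z :: complex ^ 'n. z $ i \<noteq> 0})"
    by (intro open_INT ballI open_Collect_neq continuous_intros) auto
  moreover have "(\<Inter>i. {z :: complex ^ 'n. z $ i \<noteq> 0}) = {z. \<forall>i. z $ i \<noteq> 0}" by auto
  ultimately show ?thesis by simp
qed

text \<open>The gradient of the distance r is \<open>sphere_product_grad\<close> divided by r. The
  trace of the derivative of that field and the connection term split over the factors, and
  differentiating 1/r contributes -1/r.\<close>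

lemma laplacian_sphere_product:
  fixes z :: "complex ^ 2"
  assumes z: "\<And>i. z $ i \<noteq> 0"
  shows "laplacian sphere_product (rdist sphere_product 0) z =
    (1 + (\<Sum>i\<in>UNIV. arctan (norm (z $ i)) * (1 / norm (z $ i) - norm (z $ i)))) / rdist sphere_product 0 z"
proof -
  define V where "V = {z :: complex ^ 2. \<forall>i. z $ i \<noteq> 0}"
  define c where "c = sqrt (2 / 3)"
  have c: "c * c = 2 / 3" "c > 0" by (simp_all add: c_def)
  define n where "n i = norm (z $ i)" for i
  have n: "n i > 0" for i using z by (simp add: n_def)
  define \<rho> where "\<rho> = sphere_product_radius z"
  have \<rho>: "\<rho> > 0" using sphere_product_radius_has_derivative(2)[OF z] by (simp add: \<rho>_def)
  define w where "w = (\<chi> i. (arctan (n i) / ((1 + (n i)\<^sup>2) * n i * \<rho>)) *\<^sub>R z $ i)"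
  define L where "L u = (\<chi> i. (arctan (n i) * (1 + (n i)\<^sup>2) / n i) *\<^sub>R u $ i +
      (((1 / n i + arctan (n i) * (1 - 1 / (n i)\<^sup>2)) / n i) *\<^sub>R z $ i \<bullet> u $ i) *\<^sub>R z $ i)" for u :: "complex ^ 2"
  have r: "rdist sphere_product 0 = (\<lambda>z. c * sphere_product_radius z)"
    by (simp add: fun_eq_iff rdist_sphere_product c_def)
  define X where "X x = (1 / (c * sphere_product_radius x)) *\<^sub>R sphere_product_grad x" for x
  have grad: "(rdist sphere_product 0 has_derivative (\<lambda>y. sph_metric x (X x) y)) (at x)" if "x \<in> V" for x
  proof -
    have x: "x $ i \<noteq> 0" for i using that by (simp add: V_def)
    note D = sphere_product_radius_has_derivative[OF x]
    have eq: "c * (a / (A * m * \<rho>) * b) = 2 / 3 * (1 / (c * \<rho>) * (a * A / m) * b / A\<^sup>2)"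
      if "A > 0" "m > 0" "\<rho> > 0" for A m a b \<rho> :: real
      using that c by (simp add: field_simps power2_eq_square)
    show ?thesis
      unfolding r
    proof (rule has_derivative_eq_rhs[OF has_derivative_mult_right[OF D(1)]], rule ext)
      fix y
      have "c * (arctan (norm (x $ i)) / ((1 + (norm (x $ i))\<^sup>2) * norm (x $ i) * sphere_product_radius x) * (x $ i \<bullet> y $ i)) =
        2 / 3 * (1 / (c * sphere_product_radius x) * (arctan (norm (x $ i)) * (1 + (norm (x $ i))\<^sup>2) / norm (x $ i)) * (x $ i \<bullet> y $ i) / (1 + (norm (x $ i))\<^sup>2)\<^sup>2)" for i
        by (rule eq) (use one_plus_norm_sq_pos[of "x $ i"] D(2) x in auto)
      then show "c * ((\<chi> i. (arctan (norm (x $ i)) / ((1 + (norm (x $ i))\<^sup>2) * norm (x $ i) * sphere_product_radius x)) *\<^sub>R x $ i) \<bullet> y) = sph_metric x (X x) y"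
        unfolding sph_metric_eq X_def inner_vec_def sum_distrib_left sphere_product_grad_def
        by (intro sum.cong) (simp_all add: mult_ac)
    qed
  qed
  have zV: "z \<in> V" using z by (simp add: V_def)
  have inv: "((\<lambda>x. 1 / (c * sphere_product_radius x)) has_derivative (\<lambda>u. - (w \<bullet> u) / (c * \<rho>\<^sup>2))) (at z)"
  proof -
    have "((\<lambda>x. c * sphere_product_radius x) has_derivative (\<lambda>u. c * (w \<bullet> u))) (at z)"
      unfolding w_def \<rho>_def n_def
      by (intro has_derivative_mult_right sphere_product_radius_has_derivative z)
    from has_derivative_divide'[OF has_derivative_const[of 1] this] show ?thesis
      using c \<rho> by (rule_tac has_derivative_eq_rhs) (auto simp: fun_eq_iff \<rho>_def[symmetric] field_simps power2_eq_square)
  qed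
  have DX: "(X has_derivative (\<lambda>u. (1 / (c * \<rho>)) *\<^sub>R L u + (- (w \<bullet> u) / (c * \<rho>\<^sup>2)) *\<^sub>R sphere_product_grad z)) (at z)"
    unfolding X_def[abs_def] \<rho>_def L_def n_def
    by (rule has_derivative_scaleR[OF inv[unfolded \<rho>_def] sphere_product_grad_has_derivative[OF z]])
  have traceL: "endo_trace L = (\<Sum>i\<in>UNIV. 1 + arctan (n i) * (3 * n i + 1 / n i))"
  proof -
    have eq: "2 * (a * (1 + m\<^sup>2) / m) + (1 / m + a * (1 - 1 / m\<^sup>2)) / m * m\<^sup>2 = 1 + a * (3 * m + 1 / m)"
      if "m > 0" for m a :: real
      using that by (simp add: field_simps power2_eq_square)
    have "endo_trace L = (\<Sum>i\<in>UNIV. 2 * (arctan (n i) * (1 + (n i)\<^sup>2) / n i) + (1 / n i + arctan (n i) * (1 - 1 / (n i)\<^sup>2)) / n i * (n i)\<^sup>2)"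
      unfolding L_def vec_lambda_plus endo_trace_add endo_trace_scaleR_diag endo_trace_rank_one_diag
      by (simp add: sum.distrib sum_distrib_left n_def power2_norm_eq_inner)
    then show ?thesis using eq[OF n] by simp
  qed
  \<comment> \<open>\<open>w\<close> is the Euclidean gradient of the radius, and the field is r
    times the unit radial field, so along it the radius grows at a rate equal to itself.\<close>
  have wY: "w \<bullet> sphere_product_grad z = \<rho>"
  proof -
    have "w \<bullet> sphere_product_grad z = (\<Sum>i\<in>UNIV. (arctan (n i))\<^sup>2 / \<rho>)"
      unfolding w_def sphere_product_grad_def inner_vec_def n_def[symmetric] vec_lambda_beta
    proof (rule sum.cong[OF refl])
      fix i
      have "1 + (n i)\<^sup>2 \<noteq> 0" using one_plus_norm_sq_pos[of "n i"] by simp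
      moreover have "z $ i \<bullet> z $ i = (n i)\<^sup>2" by (simp add: n_def power2_norm_eq_inner)
      ultimately show "(arctan (n i) / ((1 + (n i)\<^sup>2) * n i * \<rho>)) *\<^sub>R z $ i \<bullet>
          (arctan (n i) * (1 + (n i)\<^sup>2) / n i) *\<^sub>R z $ i = (arctan (n i))\<^sup>2 / \<rho>"
        using n[of i] \<rho> by (simp add: power2_eq_square)
    qed
    also have "\<dots> = \<rho>\<^sup>2 / \<rho>"
      by (simp add: sum_divide_distrib[symmetric] \<rho>_def sphere_product_radius_def L2_set_def n_def sum_nonneg)
    finally show ?thesis using \<rho> by (simp add: power2_eq_square)
  qed
  have trace\<Gamma>: "endo_trace (\<lambda>u. sph_conn z u (X z)) = - 4 * (\<Sum>i\<in>UNIV. arctan (n i) * n i) / (c * \<rho>)"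
  proof -
    have Re_eq: "Re (- 2 * cnj (z $ i) * X z $ i / saff (z $ i)) = - 2 * (arctan (n i) * n i / (c * \<rho>))" for i
    proof -
      have zz: "cnj (z $ i) * z $ i = of_real ((n i)\<^sup>2)"
        by (metis complex_norm_square mult.commute n_def)
      have "- 2 * cnj (z $ i) * X z $ i / saff (z $ i) =
          of_real (- 2 * (1 / (c * \<rho>) * (arctan (n i) * (1 + (n i)\<^sup>2) / n i)) / (1 + (n i)\<^sup>2)) * (cnj (z $ i) * z $ i)"
        using saff_nonzero[of "z $ i"] one_plus_norm_sq_pos[of "z $ i"]
        by (simp add: X_def sphere_product_grad_def saff_eq scaleR_conv_of_real[where 'a = complex] n_def \<rho>_def)
      also have "\<dots> = of_real (- 2 * (arctan (n i) * n i / (c * \<rho>)))"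
        unfolding zz of_real_mult[symmetric] of_real_eq_iff
        using n[of i] one_plus_norm_sq_pos[of "n i"] by (simp add: power2_eq_square)
      finally show ?thesis by (simp only: Re_complex_of_real)
    qed
    have "(\<lambda>u. sph_conn z u (X z)) = (\<lambda>u. \<chi> i. (- 2 * cnj (z $ i) * X z $ i / saff (z $ i)) * u $ i)"
      by (simp add: sph_conn_def fun_eq_iff vec_eq_iff)
    then have "endo_trace (\<lambda>u. sph_conn z u (X z)) = 2 * (\<Sum>i\<in>UNIV. Re (- 2 * cnj (z $ i) * X z $ i / saff (z $ i)))"
      by (simp only: endo_trace_diag)
    then show ?thesis unfolding Re_eq by (simp add: sum_distrib_left sum_divide_distrib)
  qed
  have "laplace_beltrami sph_metric (rdist sphere_product 0) z =
      endo_trace (\<lambda>u. (1 / (c * \<rho>)) *\<^sub>R L u + (- (w \<bullet> u) / (c * \<rho>\<^sup>2)) *\<^sub>R sphere_product_grad z)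
      + endo_trace (\<lambda>u. sph_conn z u (X z))"
    by (rule sph.laplace_beltrami_eq[OF _ _ zV grad DX])
      (use open_nth_nonzero in \<open>simp_all add: V_def\<close>)
  also have "(\<lambda>u. (- (w \<bullet> u) / (c * \<rho>\<^sup>2)) *\<^sub>R sphere_product_grad z) = (\<lambda>u. (- 1 / (c * \<rho>\<^sup>2)) *\<^sub>R ((w \<bullet> u) *\<^sub>R sphere_product_grad z))"
    by simp
  finally have "laplace_beltrami sph_metric (rdist sphere_product 0) z =
      1 / (c * \<rho>) * (\<Sum>i\<in>UNIV. 1 + arctan (n i) * (3 * n i + 1 / n i)) - 1 / (c * \<rho>\<^sup>2) * \<rho>
      - 4 * (\<Sum>i\<in>UNIV. arctan (n i) * n i) / (c * \<rho>)"
    unfolding endo_trace_add endo_trace_scaleR endo_trace_rank_one traceL wY trace\<Gamma> by simp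
  also have "\<dots> = (1 + (\<Sum>i\<in>UNIV. arctan (n i) * (1 / n i - n i))) / (c * \<rho>)"
    using c \<rho> by (simp add: sum.distrib sum_2 field_simps power2_eq_square)
  finally show ?thesis
    by (simp add: laplacian_def chart_at_sphere_product r \<rho>_def n_def) (simp add: sphere_product_def)
qed

lemma smooth_near_sphere_product:
  fixes z :: "complex ^ 2"
  assumes z: "\<And>i. z $ i \<noteq> 0"
  shows "smooth_near sphere_product (rdist sphere_product 0) z"
proof -
  define V where "V = {z :: complex ^ 2. \<forall>i. z $ i \<noteq> 0}"
  have V: "open V" unfolding V_def by (rule open_nth_nonzero)
  have nrm: "smooth_on (\<lambda>x. (norm (x $ i))\<^sup>2) V" for i
    unfolding cmod_power2
    by (intro smooth_on_add smooth_on_power smooth_on_bounded_linear V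
        bounded_linear_compose[OF bounded_linear_Re bounded_linear_vec_nth]
        bounded_linear_compose[OF bounded_linear_Im bounded_linear_vec_nth])
  \<comment> \<open>Norms enter as square roots of their squares, because the squares are polynomial
    and hence smooth.\<close>
  have "smooth_on (\<lambda>x. (arctan (sqrt ((norm (x $ i))\<^sup>2)))\<^sup>2) V" for i
    by (intro smooth_on_power smooth_on_arctan smooth_on_sqrt nrm V) (simp add: V_def)
  then have "smooth_on (\<lambda>x. (arctan (sqrt ((norm (x $ 1))\<^sup>2)))\<^sup>2 + (arctan (sqrt ((norm (x $ 2))\<^sup>2)))\<^sup>2) V"
    by (intro smooth_on_add V)
  then have "smooth_on (\<lambda>x. sqrt (2 / 3) * sqrt ((arctan (norm (x $ 1)))\<^sup>2 + (arctan (norm (x $ 2)))\<^sup>2)) V"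
    by (intro smooth_on_mult smooth_on_const smooth_on_sqrt V) (simp_all add: V_def add_pos_pos)
  then have "smooth_on (rdist sphere_product 0) V"
    by (rule smooth_on_cong[OF _ V]) (simp add: rdist_sphere_product sphere_product_radius_def L2_set_def sum_2)
  then show ?thesis
    unfolding smooth_near_def
    by (intro bexI[of _ "(UNIV, id)"] conjI exI[of _ V]) (use V z in \<open>auto simp: V_def sphere_product_def\<close>)
qed


section \<open>The complex projective plane\<close>

definition proj :: "complex ^ 3 \<Rightarrow> complex ^ 3 ^ 3" where
  "proj w = (\<chi> a b. w $ a * cnj (w $ b) / herm w w)"

definition CP2 :: "(complex ^ 3 ^ 3) set" where
  "CP2 = proj ` (- {0})"

text \<open>The index type \<open>3\<close> carries arithmetic modulo 3.\<close>

definition aff_index :: "3 \<Rightarrow> 2 \<Rightarrow> 3" where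
  "aff_index i k = (if k = 1 then i + 1 else i + 2)"

text \<open>The differential of \<open>aff_emb i\<close>.\<close>

definition lin_emb :: "3 \<Rightarrow> complex ^ 2 \<Rightarrow> complex ^ 3" where
  "lin_emb i u = (\<chi> a. if a = i then 0 else if a = i + 1 then u $ 1 else u $ 2)"

definition aff_emb :: "3 \<Rightarrow> complex ^ 2 \<Rightarrow> complex ^ 3" where
  "aff_emb i z = axis i 1 + lin_emb i z"

definition ratio :: "3 \<Rightarrow> complex ^ 3 \<Rightarrow> complex ^ 2" where
  "ratio i w = (\<chi> k. w $ aff_index i k / w $ i)"

definition ratio_deriv :: "3 \<Rightarrow> complex ^ 3 \<Rightarrow> complex ^ 3 \<Rightarrow> complex ^ 2" where
  "ratio_deriv i w u = (\<chi> k. u $ aff_index i k / w $ i - w $ aff_index i k * u $ i / (w $ i)\<^sup>2)"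

definition affine_coord :: "3 \<Rightarrow> complex ^ 3 ^ 3 \<Rightarrow> complex ^ 2" where
  "affine_coord i P = (\<chi> k. P $ aff_index i k $ i / P $ i $ i)"

text \<open>The diagonal entries of a point of \<open>CP2\<close> are nonnegative and add up to 1.
  As 1/4 < 1/3, the three domains cover \<open>CP2\<close>; where one entry exceeds 3/4 the others
  are below 1/4 and only one chart is left.\<close>

definition affine_chart :: "3 \<Rightarrow> (complex ^ 3 ^ 3, 2) chart" where
  "affine_chart i = ({P \<in> CP2. Re (P $ i $ i) > 1 / 4}, affine_coord i)"

definition projective_plane :: "(complex ^ 3 ^ 3, 2) cmanifold" where
  "projective_plane = \<lparr>mtop = top_of_set CP2, atlas = range affine_chart, metric_in = (\<lambda>_. fs_metric)\<rparr>"

text \<open>The Fubini-Study form in homogeneous coordinates: the product of the components of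
  \<open>u\<close> and \<open>v\<close> orthogonal to \<open>w\<close>, divided by the squared
  length of \<open>w\<close>.\<close>

definition pfs :: "complex ^ 'n::finite \<Rightarrow> complex ^ 'n \<Rightarrow> complex ^ 'n \<Rightarrow> complex" where
  "pfs w u v = herm u v / herm w w - herm u w * herm w v / (herm w w)\<^sup>2"

section \<open>Affine and homogeneous coordinates\<close>

lemma index3_cases: "a = i \<or> a = i + 1 \<or> a = i + 2" for a i :: 3
  using exhaust_3[of a] exhaust_3[of i] by auto

lemma index3_neq: "i + 1 \<noteq> i" "i + 2 \<noteq> i" "i + 2 \<noteq> i + 1" "i \<noteq> i + 1" "i \<noteq> i + 2" "i + 1 \<noteq> i + 2" for i :: 3
  using exhaust_3[of i] by auto

lemma sum_index3: "sum f UNIV = f i + f (i + 1) + f (i + 2)" for i :: 3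
proof -
  have "UNIV = {i, i + 1, i + 2}" using index3_cases by blast
  then have "sum f UNIV = sum f {i, i + 1, i + 2}" by (rule arg_cong)
  then show ?thesis by (simp add: index3_neq add.assoc)
qed

lemma aff_index_simps: "aff_index i 1 = i + 1" "aff_index i 2 = i + 2"
  by (simp_all add: aff_index_def)

lemma vec2_eq_iff: "u = v \<longleftrightarrow> u $ 1 = v $ 1 \<and> u $ 2 = v $ 2" for u v :: "'b ^ 2"
  by (simp add: vec_eq_iff forall_2)

lemma vec3_eq_iff: "u = v \<longleftrightarrow> u $ i = v $ i \<and> u $ (i + 1) = v $ (i + 1) \<and> u $ (i + 2) = v $ (i + 2)"
  for u v :: "'b ^ 3" and i :: 3
proof
  assume eq: "u $ i = v $ i \<and> u $ (i + 1) = v $ (i + 1) \<and> u $ (i + 2) = v $ (i + 2)"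
  have "u $ a = v $ a" for a
    using index3_cases[of a i] eq by (elim disjE) simp_all
  then show "u = v" by (simp add: vec_eq_iff)
qed simp

lemma lin_emb_nth:
  "lin_emb i u $ i = 0" "lin_emb i u $ (i + 1) = u $ 1" "lin_emb i u $ (i + 2) = u $ 2"
  by (simp_all add: lin_emb_def index3_neq)

lemma aff_emb_nth:
  "aff_emb i z $ i = 1" "aff_emb i z $ (i + 1) = z $ 1" "aff_emb i z $ (i + 2) = z $ 2"
  by (simp_all add: aff_emb_def lin_emb_nth axis_def index3_neq)

lemma aff_emb_nonzero: "aff_emb i z \<noteq> 0"
  using aff_emb_nth(1)[of i z] by (metis zero_index zero_neq_one)

lemma herm_2: "herm u v = u $ 1 * cnj (v $ 1) + u $ 2 * cnj (v $ 2)" for u v :: "complex ^ 2"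
  by (simp add: herm_def sum_2)

lemma herm_aff_emb:
  "herm (aff_emb i z) (aff_emb i x) = 1 + herm z x"
  "herm (lin_emb i u) (aff_emb i z) = herm u z" "herm (aff_emb i z) (lin_emb i u) = herm z u"
  "herm (lin_emb i u) (lin_emb i v) = herm u v"
  unfolding herm_def[of "aff_emb i _"] herm_def[of "lin_emb i _"] sum_index3[of _ i]
  by (simp_all add: aff_emb_nth lin_emb_nth herm_2)

lemma fs_herm_eq_pfs: "fs_herm z u v = pfs (aff_emb i z) (lin_emb i u) (lin_emb i v)"
  by (simp add: fs_herm_def pfs_def herm_aff_emb aff_def)

lemma herm_self_eq_0_iff: "herm w w = 0 \<longleftrightarrow> w = 0"
  by (simp add: herm_self)

text \<open>Rescaling \<open>w\<close> together with the tangent vectors, or moving the latter along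
  \<open>w\<close>, does not move the line differently. Hence \<open>pfs\<close> lives on the
  projective space, and all affine charts see the same metric.\<close>

lemma pfs_invariant:
  assumes "c \<noteq> 0" "w \<noteq> 0"
  shows "pfs (c *s w) (c *s u + a *s w) (c *s v + b *s w) = pfs w u v"
proof -
  have "cnj c \<noteq> 0" "herm w w \<noteq> 0" using assms by (simp_all add: herm_self_eq_0_iff)
  then show ?thesis using assms(1)
    apply (simp add: pfs_def herm_simps power2_eq_square divide_simps)
    apply (simp add: algebra_simps)
    done
qed

lemma aff_emb_ratio: "w $ i \<noteq> 0 \<Longrightarrow> aff_emb i (ratio i w) = (1 / w $ i) *s w"
  by (simp add: vec3_eq_iff[of _ _ i] aff_emb_nth ratio_def aff_index_simps)

lemma lin_emb_ratio_deriv: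
  "w $ i \<noteq> 0 \<Longrightarrow> lin_emb i (ratio_deriv i w u) = (1 / w $ i) *s u + (- u $ i / (w $ i)\<^sup>2) *s w"
  by (simp add: vec3_eq_iff[of _ _ i] lin_emb_nth ratio_deriv_def aff_index_simps power2_eq_square)

lemma fs_herm_ratio:
  assumes "w $ i \<noteq> 0"
  shows "fs_herm (ratio i w) (ratio_deriv i w u) (ratio_deriv i w v) = pfs w u v"
proof -
  have "w \<noteq> 0" using assms by auto
  then show ?thesis
    unfolding fs_herm_eq_pfs[of _ _ _ i] aff_emb_ratio[OF assms] lin_emb_ratio_deriv[OF assms]
    using assms by (intro pfs_invariant) auto
qed

lemma ratio_has_derivative:
  assumes "w $ i \<noteq> 0"
  shows "(ratio i has_derivative ratio_deriv i w) (at w)"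
  unfolding ratio_def[abs_def] ratio_deriv_def[abs_def]
proof (rule vec_lambda_has_derivative)
  fix k
  show "((\<lambda>x. x $ aff_index i k / x $ i) has_derivative
      (\<lambda>u. u $ aff_index i k / w $ i - w $ aff_index i k * u $ i / (w $ i)\<^sup>2)) (at w)"
    by (rule has_derivative_eq_rhs[OF has_derivative_divide'[OF nth_has_derivative nth_has_derivative assms]])
      (use assms in \<open>simp add: fun_eq_iff power2_eq_square field_simps\<close>)
qed

lemma aff_emb_has_derivative: "(aff_emb i has_derivative lin_emb i) (at z)"
proof -
  have "bounded_linear (lin_emb i)"
    unfolding linear_conv_bounded_linear[symmetric]
    by (auto intro!: linearI simp: vec3_eq_iff[of _ _ i] lin_emb_nth)
  from has_derivative_add[OF has_derivative_const bounded_linear_imp_has_derivative[OF this]]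
  show ?thesis by (simp add: aff_emb_def[abs_def])
qed

section \<open>Lines as projections, and the chart domains\<close>

lemma proj_scale: "c \<noteq> 0 \<Longrightarrow> proj (c *s w) = proj w"
  by (simp add: proj_def vec_eq_iff herm_simps)

lemma proj_in_CP2: "w \<noteq> 0 \<Longrightarrow> proj w \<in> CP2"
  by (simp add: CP2_def)

lemma of_real_scale_eq_scaleR: "of_real r *s w = r *\<^sub>R w" for w :: "complex ^ 'n"
  by (simp add: vec_eq_iff scaleR_conv_of_real[where 'a = complex])

lemma CP2_E:
  assumes "P \<in> CP2"
  obtains w where "norm w = 1" "P = proj w"
proof -
  obtain w where w: "w \<noteq> 0" "P = proj w" using assms by (auto simp: CP2_def)
  show thesis
  proof
    show "norm (of_real (1 / norm w) *s w) = 1"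
      unfolding of_real_scale_eq_scaleR using w(1) by simp
    show "P = proj (of_real (1 / norm w) *s w)"
      unfolding w(2) using w(1) by (subst proj_scale) auto
  qed
qed

text \<open>The trace product of two rank one projections is the squared cosine of the angle between
  the lines.\<close>

lemma inner_proj:
  assumes "w \<noteq> 0" "v \<noteq> 0"
  shows "proj w \<bullet> proj v = (norm (herm w v))\<^sup>2 / ((norm w)\<^sup>2 * (norm v)\<^sup>2)"
proof -
  have "(\<Sum>a\<in>UNIV. \<Sum>b\<in>UNIV. proj w $ a $ b * cnj (proj v $ a $ b)) =
      herm w v * cnj (herm w v) / (herm w w * herm v v)"
    unfolding herm_def[of w v] cnj_sum sum_product sum_divide_distrib
    by (simp add: proj_def cnj_herm mult_ac)
  also have "\<dots> = of_real ((norm (herm w v))\<^sup>2 / ((norm w)\<^sup>2 * (norm v)\<^sup>2))"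
    by (simp add: complex_norm_square[symmetric] herm_self del: complex_cnj_mult)
  finally have "Re (\<Sum>a\<in>UNIV. \<Sum>b\<in>UNIV. proj w $ a $ b * cnj (proj v $ a $ b)) =
      (norm (herm w v))\<^sup>2 / ((norm w)\<^sup>2 * (norm v)\<^sup>2)" by (simp only: Re_complex_of_real)
  then show ?thesis by (simp add: inner_vec_def inner_complex_def)
qed

lemma inner_CP2: 
  assumes "P \<in> CP2" "Q \<in> CP2"
  shows "0 \<le> P \<bullet> Q" "P \<bullet> Q \<le> 1"
proof -
  obtain w where w: "norm w = 1" "P = proj w" by (rule CP2_E[OF assms(1)])
  obtain v where v: "norm v = 1" "Q = proj v" by (rule CP2_E[OF assms(2)])
  have "w \<noteq> 0" "v \<noteq> 0" using w v by auto
  then show "0 \<le> P \<bullet> Q" "P \<bullet> Q \<le> 1"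
    using herm_Cauchy_Schwarz[of w v] by (simp_all add: inner_proj w v)
qed

lemma norm_CP2: "P \<in> CP2 \<Longrightarrow> norm P = 1"
proof -
  assume "P \<in> CP2"
  then obtain w where w: "norm w = 1" "P = proj w" by (rule CP2_E)
  then have "w \<noteq> 0" by auto
  then have "P \<bullet> P = 1" using w inner_proj[of w w] by (simp add: herm_self)
  then show ?thesis by (simp add: norm_eq_sqrt_inner)
qed

lemma proj_nth_diag: "proj w $ a $ a = of_real ((norm (w $ a))\<^sup>2 / (norm w)\<^sup>2)"
  unfolding proj_def herm_self using complex_norm_square[of "w $ a"] by simp

lemma CP2_diag:
  assumes "P \<in> CP2"
  shows "Re (P $ a $ a) \<ge> 0" "(\<Sum>a\<in>UNIV. Re (P $ a $ a)) = 1"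
proof -
  obtain w where w: "norm w = 1" "P = proj w" using assms by (rule CP2_E)
  show "Re (P $ a $ a) \<ge> 0" by (simp add: w proj_nth_diag)
  show "(\<Sum>a\<in>UNIV. Re (P $ a $ a)) = 1"
    using w(1) by (simp add: w(2) proj_nth_diag norm_vec_def L2_set_def)
qed

lemma affine_coord_proj:
  assumes "w $ i \<noteq> 0"
  shows "affine_coord i (proj w) = ratio i w"
proof -
  have "w \<noteq> 0" using assms by auto
  then show ?thesis
    using assms by (simp add: affine_coord_def ratio_def proj_def vec_eq_iff herm_self_eq_0_iff)
qed

lemma ratio_aff_emb: "ratio i (aff_emb i z) = z"
  by (simp add: vec2_eq_iff ratio_def aff_index_simps aff_emb_nth)

lemma affine_coord_proj_aff_emb: "affine_coord i (proj (aff_emb i z)) = z"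
  by (simp add: affine_coord_proj aff_emb_nth ratio_aff_emb)

lemma proj_aff_emb_affine_coord:
  assumes "P \<in> CP2" "P $ i $ i \<noteq> 0"
  shows "proj (aff_emb i (affine_coord i P)) = P"
proof -
  obtain w where w: "norm w = 1" "P = proj w" using assms(1) by (rule CP2_E)
  then have "w $ i \<noteq> 0" using assms(2) by (auto simp: proj_def)
  then show ?thesis by (simp add: w affine_coord_proj aff_emb_ratio proj_scale)
qed

lemma proj_aff_emb_diag: "Re (proj (aff_emb i z) $ i $ i) = 1 / (1 + (norm z)\<^sup>2)"
proof -
  have "herm (aff_emb i z) (aff_emb i z) = of_real (1 + (norm z)\<^sup>2)"
    unfolding herm_aff_emb by (simp add: herm_self)
  then have "of_real ((norm (aff_emb i z))\<^sup>2) = (of_real (1 + (norm z)\<^sup>2) :: complex)"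
    unfolding herm_self[of "aff_emb i z"] .
  then have "(norm (aff_emb i z))\<^sup>2 = 1 + (norm z)\<^sup>2" by (simp only: of_real_eq_iff)
  then show ?thesis by (simp add: proj_nth_diag aff_emb_nth)
qed

lemma cdom_affine_chart: "P \<in> cdom (affine_chart i) \<longleftrightarrow> P \<in> CP2 \<and> Re (P $ i $ i) > 1 / 4"
  by (simp add: affine_chart_def)

lemma coord_affine_chart [simp]: "coord (affine_chart i) = affine_coord i"
  by (simp add: affine_chart_def)

lemma proj_aff_emb_in_cdom_iff:
  "proj (aff_emb i z) \<in> cdom (affine_chart i) \<longleftrightarrow> norm z < sqrt 3"
proof -
  have "1 / (1 + (norm z)\<^sup>2) > 1 / 4 \<longleftrightarrow> (norm z)\<^sup>2 < 3"
    using one_plus_norm_sq_pos[of z] by (auto simp: field_simps)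
  also have "\<dots> \<longleftrightarrow> norm z < sqrt 3"
    by (metis norm_ge_zero real_sqrt_less_iff real_sqrt_abs abs_norm_cancel)
  finally show ?thesis
    by (simp add: cdom_affine_chart proj_in_CP2 aff_emb_nonzero proj_aff_emb_diag)
qed

lemma proj_aff_emb_coord:
  "P \<in> cdom (affine_chart i) \<Longrightarrow> proj (aff_emb i (affine_coord i P)) = P"
  by (rule proj_aff_emb_affine_coord) (auto simp: cdom_affine_chart)

lemma cran_affine_chart: "cran (affine_chart i) = ball 0 (sqrt 3)"
proof (intro set_eqI iffI)
  fix z assume "z \<in> cran (affine_chart i)"
  then obtain P where "P \<in> cdom (affine_chart i)" "z = affine_coord i P" by auto
  then show "z \<in> ball 0 (sqrt 3)"
    using proj_aff_emb_coord[of P i] proj_aff_emb_in_cdom_iff[of i z] by simp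
next
  fix z :: "complex ^ 2" assume "z \<in> ball 0 (sqrt 3)"
  then have "proj (aff_emb i z) \<in> cdom (affine_chart i)" by (simp add: proj_aff_emb_in_cdom_iff)
  then show "z \<in> cran (affine_chart i)"
    using affine_coord_proj_aff_emb[of i z] by (auto intro!: image_eqI[of _ _ "proj (aff_emb i z)"])
qed

lemma cinv_affine_chart:
  assumes "z \<in> ball 0 (sqrt 3)"
  shows "cinv (affine_chart i) z = proj (aff_emb i z)"
proof -
  have "z \<in> affine_coord i ` cdom (affine_chart i)" using assms cran_affine_chart[of i] by simp
  then show ?thesis
    using inv_into_into[of z "affine_coord i" "cdom (affine_chart i)"]
      f_inv_into_f[of z "affine_coord i" "cdom (affine_chart i)"] proj_aff_emb_coord
    by (metis coord_affine_chart)
qed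

lemma continuous_on_proj [continuous_intros]:
  assumes "continuous_on S f" "\<And>x. x \<in> S \<Longrightarrow> f x \<noteq> 0"
  shows "continuous_on S (\<lambda>x. proj (f x))"
  unfolding proj_def herm_def
  using assms by (intro continuous_intros) (simp_all add: herm_def[symmetric] herm_self_eq_0_iff)

lemma continuous_on_aff_emb: "continuous_on S (aff_emb i)"
  by (meson aff_emb_has_derivative continuous_at_imp_continuous_on has_derivative_continuous)

lemma is_chart_affine_chart: "is_chart (top_of_set CP2) (affine_chart i)"
  unfolding is_chart_def
proof (intro conjI)
  have eq: "cdom (affine_chart i) = CP2 \<inter> {P. Re (P $ i $ i) > 1 / 4}"
    by (auto simp: affine_chart_def)
  have "open {P :: complex ^ 3 ^ 3. Re (P $ i $ i) > 1 / 4}"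
    by (intro open_Collect_less continuous_intros)
  then show "openin (top_of_set CP2) (cdom (affine_chart i))"
    unfolding eq by (rule openin_open_Int)
  show "open (cran (affine_chart i))" by (simp only: cran_affine_chart open_ball)
  have sub: "subtopology (top_of_set CP2) (cdom (affine_chart i)) = top_of_set (cdom (affine_chart i))"
    by (simp add: subtopology_subtopology eq Int_absorb1)
  have "homeomorphic_maps (top_of_set (cdom (affine_chart i))) (top_of_set (ball 0 (sqrt 3)))
      (affine_coord i) (\<lambda>z. proj (aff_emb i z))"
    unfolding homeomorphic_maps_def
  proof (intro conjI ballI)
    have nz: "P $ i $ i \<noteq> 0" if "P \<in> cdom (affine_chart i)" for P
      using that by (auto simp: cdom_affine_chart)
    have "continuous_on (cdom (affine_chart i)) (affine_coord i)"
      unfolding affine_coord_def[abs_def] using nz by (intro continuous_intros) auto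
    then show "continuous_map (top_of_set (cdom (affine_chart i))) (top_of_set (ball 0 (sqrt 3))) (affine_coord i)"
      using cran_affine_chart[of i] by (auto simp del: mem_ball)
    have "continuous_on (ball 0 (sqrt 3)) (\<lambda>z. proj (aff_emb i z))"
      by (intro continuous_intros continuous_on_aff_emb aff_emb_nonzero)
    then show "continuous_map (top_of_set (ball 0 (sqrt 3))) (top_of_set (cdom (affine_chart i))) (\<lambda>z. proj (aff_emb i z))"
      by (auto simp: proj_aff_emb_in_cdom_iff)
  qed (auto simp: proj_aff_emb_coord affine_coord_proj_aff_emb)
  then show "homeomorphic_map (subtopology (top_of_set CP2) (cdom (affine_chart i)))
      (top_of_set (cran (affine_chart i))) (coord (affine_chart i))"
    unfolding sub cran_affine_chart by (auto simp: homeomorphic_map_maps)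
qed

text \<open>The coordinate change is \<open>ratio j\<close> after \<open>aff_emb i\<close>, and both
  metrics are \<open>pfs\<close> at the same homogeneous vector \<open>aff_emb i z\<close>.\<close>

lemma compatible_affine_charts:
  "compatible_charts projective_plane (affine_chart i) (affine_chart j)"
  unfolding compatible_charts_def
proof
  fix z assume "z \<in> coord (affine_chart i) ` (cdom (affine_chart i) \<inter> cdom (affine_chart j))"
  then obtain P where P: "P \<in> cdom (affine_chart i)" "P \<in> cdom (affine_chart j)" "z = affine_coord i P"
    by auto
  then have z: "z \<in> ball 0 (sqrt 3)" using cran_affine_chart[of i] by auto
  have P_eq: "P = proj (aff_emb i z)" using proj_aff_emb_coord[OF P(1)] P(3) by simp
  then have w: "aff_emb i z $ j \<noteq> 0"
    using P(2) by (auto simp: cdom_affine_chart proj_def)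
  define T where "T = ratio_deriv j (aff_emb i z) \<circ> lin_emb i"
  have cont: "continuous_on UNIV (\<lambda>x. aff_emb i x $ j)"
    by (intro continuous_intros continuous_on_aff_emb)
  define V where "V = ball 0 (sqrt 3) \<inter> {x. aff_emb i x $ j \<noteq> 0}"
  have "open V" unfolding V_def by (intro open_Int open_ball open_Collect_neq cont continuous_on_const)
  have eq: "(coord (affine_chart j) \<circ> cinv (affine_chart i)) x = ratio j (aff_emb i x)" if "x \<in> V" for x
  proof -
    have x: "x \<in> ball 0 (sqrt 3)" "aff_emb i x $ j \<noteq> 0" using that by (auto simp: V_def)
    show ?thesis
      unfolding o_def cinv_affine_chart[OF x(1)] unfolding coord_affine_chart by (rule affine_coord_proj[OF x(2)])
  qed
  have "((\<lambda>x. ratio j (aff_emb i x)) has_derivative T) (at z)"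
    unfolding T_def o_def by (rule has_derivative_compose[OF aff_emb_has_derivative ratio_has_derivative[OF w]])
  then have "((coord (affine_chart j) \<circ> cinv (affine_chart i)) has_derivative T) (at z)"
    by (rule has_derivative_transform_within_open[OF _ \<open>open V\<close>]) (use z w in \<open>auto simp: V_def eq[symmetric]\<close>)
  moreover have "T (cplx_J v) = cplx_J (T v)" for v
  proof -
    have "lin_emb i (cplx_J v) = \<i> *s lin_emb i v"
      by (simp add: vec3_eq_iff[of _ _ i] lin_emb_nth cplx_J_def)
    then show ?thesis by (simp add: T_def ratio_deriv_def vec_eq_iff cplx_J_def algebra_simps)
  qed
  moreover have "fs_metric z u v = fs_metric ((coord (affine_chart j) \<circ> cinv (affine_chart i)) z) (T u) (T v)" for u v
  proof -
    have "z \<in> V" using z w by (simp add: V_def)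
    then show ?thesis
      unfolding eq[OF \<open>z \<in> V\<close>] unfolding T_def o_def fs_metric_def fs_herm_ratio[OF w]
      by (simp add: fs_herm_eq_pfs[of z _ _ i])
  qed
  ultimately show "\<exists>T. ((coord (affine_chart j) \<circ> cinv (affine_chart i)) has_derivative T) (at z) \<and>
      (\<forall>v. T (cplx_J v) = cplx_J (T v)) \<and>
      (\<forall>u v. metric_in projective_plane (affine_chart i) z u v =
        metric_in projective_plane (affine_chart j) ((coord (affine_chart j) \<circ> cinv (affine_chart i)) z) (T u) (T v))"
    by (auto simp: projective_plane_def)
qed

section \<open>The Kaehler structure of the projective plane\<close>

lemma CP2_covered:
  assumes "P \<in> CP2"
  shows "\<exists>i. P \<in> cdom (affine_chart i)"
proof (rule ccontr)
  assume "\<nexists>i. P \<in> cdom (affine_chart i)"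
  then have "Re (P $ i $ i) \<le> 1 / 4" for i
    using assms unfolding cdom_affine_chart by (meson not_le)
  then have "(\<Sum>i\<in>UNIV. Re (P $ i $ i)) \<le> (\<Sum>i\<in>(UNIV::3 set). 1 / 4)" by (rule sum_mono)
  then show False using CP2_diag(2)[OF assms] by simp
qed

lemma path_connected_CP2: "path_connected CP2"
  unfolding CP2_def
  by (intro path_connected_continuous_image continuous_on_proj continuous_on_id path_connected_punctured_universe) auto

lemma kaehler_projective_plane: "kaehler_manifold projective_plane"
  unfolding kaehler_manifold_def
proof (intro conjI ballI)
  show "Hausdorff_space (mtop projective_plane)"
    by (simp add: projective_plane_def Hausdorff_space_subtopology)
  show "second_countable (mtop projective_plane)"
    by (simp add: projective_plane_def second_countable_subtopology second_countable_euclidean)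
  show "connected_space (mtop projective_plane)"
    using path_connected_imp_connected[OF path_connected_CP2]
    by (simp add: projective_plane_def connected_space_subtopology)
  show "points projective_plane \<noteq> {}"
    using proj_in_CP2[OF aff_emb_nonzero] by (auto simp: projective_plane_def)
  show "(\<Union>c\<in>atlas projective_plane. cdom c) = points projective_plane"
    using CP2_covered unfolding projective_plane_def by (force simp: cdom_affine_chart)
  fix c d assume "c \<in> atlas projective_plane"
  then obtain i where c: "c = affine_chart i" by (auto simp: projective_plane_def)
  show "is_chart (mtop projective_plane) c"
    using is_chart_affine_chart by (simp add: c projective_plane_def)
  show "hermitian_metric_on (metric_in projective_plane c) (cran c)"
    unfolding c cran_affine_chart by (simp add: projective_plane_def hermitian_fs_metric)
  show "fundamental_form_closed_on (metric_in projective_plane c) (cran c)"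
    unfolding c cran_affine_chart by (simp add: projective_plane_def fundamental_form_closed_fs_metric)
  assume "d \<in> atlas projective_plane"
  then obtain j where d: "d = affine_chart j" by (auto simp: projective_plane_def)
  show "compatible_charts projective_plane c d"
    unfolding c d by (rule compatible_affine_charts)
qed

lemma ricci_eq_projective_plane: "ricci_eq projective_plane 6"
  by (simp add: ricci_eq_def projective_plane_def ricci_fs_metric)

lemma chsc_projective_plane: "constant_holomorphic_sectional_curvature projective_plane"
  unfolding constant_holomorphic_sectional_curvature_def
  by (intro exI[of _ 4]) (simp add: projective_plane_def Let_def holomorphic_sectional_curvature_fs_metric)


section \<open>Distances on the projective plane\<close>

text \<open>The angle between the two lines. Its double is used because 2 cos^2 - 1 is affine in the
  overlap and has the form of the height functions above.\<close>

definition fs_dist :: "complex ^ 3 ^ 3 \<Rightarrow> complex ^ 3 ^ 3 \<Rightarrow> real" where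
  "fs_dist P Q = arccos (2 * (P \<bullet> Q) - 1) / 2"

text \<open>If \<open>w $ i = 0\<close>, division by zero makes both sides 0, so curves pass to
  coordinates without tracking the chart domain.\<close>

lemma affine_coord_proj_eq_ratio: "affine_coord i (proj w) = ratio i w"
proof (cases "w $ i = 0")
  case True
  then show ?thesis by (simp add: affine_coord_def ratio_def proj_def vec_eq_iff)
qed (rule affine_coord_proj)

lemma chart_at_projective_plane:
  assumes "P \<in> CP2"
  obtains i where "chart_at projective_plane P = affine_chart i" "P \<in> cdom (affine_chart i)"
proof -
  have "\<exists>c. c \<in> atlas projective_plane \<and> P \<in> cdom c"
    using CP2_covered[OF assms] by (auto simp: projective_plane_def)
  then have "chart_at projective_plane P \<in> atlas projective_plane \<and> P \<in> cdom (chart_at projective_plane P)"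
    unfolding chart_at_def by (rule someI_ex)
  then show thesis using that by (auto simp: projective_plane_def)
qed

lemma metric_in_projective_plane [simp]: "metric_in projective_plane c = fs_metric"
  by (simp add: projective_plane_def)

lemma points_projective_plane [simp]: "points projective_plane = CP2"
  by (simp add: projective_plane_def)

text \<open>Only the component of \<open>u\<close> orthogonal to \<open>w\<close> moves the line spanned by \<open>w\<close>; the bound is
  the Cauchy-Schwarz inequality for this component and that of \<open>v\<close>.\<close>

lemma overlap_deriv_bound:
  fixes w u v :: "complex ^ 'n::finite"
  assumes w: "w \<noteq> 0" and v: "norm v = 1"
  defines "A \<equiv> herm w w" and "\<tau> \<equiv> (norm (herm w v))\<^sup>2 / (norm w)\<^sup>2"
  shows "(Re (((herm u v * herm v w + herm w v * herm v u) * A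
      - herm w v * herm v w * (herm u w + herm w u)) / (A * A)))\<^sup>2 \<le> 4 * \<tau> * (1 - \<tau>) * Re (pfs w u u)"
proof -
  have A: "A \<noteq> 0" "A = of_real ((norm w)\<^sup>2)" "cnj A = A"
    using w by (simp_all add: A_def herm_self)
  define u' where "u' = u - (herm u w / A) *s w"
  define v' where "v' = v - (herm v w / A) *s w"
  define X where "X = herm v w * herm u' v / A"
  have orth: "herm u' w = 0" using A(1) by (simp add: u'_def herm_simps A_def[symmetric])
  have "herm u' v = herm u' v'" by (simp add: v'_def herm_simps orth)
  then have X: "norm X = norm (herm w v) * norm (herm u' v') / (norm w)\<^sup>2"
    by (simp add: X_def A(2) norm_divide norm_mult norm_power) (metis cnj_herm complex_mod_cnj)
  have u': "Re (pfs w u u) * (norm w)\<^sup>2 = (norm u')\<^sup>2"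
  proof -
    have "pfs w u u * A = herm u' u'"
      using A(1,3) unfolding u'_def pfs_def A_def[symmetric]
      by (simp add: herm_simps cnj_herm A_def[symmetric] power2_eq_square field_simps)
    then have "Re (pfs w u u * A) = (norm u')\<^sup>2" by (simp only: herm_self Re_complex_of_real)
    then show ?thesis unfolding A(2) by simp
  qed
  have v': "1 - \<tau> = (norm v')\<^sup>2"
  proof -
    have "herm v' v' = herm v v - herm v w * herm w v / A"
      using A(1,3) unfolding v'_def by (simp add: herm_simps cnj_herm A_def[symmetric])
    also have "herm v w * herm w v = of_real ((norm (herm w v))\<^sup>2)"
      by (metis cnj_herm complex_norm_square mult.commute)
    finally have "of_real ((norm v')\<^sup>2) = (of_real (1 - \<tau>) :: complex)"
      unfolding herm_self A(2) v \<tau>_def by simp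
    then show ?thesis by (simp only: of_real_eq_iff)
  qed
  have D: "((herm u v * herm v w + herm w v * herm v u) * A
      - herm w v * herm v w * (herm u w + herm w u)) / (A * A) = X + cnj X"
    using A(1) unfolding X_def u'_def
    apply (simp add: herm_simps cnj_herm A(3) divide_simps)
    apply (simp add: algebra_simps)
    done
  have "(Re (X + cnj X))\<^sup>2 = 4 * (Re X)\<^sup>2" by (simp add: power_mult_distrib flip: mult_2)
  also have "\<dots> \<le> 4 * (norm X)\<^sup>2" by (simp add: cmod_power2)
  also have "\<dots> = 4 * ((norm (herm w v))\<^sup>2 * (norm (herm u' v'))\<^sup>2 / ((norm w)\<^sup>2)\<^sup>2)"
    by (simp add: X power_divide power_mult_distrib)
  also have "\<dots> \<le> 4 * ((norm (herm w v))\<^sup>2 * ((norm u')\<^sup>2 * (norm v')\<^sup>2) / ((norm w)\<^sup>2)\<^sup>2)"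
    by (intro mult_left_mono divide_right_mono herm_Cauchy_Schwarz) auto
  also have "\<dots> = 4 * \<tau> * (1 - \<tau>) * Re (pfs w u u)"
    unfolding u'[symmetric] v'[symmetric] using w by (simp add: \<tau>_def power2_eq_square)
  finally show ?thesis unfolding D .
qed

lemma norm_aff_emb: "(norm (aff_emb i z))\<^sup>2 = 1 + (norm z)\<^sup>2"
proof -
  have "Re (herm (aff_emb i z) (aff_emb i z)) = 1 + (norm z)\<^sup>2"
    unfolding herm_aff_emb by (simp add: herm_self)
  then show ?thesis unfolding herm_self[of "aff_emb i z"] by simp
qed

lemma overlap_has_derivative:
  assumes Q: "Q \<in> CP2"
  obtains F' where "((\<lambda>x. proj (aff_emb i x) \<bullet> Q) has_derivative F') (at z)"
    "\<And>u. (F' u)\<^sup>2 \<le> 4 * (proj (aff_emb i z) \<bullet> Q) * (1 - proj (aff_emb i z) \<bullet> Q) * fs_metric z u u"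
proof -
  obtain v where v: "norm v = 1" "Q = proj v" using Q by (rule CP2_E)
  then have "v \<noteq> 0" by auto
  then have eq: "proj (aff_emb i x) \<bullet> Q = (norm (herm (aff_emb i x) v))\<^sup>2 / (norm (aff_emb i x))\<^sup>2" for x
    by (simp add: v inner_proj aff_emb_nonzero)
  have eq': "proj (aff_emb i x) \<bullet> Q = Re (herm (aff_emb i x) v * herm v (aff_emb i x) / aff x)" for x
  proof -
    have "herm (aff_emb i x) v * herm v (aff_emb i x) = of_real ((norm (herm (aff_emb i x) v))\<^sup>2)"
      by (metis cnj_herm complex_norm_square)
    then show ?thesis unfolding eq aff_eq norm_aff_emb by (simp flip: of_real_power)
  qed
  define D where "D u = ((herm (lin_emb i u) v * herm v (aff_emb i z) + herm (aff_emb i z) v * herm v (lin_emb i u)) * aff z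
      - herm (aff_emb i z) v * herm v (aff_emb i z) * (herm u z + herm z u)) / (aff z * aff z)" for u
  have "((\<lambda>x. herm (aff_emb i x) v * herm v (aff_emb i x) / aff x) has_derivative D) (at z)"
    unfolding D_def
    by (rule has_derivative_eq_rhs[OF has_derivative_divide'[OF has_derivative_mult[OF
          has_derivative_compose[OF aff_emb_has_derivative herm_has_derivative_left]
          has_derivative_compose[OF aff_emb_has_derivative herm_has_derivative_right]] aff_has_derivative aff_nonzero]])
      (simp add: fun_eq_iff add.commute)
  from has_derivative_Re[OF this]
  have "((\<lambda>x. proj (aff_emb i x) \<bullet> Q) has_derivative (\<lambda>u. Re (D u))) (at z)"
    unfolding eq' .
  moreover have "(Re (D u))\<^sup>2 \<le> 4 * (proj (aff_emb i z) \<bullet> Q) * (1 - proj (aff_emb i z) \<bullet> Q) * fs_metric z u u" for u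
    using overlap_deriv_bound[OF aff_emb_nonzero[of i z] v(1), of "lin_emb i u"]
    unfolding D_def eq fs_metric_def fs_herm_eq_pfs[of z u u i]
    by (simp add: herm_aff_emb aff_def)
  ultimately show thesis by (rule that)
qed

text \<open>The point \<open>Q\<close> is independent of the ends of the curve. Taking it as the
  initial point bounds the distance from below; a general \<open>Q\<close> yields the triangle
  inequality.\<close>

lemma projective_plane_length_ge:
  assumes curve: "piecewise_C1_curve projective_plane R P \<gamma>" and Q: "Q \<in> CP2"
  shows "ennreal (fs_dist P Q - fs_dist R Q) \<le> curve_length projective_plane \<gamma>"
proof -
  obtain S where S: "finite S" and C1: "\<And>i. (affine_coord i \<circ> \<gamma>) C1_differentiable_on
      {t \<in> {0<..<1} - S. \<gamma> t \<in> cdom (affine_chart i)}"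
    using curve by (auto simp: piecewise_C1_curve_def projective_plane_def)
  have cont: "continuous_on {0..1} \<gamma>" and CP2: "\<And>t. t \<in> {0..1} \<Longrightarrow> \<gamma> t \<in> CP2"
    and ends: "\<gamma> 0 = R" "\<gamma> 1 = P"
    using curve by (auto simp: piecewise_C1_curve_def projective_plane_def)
  have ex: "\<exists>d. ((\<lambda>s. 2 * (\<gamma> s \<bullet> Q) - 1) has_real_derivative d) (at t) \<and>
      d\<^sup>2 \<le> 4 * (1 - (2 * (\<gamma> t \<bullet> Q) - 1)\<^sup>2) * (speed projective_plane \<gamma> t)\<^sup>2" if t: "t \<in> {0<..<1} - S" for t
  proof -
    have "\<gamma> t \<in> CP2" using t CP2 by auto
    then obtain i where i: "chart_at projective_plane (\<gamma> t) = affine_chart i" "\<gamma> t \<in> cdom (affine_chart i)"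
      by (rule chart_at_projective_plane)
    obtain v where v: "((affine_coord i \<circ> \<gamma>) has_vector_derivative v) (at t)"
      using C1[of i] t i(2) unfolding C1_differentiable_on_def by blast
    define z where "z = affine_coord i (\<gamma> t)"
    have speed: "(speed projective_plane \<gamma> t)\<^sup>2 = fs_metric z v v"
      using vector_derivative_at[OF v] bilinear_fs_metric[of z] fs_metric_pos[of v z]
      by (cases "v = 0") (simp_all add: speed_def i Let_def z_def bilinear_lzero)
    obtain F' where F': "((\<lambda>x. proj (aff_emb i x) \<bullet> Q) has_derivative F') (at z)"
      and bound: "\<And>u. (F' u)\<^sup>2 \<le> 4 * (proj (aff_emb i z) \<bullet> Q) * (1 - proj (aff_emb i z) \<bullet> Q) * fs_metric z u u"
      using overlap_has_derivative[OF Q] by blast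
    have D: "((\<lambda>s. proj (aff_emb i ((affine_coord i \<circ> \<gamma>) s)) \<bullet> Q) has_real_derivative F' v) (at t)"
      using has_derivative_compose[OF v[unfolded has_vector_derivative_def], of "\<lambda>x. proj (aff_emb i x) \<bullet> Q" F'] F'
      unfolding has_field_derivative_def
      by (simp add: z_def linear_cmul[OF has_derivative_linear[OF F']] mult_commute_abs)
    \<comment> \<open>While the curve stays in chart \<open>i\<close> it is recovered from its
      coordinates, which transfers the derivative of the overlap to the curve.\<close>
    define U where "U = {0<..<1} \<inter> \<gamma> -` {P. Re (P $ i $ i) > 1 / 4}"
    have "open U"
      unfolding U_def
    proof (rule continuous_open_preimage)
      show "continuous_on {0<..<1} \<gamma>" using cont by (rule continuous_on_subset) auto
      show "open {P :: complex ^ 3 ^ 3. Re (P $ i $ i) > 1 / 4}"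
        by (intro open_Collect_less continuous_intros)
    qed auto
    have inU: "proj (aff_emb i ((affine_coord i \<circ> \<gamma>) s)) = \<gamma> s" if "s \<in> U" for s
      using that CP2 by (auto simp: U_def cdom_affine_chart intro!: proj_aff_emb_coord)
    have "t \<in> U" using t i(2) by (auto simp: U_def cdom_affine_chart)
    have "((\<lambda>s. \<gamma> s \<bullet> Q) has_real_derivative F' v) (at t)"
      by (rule has_field_derivative_transform_within_open[OF D \<open>open U\<close> \<open>t \<in> U\<close>]) (simp only: inU)
    then have "((\<lambda>s. 2 * (\<gamma> s \<bullet> Q) - 1) has_real_derivative 2 * F' v) (at t)"
      by (auto intro!: derivative_eq_intros)
    moreover have "(2 * F' v)\<^sup>2 \<le> 4 * (1 - (2 * (\<gamma> t \<bullet> Q) - 1)\<^sup>2) * (speed projective_plane \<gamma> t)\<^sup>2"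
    proof -
      have "proj (aff_emb i z) = \<gamma> t" using inU[OF \<open>t \<in> U\<close>] by (simp add: z_def)
      then have "4 * (F' v)\<^sup>2 \<le> 4 * (4 * (\<gamma> t \<bullet> Q) * (1 - \<gamma> t \<bullet> Q) * fs_metric z v v)"
        using bound[of v] by (intro mult_left_mono) simp_all
      also have "4 * (\<gamma> t \<bullet> Q) * (1 - \<gamma> t \<bullet> Q) = 1 - (2 * (\<gamma> t \<bullet> Q) - 1)\<^sup>2"
        by (simp add: power2_eq_square algebra_simps)
      finally show ?thesis unfolding speed power_mult_distrib mult.assoc by simp
    qed
    ultimately show ?thesis by blast
  qed
  then obtain d where d: "\<And>t. t \<in> {0<..<1} - S \<Longrightarrow> ((\<lambda>s. 2 * (\<gamma> s \<bullet> Q) - 1) has_real_derivative d t) (at t)"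
      "\<And>t. t \<in> {0<..<1} - S \<Longrightarrow> (d t)\<^sup>2 \<le> 4 * (1 - (2 * (\<gamma> t \<bullet> Q) - 1)\<^sup>2) * (speed projective_plane \<gamma> t)\<^sup>2"
    by metis
  have "ennreal (\<Sum>i\<in>{()}. 1 * ((arccos (2 * (\<gamma> 1 \<bullet> Q) - 1) - arccos (2 * (\<gamma> 0 \<bullet> Q) - 1)) / 2))
      \<le> (\<integral>\<^sup>+t\<in>{0..1}. ennreal (speed projective_plane \<gamma> t) \<partial>lborel)"
  proof (rule arccos_increment_le_nn_integral[where S = S and d = "\<lambda>_. d" and s = "\<lambda>_. speed projective_plane \<gamma>"])
    show "continuous_on {0..1} (\<lambda>t. 2 * (\<gamma> t \<bullet> Q) - 1)" by (intro continuous_intros cont)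
    show "\<bar>2 * (\<gamma> t \<bullet> Q) - 1\<bar> \<le> 1" if "t \<in> {0..1}" for t
      using inner_CP2[OF CP2[OF that] Q] by (simp add: abs_le_iff)
    show "speed projective_plane \<gamma> t \<ge> 0" if t: "t \<in> {0<..<1} - S" for t
    proof -
      have "fs_metric z u u \<ge> 0" for z u :: "complex ^ 2"
        using fs_metric_pos[of u z] bilinear_fs_metric[of z] by (cases "u = 0") (auto simp: bilinear_lzero)
      then show ?thesis by (simp add: speed_def Let_def)
    qed
  qed (use S d in auto)
  then show ?thesis by (simp add: fs_dist_def ends curve_length_def diff_divide_distrib)
qed

text \<open>The chart picked by \<open>chart_at\<close> is unknown, but \<open>fs_herm_ratio\<close>
  shows that every chart returns the value of \<open>pfs\<close>.\<close>

lemma speed_proj: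
  assumes W: "(W has_vector_derivative W') (at t)" "W t \<noteq> 0"
  shows "speed projective_plane (\<lambda>t. proj (W t)) t = sqrt (Re (pfs (W t) W' W'))"
    and "W t $ i \<noteq> 0 \<Longrightarrow> ((affine_coord i \<circ> (\<lambda>t. proj (W t))) has_vector_derivative ratio_deriv i (W t) W') (at t)"
proof -
  show D: "((affine_coord i \<circ> (\<lambda>t. proj (W t))) has_vector_derivative ratio_deriv i (W t) W') (at t)"
    if "W t $ i \<noteq> 0" for i
  proof -
    have "linear (ratio_deriv i (W t))"
      using has_derivative_linear[OF ratio_has_derivative[OF that]] .
    then show ?thesis
      using has_derivative_compose[OF W(1)[unfolded has_vector_derivative_def] ratio_has_derivative[OF that]]
      by (simp add: has_vector_derivative_def o_def affine_coord_proj_eq_ratio linear_cmul)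
  qed
  obtain i where i: "chart_at projective_plane (proj (W t)) = affine_chart i" "proj (W t) \<in> cdom (affine_chart i)"
    using chart_at_projective_plane[OF proj_in_CP2[OF W(2)]] .
  then have "W t $ i \<noteq> 0" by (auto simp: cdom_affine_chart proj_def)
  then show "speed projective_plane (\<lambda>t. proj (W t)) t = sqrt (Re (pfs (W t) W' W'))"
    using vector_derivative_at[OF D]
    by (simp add: speed_def i Let_def affine_coord_proj_eq_ratio fs_metric_def fs_herm_ratio)
qed

lemma piecewise_C1_curve_proj:
  assumes W: "\<And>t. (W has_vector_derivative W' t) (at t)" "\<And>t. W t \<noteq> 0" and W': "continuous_on UNIV W'"
  shows "piecewise_C1_curve projective_plane (proj (W 0)) (proj (W 1)) (\<lambda>t. proj (W t))"
  unfolding piecewise_C1_curve_def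
proof (intro conjI exI[of _ "{}"] ballI)
  have contW: "continuous_on A W" for A
    using has_vector_derivative_continuous[OF W(1)] by (intro continuous_at_imp_continuous_on) blast
  have contW': "continuous_on A W'" for A using W' by (rule continuous_on_subset) simp
  show "continuous_map (top_of_set {0..1}) (mtop projective_plane) (\<lambda>t. proj (W t))"
    using continuous_on_proj[OF contW W(2)] proj_in_CP2[OF W(2)] by (auto simp: projective_plane_def)
  fix c assume "c \<in> atlas projective_plane"
  then obtain i where c: "c = affine_chart i" by (auto simp: projective_plane_def)
  define T where "T = {t \<in> {0<..<1} - {}. proj (W t) \<in> cdom (affine_chart i)}"
  have nz: "W t $ i \<noteq> 0" if "t \<in> T" for t
    using that by (auto simp: T_def cdom_affine_chart proj_def)
  have "continuous_on T (\<lambda>t. ratio_deriv i (W t) (W' t))"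
    unfolding ratio_deriv_def using nz by (intro continuous_intros contW contW') auto
  then have "(affine_coord i \<circ> (\<lambda>t. proj (W t))) C1_differentiable_on T"
    unfolding C1_differentiable_on_def
    using speed_proj(2)[OF W nz] by (intro exI[of _ "\<lambda>t. ratio_deriv i (W t) (W' t)"]) blast
  then show "(coord c \<circ> (\<lambda>t. proj (W t))) C1_differentiable_on {t \<in> {0<..<1} - {}. proj (W t) \<in> cdom c}"
    unfolding c T_def by simp
qed simp_all

text \<open>The curve is the image of a horizontal great circle of the unit sphere:
  \<open>herm (W' t) (W t)\<close> is 0, so \<open>pfs\<close> reduces to the squared Euclidean
  speed \<open>a\<^sup>2\<close>.\<close>

lemma projective_plane_geodesic:
  assumes "P \<in> CP2" "Q \<in> CP2"
  obtains \<gamma> where "piecewise_C1_curve projective_plane Q P \<gamma>"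
    "curve_length projective_plane \<gamma> = ennreal (fs_dist P Q)"
proof -
  obtain w0 where w0: "norm w0 = 1" "P = proj w0" using assms(1) by (rule CP2_E)
  obtain v where v: "norm v = 1" "Q = proj v" using assms(2) by (rule CP2_E)
  define c where "c = norm (herm w0 v)"
  \<comment> \<open>A phase that makes the product with \<open>v\<close> real and nonnegative;
    otherwise the great circle from \<open>v\<close> would not be horizontal. For orthogonal lines
    any phase serves.\<close>
  define \<theta> where "\<theta> = (if c = 0 then 1 else cnj (herm w0 v) / of_real c)"
  have \<theta>: "norm \<theta> = 1" "\<theta> * herm w0 v = of_real c"
    by (auto simp: \<theta>_def c_def norm_divide complex_norm_square[symmetric] mult.commute[of "cnj _"] power2_eq_square)
  define w where "w = \<theta> *s w0"
  have "herm w w = 1"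
  proof -
    have "herm w w = (\<theta> * cnj \<theta>) * herm w0 w0" by (simp add: w_def herm_simps)
    also have "\<dots> = 1" unfolding complex_norm_square[symmetric] \<theta>(1) herm_self w0(1) by simp
    finally show ?thesis .
  qed
  then have norm_w: "norm w = 1"
    using herm_self[of w] by (metis norm_ge_zero of_real_1 of_real_eq_iff power2_eq_1_iff not_one_le_zero neg_0_le_iff_le order_trans zero_le_one abs_norm_cancel abs_minus_cancel abs_one)
  have P: "P = proj w"
    unfolding w_def w0(2) using \<theta>(1) by (subst proj_scale) auto
  have wv: "herm w v = of_real c" "herm v w = of_real c"
    using \<theta>(2) cnj_herm[of w v] by (auto simp: w_def herm_simps)
  have inner_wv: "w \<bullet> v = c" using wv(1) by (simp add: Re_herm[symmetric])
  have c: "0 \<le> c" "c \<le> 1"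
    using herm_Cauchy_Schwarz[of w0 v] w0(1) v(1) by (simp_all add: c_def power_le_one_iff)
  define a where "a = arccos c"
  have a: "0 \<le> a" "a \<le> pi / 2" "cos a = c"
    using c arccos_le_pi2[of c] by (simp_all add: a_def arccos_lbound)
  have PQ: "P \<bullet> Q = c\<^sup>2"
  proof -
    have "w \<noteq> 0" "v \<noteq> 0" using norm_w v(1) by auto
    then show ?thesis using c by (simp add: P v(2) inner_proj wv norm_w v(1))
  qed
  have dist: "fs_dist P Q = a"
  proof -
    have "2 * (P \<bullet> Q) - 1 = cos (2 * a)" unfolding PQ cos_double_cos a(3) by simp
    then show ?thesis using a by (simp add: fs_dist_def arccos_cos)
  qed
  \<comment> \<open>For \<open>a = 0\<close> this is 0 by division by zero, and \<open>W\<close> is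
    constantly \<open>v\<close>, which then equals \<open>w\<close>.\<close>
  define e where "e = (1 / sin a) *\<^sub>R (w - c *\<^sub>R v)"
  define W where "W t = cos (t * a) *\<^sub>R v + sin (t * a) *\<^sub>R e" for t
  define W' where "W' t = a *\<^sub>R (cos (t * a) *\<^sub>R e - sin (t * a) *\<^sub>R v)" for t
  have hvv: "herm v v = 1" by (simp add: herm_self v(1))
  have sin2: "(sin a)\<^sup>2 = 1 - c\<^sup>2" using sin_squared_eq[of a] a(3) by simp
  have eW: "herm e v = 0" "herm v e = 0" by (simp_all add: e_def herm_simps wv hvv)
  have ee: "a \<noteq> 0 \<Longrightarrow> herm e e = 1"
  proof -
    assume "a \<noteq> 0"
    then have s: "sin a \<noteq> 0" using a sin_gt_zero[of a] pi_gt_zero by linarith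
    have "herm (w - c *\<^sub>R v) (w - c *\<^sub>R v) = of_real (1 - c\<^sup>2)"
      using \<open>herm w w = 1\<close> by (simp add: herm_simps wv hvv power2_eq_square)
    then show "herm e e = 1"
      using s unfolding e_def herm_simps(9,10) sin2[symmetric] by (simp add: power2_eq_square)
  qed
  have cos_sin_sq: "complex_of_real (cos x) * of_real (cos x) + of_real (sin x) * of_real (sin x) = 1" for x
    by (simp flip: of_real_mult of_real_add)
  have W_unit: "norm (W t) = 1" for t
  proof -
    have "herm (W t) (W t) = 1"
    proof (cases "a = 0")
      case True
      then show ?thesis by (simp add: W_def hvv)
    next
      case False
      then show ?thesis
        by (simp add: W_def herm_simps eW hvv ee cos_sin_sq)
    qed
    then have "(norm (W t))\<^sup>2 = 1" using herm_self[of "W t"] by (metis of_real_1 of_real_eq_iff)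
    then show ?thesis using norm_ge_zero[of "W t"] by (simp add: power2_eq_1_iff)
  qed
  have W_nz: "W t \<noteq> 0" for t using W_unit[of t] by auto
  have D: "(W has_vector_derivative W' t) (at t)" for t
    unfolding W_def W'_def
    by (rule has_vector_derivative_eq_rhs, (rule derivative_intros has_vector_derivative_add has_vector_derivative_scaleR)+)
      (auto intro!: derivative_eq_intros simp: algebra_simps)
  have speed: "Re (pfs (W t) (W' t) (W' t)) = a\<^sup>2" for t
  proof (cases "a = 0")
    case True
    then show ?thesis by (simp add: W'_def pfs_def herm_simps)
  next
    case False
    have "herm (W' t) (W t) = 0"
      by (simp add: W_def W'_def herm_simps eW hvv ee[OF False] algebra_simps)
    moreover have "herm (W' t) (W' t) = of_real a * of_real a *
        (of_real (cos (t * a)) * of_real (cos (t * a)) + of_real (sin (t * a)) * of_real (sin (t * a)))"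
      by (simp add: W'_def herm_simps eW hvv ee[OF False] algebra_simps)
    then have "herm (W' t) (W' t) = of_real (a\<^sup>2)"
      unfolding cos_sin_sq by (simp add: power2_eq_square)
    ultimately show ?thesis by (simp add: pfs_def herm_self[of "W t"] W_unit)
  qed
  have W0: "proj (W 0) = Q" by (simp add: W_def v)
  have W1: "proj (W 1) = P"
  proof (cases "a = 0")
    case True
    then have "c = 1" using a(3) by simp
    then have "(norm (w - v))\<^sup>2 = 0"
      using norm_w v(1) inner_wv by (simp add: power2_norm_eq_inner inner_diff_left inner_diff_right inner_commute norm_eq_1)
    then show ?thesis using True by (simp add: W_def P)
  next
    case False
    then have "sin a \<noteq> 0" using a sin_gt_zero[of a] pi_gt_zero by linarith
    then show ?thesis by (simp add: W_def e_def P a(3))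
  qed
  show thesis
  proof
    have "continuous_on UNIV W'" unfolding W'_def by (intro continuous_intros)
    from piecewise_C1_curve_proj[OF D W_nz this]
    show "piecewise_C1_curve projective_plane Q P (\<lambda>t. proj (W t))" by (simp add: W0 W1)
    show "curve_length projective_plane (\<lambda>t. proj (W t)) = ennreal (fs_dist P Q)"
      by (rule curve_length_const) (use a in \<open>simp add: speed_proj(1)[OF D W_nz] speed dist\<close>)
  qed
qed

lemma fs_dist_self: "P \<in> CP2 \<Longrightarrow> fs_dist P P = 0"
  by (simp add: fs_dist_def dot_square_norm norm_CP2)

lemma fs_dist_nonneg: "P \<in> CP2 \<Longrightarrow> Q \<in> CP2 \<Longrightarrow> fs_dist P Q \<ge> 0"
  using inner_CP2[of P Q] by (simp add: fs_dist_def arccos_lbound)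

lemma fs_dist_commute: "fs_dist P Q = fs_dist Q P"
  by (simp add: fs_dist_def inner_commute)

lemma rdist_projective_plane:
  assumes "P \<in> CP2" "Q \<in> CP2"
  shows "rdist projective_plane Q P = fs_dist P Q"
proof -
  obtain \<gamma> where "piecewise_C1_curve projective_plane Q P \<gamma>"
    "curve_length projective_plane \<gamma> = ennreal (fs_dist P Q)"
    using assms by (rule projective_plane_geodesic)
  then show ?thesis
    using projective_plane_length_ge[OF _ assms(2), of Q P] fs_dist_self[OF assms(2)] fs_dist_nonneg[OF assms]
    by (intro rdist_eqI) simp_all
qed

text \<open>The length bound with reference point \<open>Q\<close>, applied to a minimal geodesic
  from \<open>R\<close> to \<open>P\<close>.\<close>

lemma fs_dist_triangle:
  assumes "P \<in> CP2" "Q \<in> CP2" "R \<in> CP2"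
  shows "fs_dist P Q \<le> fs_dist P R + fs_dist R Q"
proof -
  obtain \<gamma> where "piecewise_C1_curve projective_plane R P \<gamma>"
    "curve_length projective_plane \<gamma> = ennreal (fs_dist P R)"
    using assms(1,3) by (rule projective_plane_geodesic)
  then have "ennreal (fs_dist P Q - fs_dist R Q) \<le> ennreal (fs_dist P R)"
    using projective_plane_length_ge[OF _ assms(2)] by metis
  then show ?thesis using fs_dist_nonneg[OF assms(1,3)] by (simp add: ennreal_le_iff)
qed


section \<open>Simple connectedness and completeness of the projective plane\<close>

lemma norm_scale: "norm (c *s w) = norm c * norm w" for w :: "complex ^ 'n"
proof -
  have "herm (c *s w) (c *s w) = of_real ((norm c)\<^sup>2 * (norm w)\<^sup>2)"
    using complex_norm_square[of c] by (simp add: herm_simps herm_self[of w])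
  then have "(norm (c *s w))\<^sup>2 = (norm c * norm w)\<^sup>2"
    unfolding herm_self[of "c *s w"] of_real_eq_iff by (simp add: power_mult_distrib)
  then show ?thesis by (simp add: power2_eq_iff_nonneg)
qed

lemma proj_mult_vec: "proj u *v w = (herm w u / herm u u) *s u"
  by (simp add: vec_eq_iff matrix_vector_mult_def proj_def herm_def[of w u] sum_distrib_left
      sum_divide_distrib mult_ac)

lemma proj_mult_vec_self: "w \<noteq> 0 \<Longrightarrow> proj w *v w = w"
  by (simp add: proj_mult_vec herm_self_eq_0_iff)

text \<open>Orthogonal lines have projections at distance sqrt 2, so a distance below 1 forces a
  nonzero overlap, and \<open>P *v w\<close> spans the line of \<open>P\<close>.\<close>

lemma proj_mult_vec_near:
  assumes P: "P \<in> CP2" and w: "w \<noteq> 0" and near: "dist P (proj w) < 1"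
  shows "P *v w \<noteq> 0" "proj (P *v w) = P"
proof -
  obtain u where u: "norm u = 1" "P = proj u" using P by (rule CP2_E)
  have u0: "u \<noteq> 0" using u(1) by auto
  have "(dist P (proj w))\<^sup>2 = 2 - 2 * (P \<bullet> proj w)"
    using norm_CP2[OF P] norm_CP2[OF proj_in_CP2[OF w]]
    by (simp add: dist_norm power2_norm_eq_inner inner_diff_left inner_diff_right inner_commute norm_eq_1)
  moreover have "(dist P (proj w))\<^sup>2 < 1" using near by (simp add: abs_square_less_1)
  ultimately have "P \<bullet> proj w \<noteq> 0" by auto
  then have "herm u w \<noteq> 0" by (auto simp: u(2) inner_proj u0 w)
  then have "herm w u \<noteq> 0" by (metis cnj_herm complex_cnj_zero_iff)
  then have c: "herm w u / herm u u \<noteq> 0" using u0 by (simp add: herm_self_eq_0_iff)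
  show "P *v w \<noteq> 0" unfolding u(2) proj_mult_vec using c u0 by (metis mult_eq_0_iff vec_eq_iff vector_smult_component zero_index)
  show "proj (P *v w) = P" unfolding u(2) proj_mult_vec by (rule proj_scale[OF c])
qed

text \<open>On a short interval the lift is \<open>t \<mapsto> \<gamma> t *v w\<close>, where \<open>w\<close> spans the line at the left end.\<close>

lemma CP2_path_lift:
  fixes \<gamma> :: "real \<Rightarrow> complex ^ 3 ^ 3"
  assumes cont: "continuous_on {0..1} \<gamma>" and CP2: "\<gamma> ` {0..1} \<subseteq> CP2"
  obtains W where "continuous_on {0..1} W" "\<And>t. t \<in> {0..1} \<Longrightarrow> norm (W t) = 1 \<and> proj (W t) = \<gamma> t"
proof -
  have "uniformly_continuous_on {0..1} \<gamma>"
    by (rule compact_uniformly_continuous[OF cont compact_Icc])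
  then obtain \<delta> where \<delta>: "\<delta> > 0" "\<And>s t. s \<in> {0..1} \<Longrightarrow> t \<in> {0..1} \<Longrightarrow> dist t s < \<delta> \<Longrightarrow> dist (\<gamma> t) (\<gamma> s) < 1"
    unfolding uniformly_continuous_on_def using zero_less_one by metis
  obtain N :: nat where N: "N > 0" "1 / real N < \<delta>"
    using real_arch_inverse[of \<delta>] \<delta>(1) by (auto simp: inverse_eq_divide)
  have "\<exists>W. continuous_on {0..real k / real N} W \<and>
      (\<forall>t\<in>{0..real k / real N}. W t \<noteq> 0 \<and> proj (W t) = \<gamma> t)" if "k \<le> N" for k
    using that
  proof (induction k)
    case 0
    have "\<gamma> 0 \<in> CP2" using CP2 by auto
    then obtain w where "norm w = 1" "\<gamma> 0 = proj w" by (rule CP2_E)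
    moreover from this have "w \<noteq> 0" by auto
    ultimately show ?case by (intro exI[of _ "\<lambda>_. w"]) auto
  next
    case (Suc k)
    define a where "a = real k / real N"
    define b where "b = real (Suc k) / real N"
    have ab: "0 \<le> a" "a \<le> b" "b \<le> 1" "b - a < \<delta>"
      using Suc.prems N by (auto simp: a_def b_def divide_right_mono field_simps)
    obtain W where W: "continuous_on {0..a} W" "\<And>t. t \<in> {0..a} \<Longrightarrow> W t \<noteq> 0 \<and> proj (W t) = \<gamma> t"
      using Suc by (auto simp: a_def)
    define W' where "W' t = (if t \<le> a then W t else \<gamma> t *v W a)" for t
    have Wa: "W a \<noteq> 0" "proj (W a) = \<gamma> a" using W(2)[of a] ab by auto
    have "continuous_on {0..b} W'"
      unfolding W'_def
    proof (rule continuous_on_cases_le)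
      show "continuous_on {t \<in> {0..b}. t \<le> a} W"
        by (rule continuous_on_subset[OF W(1)]) auto
      have "continuous_on {t \<in> {0..b}. a \<le> t} \<gamma>"
        by (rule continuous_on_subset[OF cont]) (use ab in auto)
      then show "continuous_on {t \<in> {0..b}. a \<le> t} (\<lambda>t. \<gamma> t *v W a)"
        unfolding matrix_vector_mult_def by (intro continuous_intros)
      show "W t = \<gamma> t *v W a" if "t \<in> {0..b}" "t = a" for t
        using that Wa proj_mult_vec_self[OF Wa(1)] by simp
    qed (intro continuous_on_id)
    moreover have "W' t \<noteq> 0 \<and> proj (W' t) = \<gamma> t" if t: "t \<in> {0..b}" for t
    proof (cases "t \<le> a")
      case True
      then show ?thesis using W(2) t by (simp add: W'_def)
    next
      case False
      then have "dist (\<gamma> t) (proj (W a)) < 1"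
        unfolding Wa(2) using t ab by (intro \<delta>(2)) (auto simp: dist_real_def)
      moreover have "\<gamma> t \<in> CP2" using CP2 t ab by auto
      ultimately show ?thesis
        using proj_mult_vec_near[OF _ Wa(1)] False by (simp add: W'_def)
    qed
    ultimately show ?case by (auto simp: b_def)
  qed
  from this[OF order_refl] N(1) obtain W where W: "continuous_on {0..1} W"
      "\<And>t. t \<in> {0..1} \<Longrightarrow> W t \<noteq> 0 \<and> proj (W t) = \<gamma> t"
    by auto
  show thesis
  proof
    show "continuous_on {0..1} (\<lambda>t. (1 / norm (W t)) *\<^sub>R W t)"
      using W by (intro continuous_intros) auto
    fix t :: real assume "t \<in> {0..1}"
    then have "W t \<noteq> 0" "proj (W t) = \<gamma> t" using W(2) by auto
    then show "norm ((1 / norm (W t)) *\<^sub>R W t) = 1 \<and> proj ((1 / norm (W t)) *\<^sub>R W t) = \<gamma> t"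
      unfolding of_real_scale_eq_scaleR[symmetric]
      by (subst proj_scale) (simp_all add: norm_scale norm_divide)
  qed
qed

lemma simply_connected_CP2: "simply_connected CP2"
  unfolding simply_connected_eq_contractible_loop_some
proof (intro conjI allI impI path_connected_CP2)
  fix p assume p: "path p \<and> path_image p \<subseteq> CP2 \<and> pathfinish p = pathstart p"
  then have p': "continuous_on {0..1} p" "p ` {0..1} \<subseteq> CP2" by (simp_all add: path_def path_image_def)
  obtain W where W: "continuous_on {0..1} W" "\<And>t. t \<in> {0..1} \<Longrightarrow> norm (W t) = 1 \<and> proj (W t) = p t"
    using CP2_path_lift[OF p'] by blast
  have W01: "norm (W 0) = 1" "norm (W 1) = 1" "proj (W 0) = proj (W 1)"
    using W(2)[of 0] W(2)[of 1] p by (auto simp: pathfinish_def pathstart_def)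
  have nz: "W 0 \<noteq> 0" "W 1 \<noteq> 0" using W01 by auto
  define l where "l = herm (W 1) (W 0)"
  have l: "W 1 = l *s W 0"
    using proj_mult_vec_self[OF nz(2)] unfolding W01(3)[symmetric] proj_mult_vec l_def herm_self[of "W 0"] W01(1)
    by simp
  have "norm l = 1" using arg_cong[OF l, of norm] W01 by (simp add: norm_scale)
  then have "exp (\<i> * of_real (Arg l)) = l" by (rule complex_norm_eq_1_exp_eq[THEN iffD1])
  then have \<theta>: "l = cis (Arg l)" by (simp add: cis_conv_exp)
  define \<theta> where "\<theta> = Arg l"
  note \<theta> = \<theta>[folded \<theta>_def]
  \<comment> \<open>The lifted path closes only up to the phase \<open>l\<close>; rotating it back
    at constant rate makes it a loop over the same lines.\<close>
  define U where "U t = cis (- \<theta> * t) *s W t" for t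
  have U_unit: "norm (U t) = 1" if "t \<in> {0..1}" for t
    using W(2)[OF that] by (simp add: U_def norm_scale)
  have U_proj: "proj (U t) = p t" if "t \<in> {0..1}" for t
    using W(2)[OF that] unfolding U_def by (subst proj_scale) auto
  have "continuous_on {0..1} U"
    unfolding U_def vector_scalar_mult_def cis_conv_exp by (intro continuous_intros W(1))
  moreover have "U 1 = U 0" by (simp add: U_def l \<theta> cis_mult)
  ultimately have "path U \<and> path_image U \<subseteq> sphere 0 1 \<and> pathfinish U = pathstart U \<and> U 0 \<in> sphere 0 1"
    using U_unit by (auto simp: path_def path_image_def pathfinish_def pathstart_def)
  moreover have "simply_connected (sphere (0 :: complex ^ 3) 1)"
    by (rule simply_connected_sphere) simp
  ultimately have "homotopic_loops (sphere 0 1) U (linepath (U 0) (U 0))"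
    unfolding simply_connected_eq_contractible_loop_any by blast
  then have "homotopic_loops CP2 (proj \<circ> U) (proj \<circ> linepath (U 0) (U 0))"
  proof (rule homotopic_loops_continuous_image)
    show "continuous_on (sphere 0 1) proj" by (rule continuous_on_proj[OF continuous_on_id]) auto
    show "proj \<in> sphere 0 1 \<rightarrow> CP2" by (auto intro!: proj_in_CP2)
  qed
  moreover have "proj \<circ> linepath (U 0) (U 0) = linepath (p 0) (p 0)"
    using U_proj[of 0] by (simp add: fun_eq_iff linepath_refl)
  moreover have "homotopic_loops CP2 p (proj \<circ> U)"
    using p U_proj by (intro homotopic_loops_eq) auto
  ultimately show "\<exists>a. a \<in> CP2 \<and> homotopic_loops CP2 p (linepath a a)"
    using p by (intro exI[of _ "p 0"]) (auto intro: homotopic_loops_trans simp: path_image_def)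
qed

lemma simply_connected_space_CP2: "simply_connected_space (top_of_set CP2)"
  unfolding simply_connected_space_def
proof (intro conjI allI impI)
  show "path_connected_space (top_of_set CP2)"
    using path_connected_CP2 unfolding path_connected_space_def path_connected_def
    by (auto simp: pathin_def path_def path_image_def pathstart_def pathfinish_def) blast
  fix f :: "complex \<Rightarrow> complex ^ 3 ^ 3"
  assume "continuous_map (top_of_set (sphere 0 1)) (top_of_set CP2) f"
  then have "continuous_on (sphere 0 1) f" "f ` sphere 0 1 \<subseteq> CP2" by auto
  then obtain a where a: "homotopic_with_canon (\<lambda>h. True) (sphere 0 1) CP2 f (\<lambda>x. a)"
    using simply_connected_CP2 unfolding simply_connected_eq_contractible_circlemap by blast
  moreover have "a \<in> CP2"
  proof -
    have "(1 :: complex) \<in> sphere 0 1" by simp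
    then show ?thesis using homotopic_with_imp_subset2[OF a] by blast
  qed
  ultimately show "\<exists>a\<in>topspace (top_of_set CP2). homotopic_with (\<lambda>_. True) (top_of_set (sphere 0 1)) (top_of_set CP2) f (\<lambda>_. a)"
    by auto
qed

section \<open>Compactness and completeness\<close>

lemma compact_CP2: "compact CP2"
proof -
  have "CP2 = proj ` sphere 0 1"
    by (auto elim!: CP2_E intro!: proj_in_CP2)
  moreover have "compact (proj ` sphere 0 1)"
    by (intro compact_continuous_image continuous_on_proj continuous_on_id compact_sphere) auto
  ultimately show ?thesis by simp
qed

text \<open>The infimum over no curves is infinite, and \<open>enn2real\<close> sends it to 0. The
  locale \<open>Metric_space\<close> demands symmetry also for points outside the carrier.\<close>

lemma rdist_projective_plane_outside:
  assumes "P \<notin> CP2 \<or> Q \<notin> CP2"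
  shows "rdist projective_plane P Q = 0"
proof -
  have "\<not> piecewise_C1_curve projective_plane P Q \<gamma>" for \<gamma>
    using assms by (auto simp: piecewise_C1_curve_def projective_plane_def Pi_iff)
  then have empty: "Collect (piecewise_C1_curve projective_plane P Q) = {}" by auto
  show ?thesis unfolding rdist_def empty by simp
qed

interpretation CP2: Metric_space CP2 "rdist projective_plane"
proof
  fix P Q R
  show "0 \<le> rdist projective_plane P Q" by (simp add: rdist_def)
  show "rdist projective_plane P Q = rdist projective_plane Q P"
    using rdist_projective_plane rdist_projective_plane_outside fs_dist_commute by metis
  assume PQ: "P \<in> CP2" "Q \<in> CP2"
  show "rdist projective_plane P Q = 0 \<longleftrightarrow> P = Q"
  proof
    assume "rdist projective_plane P Q = 0"
    then have "arccos (2 * (Q \<bullet> P) - 1) = 0" using PQ by (simp add: rdist_projective_plane fs_dist_def)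
    then have "Q \<bullet> P = 1"
      using inner_CP2[OF PQ(2,1)] arccos_eq_0_iff[of "2 * (Q \<bullet> P) - 1"] by auto
    then have "(norm (P - Q))\<^sup>2 = 0"
      using norm_CP2[OF PQ(1)] norm_CP2[OF PQ(2)]
      by (simp add: power2_norm_eq_inner inner_diff_left inner_diff_right inner_commute norm_eq_1)
    then show "P = Q" by simp
  qed (use PQ in \<open>simp add: rdist_projective_plane fs_dist_self\<close>)
  assume R: "R \<in> CP2"
  show "rdist projective_plane P R \<le> rdist projective_plane P Q + rdist projective_plane Q R"
    using fs_dist_triangle[of R P Q] PQ R by (simp add: rdist_projective_plane fs_dist_commute)
qed

text \<open>By compactness a subsequence converges in the ambient matrix space; continuity of the
  overlap turns this into convergence for \<open>rdist\<close>, and a Cauchy sequence with a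
  convergent subsequence converges.\<close>

lemma mcomplete_CP2: "CP2.mcomplete"
  unfolding CP2.mcomplete_def
proof (intro allI impI)
  fix \<sigma> :: "nat \<Rightarrow> complex ^ 3 ^ 3" assume cauchy: "CP2.MCauchy \<sigma>"
  then have \<sigma>: "\<sigma> n \<in> CP2" for n by (auto simp: CP2.MCauchy_def)
  obtain l r where l: "l \<in> CP2" and r: "strict_mono r" and lim: "(\<sigma> \<circ> r) \<longlonglongrightarrow> l"
    using compact_imp_seq_compact[OF compact_CP2] \<sigma> by (auto elim!: seq_compactE)
  have "(\<lambda>n. arccos (2 * (l \<bullet> (\<sigma> \<circ> r) n) - 1)) \<longlonglongrightarrow> arccos (2 * (l \<bullet> l) - 1)"
  proof (rule continuous_on_tendsto_compose[OF continuous_on_arccos'])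
    show "(\<lambda>n. 2 * (l \<bullet> (\<sigma> \<circ> r) n) - 1) \<longlonglongrightarrow> 2 * (l \<bullet> l) - 1"
      by (intro tendsto_intros lim)
  qed (use inner_CP2[OF l l] inner_CP2[OF l \<sigma>] in \<open>auto intro!: always_eventually\<close>)
  from tendsto_divide[OF this tendsto_const[of 2]]
  have "(\<lambda>n. fs_dist l ((\<sigma> \<circ> r) n)) \<longlonglongrightarrow> 0"
    using fs_dist_self[OF l] by (simp add: fs_dist_def)
  then have "limitin CP2.mtopology (\<sigma> \<circ> r) l sequentially"
    unfolding CP2.limit_metric_sequentially
    using l \<sigma> fs_dist_nonneg[OF l \<sigma>] by (auto simp: rdist_projective_plane dest!: LIMSEQ_D) blast
  then show "\<exists>x. limitin CP2.mtopology \<sigma> x sequentially"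
    using CP2.MCauchy_convergent_subsequence[OF cauchy r] by blast
qed

lemma complex_space_form_projective_plane: "complex_space_form projective_plane 6"
  unfolding complex_space_form_def
  using kaehler_projective_plane mcomplete_CP2 simply_connected_space_CP2
    chsc_projective_plane ricci_eq_projective_plane
  by (simp add: projective_plane_def[THEN arg_cong, of mtop])


section \<open>The Laplacian on the projective plane and the comparison\<close>

text \<open>At \<open>norm z\<close> = tan r the value is 2 cot 2r + (2n - 2) cot r, where n is the
  complex dimension: the eigenvalue 4 once and the eigenvalue 1 with multiplicity 2n - 2.\<close>

lemma laplace_beltrami_fs_arctan_norm:
  fixes z :: "complex ^ 'n::finite"
  assumes V: "open V" "z \<in> V" "0 \<notin> V" and f: "\<And>x. x \<in> V \<Longrightarrow> f x = arctan (norm x)"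
  shows "laplace_beltrami fs_metric f z = (2 * real CARD('n) - 1) / norm z - norm z"
proof -
  \<comment> \<open>The gradient \<open>X\<close> has Euclidean length 1 + s^2 at radius s: the
    slope 1 / (1 + s^2) of \<open>arctan\<close>, divided by the factor 1 / (1 + s^2)^2 of the
    metric on radial vectors.\<close>
  define \<psi> :: "real \<Rightarrow> real" where "\<psi> s = (1 + s\<^sup>2) / s" for s
  define X where "X x = \<psi> (norm x) *\<^sub>R x" for x :: "complex ^ 'n"
  define s where "s = norm z"
  have z: "z \<noteq> 0" and s: "s > 0" using V by (auto simp: s_def)
  have fs_radial: "fs_metric x (c *\<^sub>R x) y = c * (x \<bullet> y) / (1 + (norm x)\<^sup>2)\<^sup>2" for x y :: "complex ^ 'n" and c
  proof -
    have "fs_herm x x y = (aff x - herm x x) * herm x y / (aff x)\<^sup>2"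
      by (simp add: fs_herm_def power2_eq_square field_simps)
    also have "\<dots> = herm x y / of_real ((1 + (norm x)\<^sup>2)\<^sup>2)"
      unfolding aff_def herm_self by simp
    finally have "Re (fs_herm x x y) = (x \<bullet> y) / (1 + (norm x)\<^sup>2)\<^sup>2"
      by (simp only: Re_divide_of_real Re_herm)
    then show ?thesis by (simp add: fs_metric_def fs_herm_simps)
  qed
  have grad: "(f has_derivative (\<lambda>y. fs_metric x (X x) y)) (at x)" if "x \<in> V" for x
  proof (rule has_derivative_transform_within_open[OF _ V(1) that f[symmetric]])
    have x: "x \<noteq> 0" using that V(3) by auto
    have "1 / (1 + (norm x)\<^sup>2) * (b / norm x) = \<psi> (norm x) * b / (1 + (norm x)\<^sup>2)\<^sup>2" for b
      using x one_plus_norm_sq_pos[of x] by (simp add: \<psi>_def power2_eq_square)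
    then have eq: "(\<lambda>y. fs_metric x (X x) y) = (\<lambda>y. 1 / (1 + (norm x)\<^sup>2) * ((x \<bullet> y) / norm x))"
      unfolding X_def fs_radial by simp
    show "((\<lambda>x. arctan (norm x)) has_derivative (\<lambda>y. fs_metric x (X x) y)) (at x)"
      unfolding eq by (rule radial_has_derivative[OF x]) (auto intro!: derivative_eq_intros simp: inverse_eq_divide)
  qed
  have DX: "(X has_derivative (\<lambda>u. \<psi> s *\<^sub>R u + (((1 - 1 / s\<^sup>2) / s) *\<^sub>R z \<bullet> u) *\<^sub>R z)) (at z)"
  proof -
    have "(\<psi> has_real_derivative (1 - 1 / s\<^sup>2)) (at s)"
      unfolding \<psi>_def using s by (auto intro!: derivative_eq_intros simp: field_simps power2_eq_square)
    from has_derivative_scaleR[OF radial_has_derivative[OF z this[unfolded s_def]] has_derivative_ident]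
    show ?thesis by (simp add: X_def[abs_def] s_def)
  qed
  have "endo_trace (\<lambda>u. fs_conn z u (X z)) = - ((2 + 2 * real CARD('n)) * s)"
  proof -
    have hX: "herm (X z) z = of_real (\<psi> s * s\<^sup>2)" by (simp add: X_def herm_simps herm_self s_def)
    have eq: "of_real (\<psi> s * s\<^sup>2) / of_real (1 + s\<^sup>2) = (of_real s :: complex)"
      unfolding of_real_divide[symmetric] of_real_eq_iff
      using s one_plus_norm_sq_pos[of s] by (simp add: \<psi>_def power2_eq_square)
    have "(\<lambda>u. fs_conn z u (X z)) =
        (\<lambda>u. - (herm u z *s ((1 / aff z) *s X z) + (herm (X z) z / aff z) *s u))"
      by (simp add: fs_conn_def fun_eq_iff vec_eq_iff)
    then have "endo_trace (\<lambda>u. fs_conn z u (X z)) =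
        - (2 * Re (herm ((1 / aff z) *s X z) z) + 2 * real CARD('n) * Re (herm (X z) z / aff z))"
      by (simp only: endo_trace_minus endo_trace_add endo_trace_herm_left endo_trace_scale of_nat_mult of_nat_numeral)
    also have "herm ((1 / aff z) *s X z) z = herm (X z) z / aff z" by (simp add: herm_simps)
    also have "herm (X z) z / aff z = of_real s" unfolding hX aff_eq s_def[symmetric] by (rule eq)
    finally show ?thesis by (simp add: algebra_simps)
  qed
  moreover have "endo_trace (\<lambda>u. \<psi> s *\<^sub>R u + (((1 - 1 / s\<^sup>2) / s) *\<^sub>R z \<bullet> u) *\<^sub>R z) =
      \<psi> s * (2 * real CARD('n)) + (1 - 1 / s\<^sup>2) / s * s\<^sup>2"
    unfolding endo_trace_add endo_trace_scaleR endo_trace_ident endo_trace_rank_one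
    by (simp add: s_def power2_norm_eq_inner mult.commute)
  ultimately have "laplace_beltrami fs_metric f z =
      \<psi> s * (2 * real CARD('n)) + (1 - 1 / s\<^sup>2) / s * s\<^sup>2 - (2 + 2 * real CARD('n)) * s"
    using fs.laplace_beltrami_eq[OF V(1) _ V(2) grad DX] by simp
  also have "\<dots> = (2 * real CARD('n) - 1) / s - s"
    using s by (simp add: \<psi>_def power2_eq_square field_simps)
  finally show ?thesis by (simp add: s_def)
qed

section \<open>The projective plane around its base point\<close>

definition CP2_origin :: "complex ^ 3 ^ 3" where
  "CP2_origin = proj (aff_emb 1 0)"

lemma CP2_origin_in_CP2: "CP2_origin \<in> CP2"
  by (simp add: CP2_origin_def proj_in_CP2 aff_emb_nonzero)

lemma rdist_CP2_origin: "rdist projective_plane CP2_origin (proj (aff_emb 1 z)) = arctan (norm z)"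
proof -
  have "proj (aff_emb 1 z) \<bullet> CP2_origin = 1 / (1 + (norm z)\<^sup>2)"
    by (simp add: CP2_origin_def inner_proj aff_emb_nonzero herm_aff_emb norm_aff_emb herm_simps)
  then have "2 * (proj (aff_emb 1 z) \<bullet> CP2_origin) - 1 = (1 - (norm z)\<^sup>2) / (1 + (norm z)\<^sup>2)"
    using one_plus_norm_sq_pos[of z] by (simp add: field_simps)
  then show ?thesis
    by (simp add: rdist_projective_plane CP2_origin_in_CP2 proj_in_CP2 aff_emb_nonzero fs_dist_def arccos_arctan_norm)
qed

lemma rdist_CP2_origin_cinv:
  "x \<in> ball 0 (sqrt 3) \<Longrightarrow> (rdist projective_plane CP2_origin \<circ> cinv (affine_chart 1)) x = arctan (norm x)"
  unfolding o_def by (simp only: cinv_affine_chart rdist_CP2_origin)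

text \<open>The bound 1/3 makes the first diagonal entry 1 / (1 + |z|^2) exceed 3/4, so the other
  two entries are below the threshold 1/4.\<close>

lemma chart_at_near_CP2_origin:
  assumes "(norm z)\<^sup>2 < 1 / 3"
  shows "chart_at projective_plane (proj (aff_emb 1 z)) = affine_chart 1"
proof -
  let ?P = "proj (aff_emb 1 z)"
  have P: "?P \<in> CP2" by (simp add: proj_in_CP2 aff_emb_nonzero)
  have P1: "Re (?P $ 1 $ 1) > 3 / 4"
    unfolding proj_aff_emb_diag using assms one_plus_norm_sq_pos[of z] by (simp add: field_simps)
  have "Re (?P $ (1 + 1) $ (1 + 1)) < 1 / 4" "Re (?P $ (1 + 2) $ (1 + 2)) < 1 / 4"
    using CP2_diag(2)[OF P] P1 CP2_diag(1)[OF P, of "1 + 1"] CP2_diag(1)[OF P, of "1 + 2"]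
    unfolding sum_index3[of _ 1] by linarith+
  then have "i = 1" if "?P \<in> cdom (affine_chart i)" for i
    using index3_cases[of i 1] that unfolding cdom_affine_chart by auto
  then show ?thesis
    using chart_at_projective_plane[OF P] by metis
qed

lemma laplacian_CP2_origin:
  assumes "z \<noteq> 0" "(norm z)\<^sup>2 < 1 / 3"
  shows "laplacian projective_plane (rdist projective_plane CP2_origin) (proj (aff_emb 1 z)) = 3 / norm z - norm z"
proof -
  have "norm z < sqrt 3" using assms(2) by (intro real_less_rsqrt) simp
  then have z: "z \<in> ball 0 (sqrt 3) - {0}" using assms(1) by simp
  have "laplace_beltrami fs_metric (rdist projective_plane CP2_origin \<circ> cinv (affine_chart 1)) z =
      (2 * real CARD(2) - 1) / norm z - norm z"
    by (rule laplace_beltrami_fs_arctan_norm[OF _ z _ rdist_CP2_origin_cinv]) auto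
  then show ?thesis
    by (simp add: laplacian_def chart_at_near_CP2_origin[OF assms(2)] Let_def affine_coord_proj_aff_emb)
qed

lemma smooth_near_CP2_origin:
  assumes "z \<noteq> 0" "(norm z)\<^sup>2 < 1 / 3"
  shows "smooth_near projective_plane (rdist projective_plane CP2_origin) (proj (aff_emb 1 z))"
proof -
  have nz: "norm z < sqrt 3" using assms(2) by (intro real_less_rsqrt) simp
  define V where "V = ball (0 :: complex ^ 2) (sqrt 3) - {0}"
  have V: "open V" unfolding V_def by auto
  have "smooth_on (\<lambda>x. arctan (sqrt ((norm x)\<^sup>2))) V"
    by (intro smooth_on_arctan smooth_on_sqrt smooth_on_norm_power2 V) (simp add: V_def)
  then have "smooth_on (rdist projective_plane CP2_origin \<circ> cinv (affine_chart 1)) V"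
    by (rule smooth_on_cong[OF _ V]) (subst rdist_CP2_origin_cinv, auto simp: V_def)
  moreover have "V \<subseteq> cran (affine_chart 1)" unfolding cran_affine_chart by (auto simp: V_def)
  moreover have "coord (affine_chart 1) (proj (aff_emb 1 z)) \<in> V"
    using assms(1) nz by (simp add: affine_coord_proj_aff_emb V_def)
  moreover have "affine_chart 1 \<in> atlas projective_plane" by (simp add: projective_plane_def)
  moreover have "proj (aff_emb 1 z) \<in> cdom (affine_chart 1)" using nz by (simp add: proj_aff_emb_in_cdom_iff)
  ultimately show ?thesis
    unfolding smooth_near_def using V by blast
qed

text \<open>Expansions at \<open>0\<close> of the two Laplacians, multiplied by \<open>r\<close>, for \<open>r = 2 a / sqrt 3\<close>.  They
  agree up to the fourth order.\<close>

lemma laplacian_gap: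
  "\<forall>\<^sub>F a in at_right 0. 3 / tan (2 * a / sqrt 3) - tan (2 * a / sqrt 3)
    < (1 + 2 * a * (1 / tan a - tan a)) / (2 * a / sqrt 3)"
proof -
  define c where "c = 2 / sqrt 3"
  have c: "c > 0" "c\<^sup>2 = 4 / 3" by (simp_all add: c_def power_divide)
  have c4: "c ^ 4 = 16 / 9" "c ^ 6 = 64 / 27"
    using arg_cong[OF c(2), of "\<lambda>x. x ^ 2"] arg_cong[OF c(2), of "\<lambda>x. x ^ 3"]
    by (simp_all add: power_divide flip: power_mult)
  define N where "N t = t * (3 / tan t - tan t)" for t :: real
  define M where "M a = 1 + 2 * a * (1 / tan a - tan a)" for a :: real
  \<comment> \<open>The coefficients are 1/3, 1/45 and 2/945 times the power sums 6, 18, 66 of 4, 1,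
    1. In \<open>RM\<close> the power sums are 6, 18, 54, and r^2 = 4 a^2 / 3 is
    substituted.\<close>
  define RN where "RN t = (N t - (3 - 2 * t ^ 2 - 2 / 5 * t ^ 4 - 132 / 945 * t ^ 6)) / t ^ 6" for t
  define RM where "RM a = (M a - (3 - 8 / 3 * a ^ 2 - 32 / 45 * a ^ 4 - 256 / 945 * a ^ 6)) / a ^ 6" for a
  have RN0: "(RN \<longlongrightarrow> 0) (at_right 0)" unfolding RN_def N_def by real_asymp
  have RM0: "(RM \<longlongrightarrow> 0) (at_right 0)" unfolding RM_def M_def by real_asymp
  have "filterlim (\<lambda>a. c * a) (at_right 0) (at_right 0)" using c(1) by real_asymp
  from filterlim_compose[OF RN0 this] have RN1: "((\<lambda>a. RN (c * a)) \<longlongrightarrow> 0) (at_right 0)" .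
  have "\<forall>\<^sub>F a in at_right (0::real). a > 0" by (rule eventually_at_right_less)
  moreover have "\<forall>\<^sub>F a in at_right 0. RN (c * a) < 1 / 100"
    by (rule order_tendstoD(2)[OF RN1]) simp
  moreover have "\<forall>\<^sub>F a in at_right 0. RM a > - 1 / 100"
    by (rule order_tendstoD(1)[OF RM0]) simp
  ultimately show ?thesis
  proof eventually_elim
    case (elim a)
    have "N (c * a) = 3 - 2 * (c * a) ^ 2 - 2 / 5 * (c * a) ^ 4 - 132 / 945 * (c * a) ^ 6 + RN (c * a) * (c * a) ^ 6"
      using elim c(1) by (simp add: RN_def)
    also have "\<dots> = 3 - 8 / 3 * a ^ 2 - 32 / 45 * a ^ 4 - (132 / 945 * (64 / 27) - RN (c * a) * (64 / 27)) * a ^ 6"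
      by (simp add: power_mult_distrib c(2) c4 algebra_simps)
    also have "\<dots> < 3 - 8 / 3 * a ^ 2 - 32 / 45 * a ^ 4 - (256 / 945 - RM a) * a ^ 6"
    proof -
      \<comment> \<open>The coefficients differ by about 0.060, more than the two errors 64/2700 and
        1/100 together.\<close>
      have "256 / 945 - RM a < 132 / 945 * (64 / 27) - RN (c * a) * (64 / 27)" using elim by simp
      then show ?thesis using elim by simp
    qed
    also have "\<dots> = M a" using elim by (simp add: RM_def field_simps)
    finally have "N (c * a) < M a" .
    then have "N (c * a) / (c * a) < M a / (c * a)" using elim c(1) by (intro divide_strict_right_mono) auto
    moreover have "N (c * a) / (c * a) = 3 / tan (c * a) - tan (c * a)" using elim c(1) by (simp add: N_def)
    moreover have "c * a = 2 * a / sqrt 3" by (simp add: c_def)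
    ultimately show ?case by (simp add: M_def)
  qed
qed

lemma not_pointwise_laplacian_comparison:
  assumes "\<epsilon> > 0"
  shows "\<not> pointwise_laplacian_comparison_within \<epsilon> sphere_product 0 projective_plane CP2_origin"
proof
  assume comp: "pointwise_laplacian_comparison_within \<epsilon> sphere_product 0 projective_plane CP2_origin"
  have "\<forall>\<^sub>F a in at_right (0::real). (tan (2 * a / sqrt 3))\<^sup>2 < 1 / 3"
    by (rule order_tendstoD(2)[where y = 0]) (real_asymp, simp)
  moreover have "\<forall>\<^sub>F a in at_right (0::real). 2 * a / sqrt 3 < min \<epsilon> 1"
    using assms by (intro order_tendstoD(2)[where y = 0]) (real_asymp, simp)
  moreover have "\<forall>\<^sub>F a in at_right (0::real). a > 0" by (rule eventually_at_right_less)
  moreover have "\<forall>\<^sub>F a in at_right (0::real). a < 1" by (rule eventually_at_right_real[of 0 1, THEN eventually_mono]) auto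
  moreover note laplacian_gap
  ultimately have "\<forall>\<^sub>F a in at_right (0::real). (tan (2 * a / sqrt 3))\<^sup>2 < 1 / 3 \<and> 2 * a / sqrt 3 < min \<epsilon> 1 \<and>
      a > 0 \<and> a < 1 \<and> 3 / tan (2 * a / sqrt 3) - tan (2 * a / sqrt 3)
        < (1 + 2 * a * (1 / tan a - tan a)) / (2 * a / sqrt 3)"
    by eventually_elim simp
  then obtain a :: real where a: "0 < a" "a < 1" and small: "(tan (2 * a / sqrt 3))\<^sup>2 < 1 / 3" "2 * a / sqrt 3 < min \<epsilon> 1"
    and gap: "3 / tan (2 * a / sqrt 3) - tan (2 * a / sqrt 3) < (1 + 2 * a * (1 / tan a - tan a)) / (2 * a / sqrt 3)"
    using eventually_happens'[OF trivial_limit_at_right_real] by blast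
  define t where "t = 2 * a / sqrt 3"
  have t: "0 < t" "t < 1" "t < \<epsilon>" using a small by (simp_all add: t_def)
  have pi: "1 < pi / 2" using pi_gt3 by simp
  have tan_pos: "tan a > 0" "tan t > 0" using a t pi by (auto intro!: tan_gt_zero)
  \<comment> \<open>Both components of \<open>x\<close> have factor distance \<open>a\<close>, so
    \<open>x\<close> lies at distance \<open>t\<close>. Near the origin of the plane, distance and
    Laplacian depend only on the norm of the coordinate, so any \<open>z\<close> of norm
    \<open>tan t\<close> serves.\<close>
  define x :: "complex ^ 2" where "x = (\<chi> i. of_real (tan a))"
  define z :: "complex ^ 2" where "z = (\<chi> i. if i = 1 then of_real (tan t) else 0)"
  define y where "y = proj (aff_emb 1 z)"
  have x: "norm (x $ i) = tan a" "x $ i \<noteq> 0" for i using tan_pos by (simp_all add: x_def)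
  have norm_z: "norm z = tan t"
    using tan_pos by (simp add: z_def norm_vec_def L2_set_def sum_2)
  then have z: "z \<noteq> 0" "(norm z)\<^sup>2 < 1 / 3" using tan_pos small by (auto simp: t_def)
  have arctan: "arctan (tan a) = a" "arctan (tan t) = t" using a t pi by (auto intro!: arctan_tan)
  have rx: "rdist sphere_product 0 x = t"
  proof -
    have "rdist sphere_product 0 x = sqrt (2 / 3) * sqrt (2 * a\<^sup>2)"
      by (simp add: rdist_sphere_product sphere_product_radius_def L2_set_def x arctan sum_2)
    also have "\<dots> = sqrt ((2 * a)\<^sup>2 / 3)" by (simp add: power_mult_distrib flip: real_sqrt_mult)
    also have "\<dots> = t" unfolding real_sqrt_divide real_sqrt_abs using a by (simp add: t_def)
    finally show ?thesis .
  qed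
  have ry: "rdist projective_plane CP2_origin y = t"
    by (simp add: y_def rdist_CP2_origin norm_z arctan)
  have "laplacian sphere_product (rdist sphere_product 0) x \<le> laplacian projective_plane (rdist projective_plane CP2_origin) y"
    using comp[unfolded pointwise_laplacian_comparison_within_def, rule_format, of x y] rx ry t
      smooth_near_sphere_product[OF x(2)] smooth_near_CP2_origin[OF z, folded y_def]
    by (simp add: y_def proj_in_CP2 aff_emb_nonzero) (simp add: sphere_product_def)
  then show False
    using gap by (simp add: laplacian_sphere_product[OF x(2)] laplacian_CP2_origin[OF z, folded y_def] rx norm_z x arctan sum_2 t_def mult.assoc)
qed

theorem mainTheorem3:
  shows "\<not> (\<forall>(K::real) (M :: (complex ^ 2, 2) cmanifold) p (N :: (complex ^ 3 ^ 3, 2) cmanifold) q.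
            kaehler_manifold M \<and> ricci_ge M K \<and> p \<in> points M \<and>
            complex_space_form N K \<and> q \<in> points N \<longrightarrow>
            (\<exists>\<epsilon>>0. pointwise_laplacian_comparison_within \<epsilon> M p N q))"
proof
  assume "\<forall>(K::real) (M :: (complex ^ 2, 2) cmanifold) p (N :: (complex ^ 3 ^ 3, 2) cmanifold) q.
            kaehler_manifold M \<and> ricci_ge M K \<and> p \<in> points M \<and>
            complex_space_form N K \<and> q \<in> points N \<longrightarrow>
            (\<exists>\<epsilon>>0. pointwise_laplacian_comparison_within \<epsilon> M p N q)"
  moreover have "0 \<in> points sphere_product" by (simp add: sphere_product_def)
  moreover have "CP2_origin \<in> points projective_plane" by (simp add: CP2_origin_in_CP2)
  ultimately obtain \<epsilon> where "\<epsilon> > 0"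
      "pointwise_laplacian_comparison_within \<epsilon> sphere_product 0 projective_plane CP2_origin"
    using kaehler_sphere_product ricci_ge_sphere_product complex_space_form_projective_plane by blast
  then show False using not_pointwise_laplacian_comparison by blast
qed

end
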